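(* Let $R=\Bbbk[\mathcal M]$ be a toric face ring. If ${}^{+}I_R^\bullet$ is quasi-isomorphic to the dualizing complex $D_R^\bullet$ of $R$, then $R$ is seminormal.
   Context: Seminormality: a reduced noetherian commutative ring $A$ with total quotient ring $Q(A)$ is seminormal if $a\in Q(A)$ and $a^2,a^3\in A$ imply $a\in A$. Toric face rings. Let $\Bbbk$ be a field and $\mathcal X$ a finite regular CW complex with the intersection property, with underlying space $X$: (1) $\emptyset\in\mathcal X$ (with $\dim\emptyset=-1$), and $X$ is the disjoint union of the cells $\sigma\in\mathcal X$; (2) for $\emptyset\ne\sigma\in\mathcal X$ there is a homeomorphism from a closed ball $\{x\in\mathbb R^i\mid\|x\|\le1\}$ onto the closure $\overline\sigma$ mapping the open ball onto $\sigma$; (3) each $\overline\sigma$ is a union of cells; (4) for $\sigma,\tau\in\mathcal X$ there is $\upsilon\in\mathcal X$ (possibly $\emptyset$) with $\overline\upsilon=\overline\sigma\cap\overline\tau$. Write $\sigma\ge\tau$ if $\overline\sigma\supset\tau$. A conical complex on $\mathcal X$ assigns to each $\sigma\in\mathcal X$ the Euclidean space $\mathbf E_\sigma=\mathbb R^{\dim\sigma+1}$ and a polyhedral cone $C_\sigma\subset\mathbf E_\sigma$ with $\dim C_\sigma=\dim\sigma+1$ containing no line, and to each $\sigma\ge\tau$ an injection $\iota_{\sigma,\tau}:C_\tau\to C_\sigma$ which lifts to a linear map $\tilde\iota_{\sigma,\tau}:\mathbf E_\tau\to\mathbf E_\sigma$, such that $\iota_{\sigma,\tau}(C_\tau)$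 is a face of $C_\sigma$, each face of $C_\sigma$ equals $\iota_{\sigma,\tau}(C_\tau)$ for exactly one $\tau\le\sigma$, $\iota_{\sigma,\sigma}=\mathrm{Id}$, and $\iota_{\sigma,\tau}\circ\iota_{\tau,\upsilon}=\iota_{\sigma,\upsilon}$ for $\sigma\ge\tau\ge\upsilon$. Let $\mathbf L_\sigma=\mathbb Z^{\dim\sigma+1}\subset\mathbf E_\sigma$; it is assumed that $\tilde\iota_{\sigma,\tau}(\mathbf L_\tau)=\tilde\iota_{\sigma,\tau}(\mathbf E_\tau)\cap\mathbf L_\sigma$ for all $\sigma\ge\tau$. A monoidal complex $\mathcal M=\{\mathbf M_\sigma\}_{\sigma\in\mathcal X}$ consists of finitely generated submonoids $\mathbf M_\sigma\subset\mathbf L_\sigma\cap C_\sigma$ with $\mathbb R_{\ge0}\mathbf M_\sigma=C_\sigma$ such that $\iota_{\sigma,\tau}$ induces an isomorphism $\mathbf M_\tau\cong\mathbf M_\sigma\cap\iota_{\sigma,\tau}(C_\tau)$ for all $\sigma\ge\tau$. Let $|\mathcal M|=\varinjlim_{\sigma}\mathbf M_\sigma$ (direct limit of sets along the $\iota_{\sigma,\tau}$), so $\mathbf M_\sigma\subset|\mathcal M|$. For $a,b\in|\mathcal M|$, $a+b$ exists iff $a,b\in\mathbf M_\sigma$ for some $\sigma$, and then it is the sum in $\mathbf M_\sigma$. The toric face ring is $\Bbbk[\mathcal M]=\bigoplus_{a\in|\mathcal M|}\Bbbk x^a$ with $x^ax^b=x^{a+b}$ if $a+b$ exists and $x^ax^b=0$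 otherwise. Put $d=\dim\Bbbk[\mathcal M]=\dim\mathcal X+1$. The ideal $\mathfrak p_\sigma=(x^a\mid a\in|\mathcal M|\setminus\mathbf M_\sigma)$ is prime and $R/\mathfrak p_\sigma\cong\Bbbk[\mathbf M_\sigma]$, the affine semigroup ring. The complex ${}^{+}I_R^\bullet$. Let $\mathbb Z\mathbf M_\sigma\subset\mathbf L_\sigma$ be the subgroup generated by $\mathbf M_\sigma$; $\Bbbk[\mathbb Z\mathbf M_\sigma\cap C_\sigma]$ is the normalization of $\Bbbk[\mathbf M_\sigma]$, and is an $R$-module via $R\to R/\mathfrak p_\sigma\cong\Bbbk[\mathbf M_\sigma]$. Put ${}^{+}I_R^{-i}=\bigoplus_{\sigma\in\mathcal X,\ \dim\sigma=i-1}\Bbbk[\mathbb Z\mathbf M_\sigma\cap C_\sigma]$ for $0\le i\le d$, with differential ${}^{+}I_R^{-i}\to{}^{+}I_R^{-i+1}$ given by $\partial(y)=\sum_{\tau\le\sigma,\ \dim\tau=i-2}\varepsilon(\sigma,\tau)\,\pi_{\tau,\sigma}(y)$ for $y\in\Bbbk[\mathbb Z\mathbf M_\sigma\cap C_\sigma]$, where $\varepsilon$ is an incidence function of $\mathcal X$ (with values $\pm1$ on such pairs) and $\pi_{\tau,\sigma}:\Bbbk[\mathbb Z\mathbf M_\sigma\cap C_\sigma]\to\Bbbk[\mathbb Z\mathbf M_\tau\cap C_\tau]$ is the natural surjection (identity on monomials with exponent in $\mathbb Z\mathbf M_\tau\cap C_\tau$, zero on other monomials). $D_R^\bullet$ is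 the dualizing complex of $R$, normalized so that $D_R^{-i}=\bigoplus_{\mathfrak p\in\mathrm{Spec}R,\ \dim R/\mathfrak p=i}E(R/\mathfrak p)$, where $E(-)$ is the injective envelope. "Quasi-isomorphic" means isomorphic in the derived category of $R$-modules. *)

theory Defs
  imports
    "HOL-Analysis.Abstract_Euclidean_Space"
    "HOL-Library.Extended_Nat"
    "HOL-Library.Function_Algebras"
    "HOL-Algebra.QuotRing"
    "HOL-Algebra.Module"
    "HOL-Algebra.Ring_Divisibility"
begin

section \<open>Commutative algebra\<close>

subsection \<open>Total quotient rings and seminormality\<close>

definition nonzerodivisors :: "('a, 'e) ring_scheme \<Rightarrow> 'a set" where
  "nonzerodivisors A =
    {s \<in> carrier A. \<forall>a \<in> carrier A. a \<otimes>\<^bsub>A\<^esub> s = \<zero>\<^bsub>A\<^esub> \<longrightarrow> a = \<zero>\<^bsub>A\<^esub>}"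

text \<open>The fraction a/s, as the class of all pairs (b, t) with b s = a t. No auxiliary multiplier
  is needed, because all denominators are nonzerodivisors.\<close>

definition frac :: "('a, 'e) ring_scheme \<Rightarrow> 'a \<Rightarrow> 'a \<Rightarrow> ('a \<times> 'a) set" where
  "frac A a s =
    {(b, t). b \<in> carrier A \<and> t \<in> nonzerodivisors A \<and> b \<otimes>\<^bsub>A\<^esub> s = a \<otimes>\<^bsub>A\<^esub> t}"

definition total_quotient_ring :: "('a, 'e) ring_scheme \<Rightarrow> ('a \<times> 'a) set ring" where
  "total_quotient_ring A =
    \<lparr>carrier = {frac A a s | a s. a \<in> carrier A \<and> s \<in> nonzerodivisors A},
     monoid.mult = (\<lambda>P Q. \<Union>(a, s) \<in> P. \<Union>(b, t) \<in> Q. frac A (a \<otimes>\<^bsub>A\<^esub> b) (s \<otimes>\<^bsub>A\<^esub> t)),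
     one = frac A \<one>\<^bsub>A\<^esub> \<one>\<^bsub>A\<^esub>,
     zero = frac A \<zero>\<^bsub>A\<^esub> \<one>\<^bsub>A\<^esub>,
     add = (\<lambda>P Q. \<Union>(a, s) \<in> P. \<Union>(b, t) \<in> Q.
       frac A (a \<otimes>\<^bsub>A\<^esub> t \<oplus>\<^bsub>A\<^esub> b \<otimes>\<^bsub>A\<^esub> s) (s \<otimes>\<^bsub>A\<^esub> t))\<rparr>"

definition reduced_ring :: "('a, 'e) ring_scheme \<Rightarrow> bool" where
  "reduced_ring A \<longleftrightarrow>
    (\<forall>a \<in> carrier A. \<forall>n::nat. a [^]\<^bsub>A\<^esub> n = \<zero>\<^bsub>A\<^esub> \<longrightarrow> a = \<zero>\<^bsub>A\<^esub>)"

definition seminormal :: "('a, 'e) ring_scheme \<Rightarrow> bool" where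
  "seminormal A \<longleftrightarrow>
    cring A \<and> reduced_ring A \<and> noetherian_ring A \<and>
    (let Q = total_quotient_ring A; A' = {frac A a \<one>\<^bsub>A\<^esub> | a. a \<in> carrier A}
     in \<forall>q \<in> carrier Q. q [^]\<^bsub>Q\<^esub> (2::nat) \<in> A' \<and> q [^]\<^bsub>Q\<^esub> (3::nat) \<in> A' \<longrightarrow> q \<in> A')"

subsection \<open>Krull dimension\<close>

definition krull_dim :: "('a, 'e) ring_scheme \<Rightarrow> enat" where
  "krull_dim A = Sup {enat n | n.
    \<exists>P :: nat \<Rightarrow> 'a set. (\<forall>i\<le>n. primeideal (P i) A) \<and> (\<forall>i<n. P i \<subset> P (Suc i))}"

subsection \<open>Modules\<close>

text \<open>The library's module records contain a ring multiplication and a one, which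
  \<^locale>\<open>module\<close> leaves unconstrained; they are left unspecified where they have no meaning.\<close>

definition make_module ::
    "'m set \<Rightarrow> 'm \<Rightarrow> ('m \<Rightarrow> 'm \<Rightarrow> 'm) \<Rightarrow> ('r \<Rightarrow> 'm \<Rightarrow> 'm) \<Rightarrow> ('r, 'm) module" where
  "make_module S z a s =
    \<lparr>carrier = S, monoid.mult = undefined, one = undefined, zero = z, add = a, smult = s\<rparr>"

definition ring_as_module :: "('r, 'e) ring_scheme \<Rightarrow> ('r, 'r) module" where
  "ring_as_module R = make_module (carrier R) \<zero>\<^bsub>R\<^esub> (add R) (monoid.mult R)"

definition mod_hom ::
    "('r, 'e) ring_scheme \<Rightarrow> ('r, 'm) module \<Rightarrow> ('r, 'n) module \<Rightarrow> ('m \<Rightarrow> 'n) set" where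
  "mod_hom R M N = {f \<in> carrier M \<rightarrow> carrier N.
    (\<forall>x \<in> carrier M. \<forall>y \<in> carrier M. f (x \<oplus>\<^bsub>M\<^esub> y) = f x \<oplus>\<^bsub>N\<^esub> f y) \<and>
    (\<forall>r \<in> carrier R. \<forall>x \<in> carrier M. f (r \<odot>\<^bsub>M\<^esub> x) = r \<odot>\<^bsub>N\<^esub> f x)}"

definition mod_isomorphic ::
    "('r, 'e) ring_scheme \<Rightarrow> ('r, 'm) module \<Rightarrow> ('r, 'n) module \<Rightarrow> bool" where
  "mod_isomorphic R M N \<longleftrightarrow> (\<exists>f \<in> mod_hom R M N. bij_betw f (carrier M) (carrier N))"

text \<open>The module K/N, for submodules N and K of M with N contained in K.\<close>

definition subquotient :: "('r, 'm) module \<Rightarrow> 'm set \<Rightarrow> 'm set \<Rightarrow> ('r, 'm set) module" where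
  "subquotient M K N =
    make_module ((\<lambda>x. N +>\<^bsub>M\<^esub> x) ` K) N (\<lambda>P Q. P <+>\<^bsub>M\<^esub> Q)
      (\<lambda>r P. \<Union>x \<in> P. N +>\<^bsub>M\<^esub> (r \<odot>\<^bsub>M\<^esub> x))"

definition direct_sum :: "'i set \<Rightarrow> ('i \<Rightarrow> ('r, 'm) module) \<Rightarrow> ('r, 'i \<Rightarrow> 'm) module" where
  "direct_sum I N =
    make_module
      {f \<in> (\<Pi>\<^sub>E i \<in> I. carrier (N i)). finite {i \<in> I. f i \<noteq> \<zero>\<^bsub>N i\<^esub>}}
      (\<lambda>i\<in>I. \<zero>\<^bsub>N i\<^esub>)
      (\<lambda>f g. \<lambda>i\<in>I. f i \<oplus>\<^bsub>N i\<^esub> g i)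
      (\<lambda>r f. \<lambda>i\<in>I. r \<odot>\<^bsub>N i\<^esub> f i)"

definition fin_gen_module :: "('r, 'e) ring_scheme \<Rightarrow> ('r, 'm) module \<Rightarrow> bool" where
  "fin_gen_module R M \<longleftrightarrow> module R M \<and>
    (\<exists>S \<subseteq> carrier M. finite S \<and> (\<forall>N. submodule N R M \<and> S \<subseteq> N \<longrightarrow> N = carrier M))"

text \<open>HOL cannot quantify over all modules (of all types) here, so the lifting property is stated for
  modules whose elements are taken from the element type of R. These include R and all its
  ideals, so by Baer's criterion nothing is lost.\<close>

definition injective_module :: "('r, 'e) ring_scheme \<Rightarrow> ('r, 'm) module \<Rightarrow> bool" where
  "injective_module R E \<longleftrightarrow> module R E \<and>
    (\<forall>(A :: ('r, 'r) module) (B :: ('r, 'r) module) f g.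
      module R A \<and> module R B \<and>
      f \<in> mod_hom R A B \<and> inj_on f (carrier A) \<and> g \<in> mod_hom R A E \<longrightarrow>
      (\<exists>h \<in> mod_hom R B E. \<forall>a \<in> carrier A. h (f a) = g a))"

definition injective_envelope ::
    "('r, 'e) ring_scheme \<Rightarrow> ('r, 'n) module \<Rightarrow> ('r, 'm) module \<Rightarrow> bool" where
  "injective_envelope R N E \<longleftrightarrow> injective_module R E \<and>
    (\<exists>j \<in> mod_hom R N E. inj_on j (carrier N) \<and>
      (\<forall>S. submodule S R E \<and> S \<noteq> {\<zero>\<^bsub>E\<^esub>} \<longrightarrow> S \<inter> j ` carrier N \<noteq> {\<zero>\<^bsub>E\<^esub>}))"

section \<open>Complexes and the derived category\<close>

record ('r, 'm) cochain =
  obj :: "int \<Rightarrow> ('r, 'm) module"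
  diff :: "int \<Rightarrow> 'm \<Rightarrow> 'm"

definition cochain_complex :: "('r, 'e) ring_scheme \<Rightarrow> ('r, 'm) cochain \<Rightarrow> bool" where
  "cochain_complex R X \<longleftrightarrow>
    (\<forall>i. module R (obj X i) \<and> diff X i \<in> mod_hom R (obj X i) (obj X (i + 1)) \<and>
      (\<forall>x \<in> carrier (obj X i). diff X (i + 1) (diff X i x) = \<zero>\<^bsub>obj X (i + 2)\<^esub>))"

definition cocycles :: "('r, 'm) cochain \<Rightarrow> int \<Rightarrow> 'm set" where
  "cocycles X i = {x \<in> carrier (obj X i). diff X i x = \<zero>\<^bsub>obj X (i + 1)\<^esub>}"

definition coboundaries :: "('r, 'm) cochain \<Rightarrow> int \<Rightarrow> 'm set" where
  "coboundaries X i = diff X (i - 1) ` carrier (obj X (i - 1))"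

definition cohomology :: "('r, 'm) cochain \<Rightarrow> int \<Rightarrow> ('r, 'm set) module" where
  "cohomology X i = subquotient (obj X i) (cocycles X i) (coboundaries X i)"

definition chain_map :: "('r, 'e) ring_scheme \<Rightarrow> ('r, 'm) cochain \<Rightarrow> ('r, 'n) cochain \<Rightarrow>
    (int \<Rightarrow> 'm \<Rightarrow> 'n) \<Rightarrow> bool" where
  "chain_map R X Y f \<longleftrightarrow> cochain_complex R X \<and> cochain_complex R Y \<and>
    (\<forall>i. f i \<in> mod_hom R (obj X i) (obj Y i) \<and>
      (\<forall>x \<in> carrier (obj X i). f (i + 1) (diff X i x) = diff Y i (f i x)))"

definition quasi_iso :: "('r, 'e) ring_scheme \<Rightarrow> ('r, 'm) cochain \<Rightarrow> ('r, 'n) cochain \<Rightarrow>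
    (int \<Rightarrow> 'm \<Rightarrow> 'n) \<Rightarrow> bool" where
  "quasi_iso R X Y f \<longleftrightarrow> chain_map R X Y f \<and>
    (\<forall>i. bij_betw (\<lambda>K. (f i ` K) <+>\<^bsub>obj Y i\<^esub> coboundaries Y i)
      (carrier (cohomology X i)) (carrier (cohomology Y i)))"

text \<open>By the calculus of fractions, two complexes are isomorphic in the derived category iff they
  are joined by a roof of two quasi-isomorphisms. The element type of the apex is a parameter; as
  an assumption with a free type variable, this predicate amounts to the existence of a roof with an
  arbitrary apex.\<close>

definition derived_isomorphic :: "'z itself \<Rightarrow> ('r, 'e) ring_scheme \<Rightarrow>
    ('r, 'm) cochain \<Rightarrow> ('r, 'n) cochain \<Rightarrow> bool" where
  "derived_isomorphic _ R X Y \<longleftrightarrow>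
    (\<exists>(Z :: ('r, 'z) cochain) f g. quasi_iso R Z X f \<and> quasi_iso R Z Y g)"

definition ring_as_complex :: "('r, 'e) ring_scheme \<Rightarrow> ('r, 'r) cochain" where
  "ring_as_complex R =
    \<lparr>obj = (\<lambda>i. if i = 0 then ring_as_module R
       else make_module {\<zero>\<^bsub>R\<^esub>} \<zero>\<^bsub>R\<^esub> (add R) (monoid.mult R)),
     diff = (\<lambda>i x. \<zero>\<^bsub>R\<^esub>)\<rparr>"

definition hom_obj :: "('r, 'e) ring_scheme \<Rightarrow> ('r, 'm) cochain \<Rightarrow> ('r, 'n) cochain \<Rightarrow>
    int \<Rightarrow> ('r, int \<Rightarrow> 'm \<Rightarrow> 'n) module" where
  "hom_obj R X Y n =
    make_module
      {f. \<forall>i. f i \<in> mod_hom R (obj X i) (obj Y (i + n)) \<inter> extensional (carrier (obj X i))}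
      (\<lambda>i. \<lambda>x\<in>carrier (obj X i). \<zero>\<^bsub>obj Y (i + n)\<^esub>)
      (\<lambda>f g. \<lambda>i. \<lambda>x\<in>carrier (obj X i). f i x \<oplus>\<^bsub>obj Y (i + n)\<^esub> g i x)
      (\<lambda>r f. \<lambda>i. \<lambda>x\<in>carrier (obj X i). r \<odot>\<^bsub>obj Y (i + n)\<^esub> f i x)"

definition hom_diff :: "('r, 'm) cochain \<Rightarrow> ('r, 'n) cochain \<Rightarrow>
    int \<Rightarrow> (int \<Rightarrow> 'm \<Rightarrow> 'n) \<Rightarrow> (int \<Rightarrow> 'm \<Rightarrow> 'n)" where
  "hom_diff X Y n f = (\<lambda>i. \<lambda>x\<in>carrier (obj X i).
    let u = diff Y (i + n) (f i x); v = f (i + 1) (diff X i x)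
    in if even n then u \<ominus>\<^bsub>obj Y (i + n + 1)\<^esub> v else u \<oplus>\<^bsub>obj Y (i + n + 1)\<^esub> v)"

definition hom_complex :: "('r, 'e) ring_scheme \<Rightarrow> ('r, 'm) cochain \<Rightarrow> ('r, 'n) cochain \<Rightarrow>
    ('r, int \<Rightarrow> 'm \<Rightarrow> 'n) cochain" where
  "hom_complex R X Y = \<lparr>obj = hom_obj R X Y, diff = hom_diff X Y\<rparr>"

definition homothety :: "('r, 'm) cochain \<Rightarrow> int \<Rightarrow> 'r \<Rightarrow> (int \<Rightarrow> 'm \<Rightarrow> 'm)" where
  "homothety X n r = (\<lambda>i. \<lambda>x\<in>carrier (obj X i).
    if n = 0 then r \<odot>\<^bsub>obj X i\<^esub> x else \<zero>\<^bsub>obj X (i + n)\<^esub>)"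

text \<open>Since the modules of D are injective and D is bounded, the Hom complex below computes
  the derived endomorphisms RHom(D, D).\<close>

definition dualizing_complex :: "('r, 'e) ring_scheme \<Rightarrow> ('r, 'd) cochain \<Rightarrow> bool" where
  "dualizing_complex R D \<longleftrightarrow>
    cochain_complex R D \<and>
    (\<exists>b. \<forall>i. \<bar>i\<bar> > b \<longrightarrow> carrier (obj D i) = {\<zero>\<^bsub>obj D i\<^esub>}) \<and>
    (\<forall>i. injective_module R (obj D i)) \<and>
    (\<forall>i. fin_gen_module R (cohomology D i)) \<and>
    quasi_iso R (ring_as_complex R) (hom_complex R D D) (homothety D)"

definition normalized_dualizing_complex ::
    "('r, 'e) ring_scheme \<Rightarrow> ('r, 'd) cochain \<Rightarrow> bool" where
  "normalized_dualizing_complex R D \<longleftrightarrow>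
    dualizing_complex R D \<and>
    (\<forall>i. let P = {p. primeideal p R \<and> (\<exists>n. krull_dim (R Quot p) = enat n \<and> int n = i)}
      in \<exists>E :: 'r set \<Rightarrow> ('r, 'd) module.
        (\<forall>p \<in> P. injective_envelope R
          (subquotient (ring_as_module R) (carrier R) p) (E p)) \<and>
        mod_isomorphic R (obj D (- i)) (direct_sum P E))"

section \<open>Finite regular CW complexes\<close>

definition closed_ball :: "nat \<Rightarrow> (nat \<Rightarrow> real) set" where
  "closed_ball n = {x \<in> topspace (Euclidean_space n). (\<Sum>i<n. (x i)\<^sup>2) \<le> 1}"

definition open_ball :: "nat \<Rightarrow> (nat \<Rightarrow> real) set" where
  "open_ball n = {x \<in> topspace (Euclidean_space n). (\<Sum>i<n. (x i)\<^sup>2) < 1}"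

definition is_cell :: "'x topology \<Rightarrow> 'x set \<Rightarrow> nat \<Rightarrow> bool" where
  "is_cell T \<sigma> n \<longleftrightarrow>
    (\<exists>h. homeomorphic_map (subtopology (Euclidean_space n) (closed_ball n))
        (subtopology T (T closure_of \<sigma>)) h \<and>
      h ` open_ball n = \<sigma>)"

definition cell_dim :: "'x topology \<Rightarrow> 'x set \<Rightarrow> int" where
  "cell_dim T \<sigma> = (if \<sigma> = {} then -1 else int (THE n. is_cell T \<sigma> n))"

definition cell_le :: "'x topology \<Rightarrow> 'x set \<Rightarrow> 'x set \<Rightarrow> bool" where
  "cell_le T \<tau> \<sigma> \<longleftrightarrow> \<tau> \<subseteq> T closure_of \<sigma>"

locale regular_CW_complex =
  fixes T :: "'x topology" and X :: "'x set set"
  assumes hausdorff: "Hausdorff_space T"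
    and finite_cells: "finite X"
    and empty_cell: "{} \<in> X"
    and cells_cover: "\<Union>X = topspace T"
    and cells_disjoint: "pairwise disjnt X"
    and cells: "\<And>\<sigma>. \<sigma> \<in> X \<Longrightarrow> \<sigma> \<noteq> {} \<Longrightarrow> \<exists>n. is_cell T \<sigma> n"
    and closure_union: "\<And>\<sigma>. \<sigma> \<in> X \<Longrightarrow> \<exists>Y \<subseteq> X. T closure_of \<sigma> = \<Union>Y"
    and intersection_property: "\<And>\<sigma> \<tau>. \<sigma> \<in> X \<Longrightarrow> \<tau> \<in> X \<Longrightarrow>
      \<exists>\<upsilon> \<in> X. T closure_of \<upsilon> = T closure_of \<sigma> \<inter> T closure_of \<tau>"

text \<open>The sum in the last clause has exactly two terms if \<tau> is a face of \<sigma>.\<close>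

definition incidence_function ::
    "'x topology \<Rightarrow> 'x set set \<Rightarrow> ('x set \<Rightarrow> 'x set \<Rightarrow> int) \<Rightarrow> bool" where
  "incidence_function T X \<epsilon> \<longleftrightarrow>
    (\<forall>\<sigma> \<in> X. \<forall>\<tau> \<in> X. \<epsilon> \<sigma> \<tau> \<in> {-1, 0, 1} \<and>
      (\<epsilon> \<sigma> \<tau> \<noteq> 0 \<longleftrightarrow> cell_le T \<tau> \<sigma> \<and> cell_dim T \<tau> = cell_dim T \<sigma> - 1)) \<and>
    (\<forall>\<sigma> \<in> X. cell_dim T \<sigma> = 0 \<longrightarrow> \<epsilon> \<sigma> {} = 1) \<and>
    (\<forall>\<sigma> \<in> X. \<forall>\<tau> \<in> X. cell_le T \<tau> \<sigma> \<and> cell_dim T \<tau> = cell_dim T \<sigma> - 2 \<longrightarrow>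
      (\<Sum>\<upsilon> \<in> {\<upsilon> \<in> X. cell_le T \<tau> \<upsilon> \<and> cell_le T \<upsilon> \<sigma> \<and> cell_dim T \<upsilon> = cell_dim T \<sigma> - 1}.
        \<epsilon> \<sigma> \<upsilon> * \<epsilon> \<upsilon> \<tau>) = 0)"

section \<open>Conical and monoidal complexes\<close>

text \<open>Real n-space consists of the sequences that vanish from index n on, as in
  \<^const>\<open>Euclidean_space\<close>.\<close>

definition scale :: "real \<Rightarrow> (nat \<Rightarrow> real) \<Rightarrow> nat \<Rightarrow> real" where
  "scale c x = (\<lambda>i. c * x i)"

definition real_space :: "nat \<Rightarrow> (nat \<Rightarrow> real) set" where
  "real_space n = {x. \<forall>i\<ge>n. x i = 0}"

definition int_lattice :: "nat \<Rightarrow> (nat \<Rightarrow> real) set" where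
  "int_lattice n = {x \<in> real_space n. \<forall>i. x i \<in> \<int>}"

definition polyhedral_cone :: "nat \<Rightarrow> (nat \<Rightarrow> real) set \<Rightarrow> bool" where
  "polyhedral_cone n C \<longleftrightarrow>
    (\<exists>A. finite A \<and> C = {x \<in> real_space n. \<forall>a \<in> A. 0 \<le> (\<Sum>i<n. a i * x i)})"

definition cone_face :: "nat \<Rightarrow> (nat \<Rightarrow> real) set \<Rightarrow> (nat \<Rightarrow> real) set \<Rightarrow> bool" where
  "cone_face n C F \<longleftrightarrow>
    (\<exists>a. (\<forall>x \<in> C. 0 \<le> (\<Sum>i<n. a i * x i)) \<and> F = {x \<in> C. (\<Sum>i<n. a i * x i) = 0})"

definition linear_between ::
    "(nat \<Rightarrow> real) set \<Rightarrow> (nat \<Rightarrow> real) set \<Rightarrow> ((nat \<Rightarrow> real) \<Rightarrow> nat \<Rightarrow> real) \<Rightarrow> bool" where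
  "linear_between V W f \<longleftrightarrow> f \<in> V \<rightarrow> W \<and>
    (\<forall>x \<in> V. \<forall>y \<in> V. f (x + y) = f x + f y) \<and> (\<forall>c. \<forall>x \<in> V. f (scale c x) = scale c (f x))"

definition is_submonoid :: "(nat \<Rightarrow> real) set \<Rightarrow> bool" where
  "is_submonoid S \<longleftrightarrow> 0 \<in> S \<and> (\<forall>x \<in> S. \<forall>y \<in> S. x + y \<in> S)"

definition is_subgroup :: "(nat \<Rightarrow> real) set \<Rightarrow> bool" where
  "is_subgroup S \<longleftrightarrow> 0 \<in> S \<and> (\<forall>x \<in> S. \<forall>y \<in> S. x - y \<in> S)"

definition is_convex_cone :: "(nat \<Rightarrow> real) set \<Rightarrow> bool" where
  "is_convex_cone S \<longleftrightarrow> is_submonoid S \<and> (\<forall>c\<ge>0. \<forall>x \<in> S. scale c x \<in> S)"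

definition fin_gen_submonoid :: "(nat \<Rightarrow> real) set \<Rightarrow> bool" where
  "fin_gen_submonoid S \<longleftrightarrow> (\<exists>G. finite G \<and> S = is_submonoid hull G)"

definition cell_rank :: "'x topology \<Rightarrow> 'x set \<Rightarrow> nat" where
  "cell_rank T \<sigma> = nat (cell_dim T \<sigma> + 1)"

abbreviation cell_space :: "'x topology \<Rightarrow> 'x set \<Rightarrow> (nat \<Rightarrow> real) set" where
  "cell_space T \<sigma> \<equiv> real_space (cell_rank T \<sigma>)"

abbreviation cell_lattice :: "'x topology \<Rightarrow> 'x set \<Rightarrow> (nat \<Rightarrow> real) set" where
  "cell_lattice T \<sigma> \<equiv> int_lattice (cell_rank T \<sigma>)"

text \<open>Since each cone spans its ambient space, the linear lift of an injection between cones is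
  unique; \<open>\<iota>\<close> denotes the lifted maps, whose restrictions to the cones are the injections.
  The values of \<open>\<iota> \<sigma> \<tau>\<close> outside the space of \<open>\<tau>\<close> are irrelevant.\<close>

locale conical_complex = regular_CW_complex T X
  for T :: "'x topology" and X :: "'x set set" +
  fixes C :: "'x set \<Rightarrow> (nat \<Rightarrow> real) set"
    and \<iota> :: "'x set \<Rightarrow> 'x set \<Rightarrow> (nat \<Rightarrow> real) \<Rightarrow> (nat \<Rightarrow> real)"
  assumes cone_polyhedral: "\<And>\<sigma>. \<sigma> \<in> X \<Longrightarrow> polyhedral_cone (cell_rank T \<sigma>) (C \<sigma>)"
    and cone_dim: "\<And>\<sigma>. \<sigma> \<in> X \<Longrightarrow> vector_space.dim scale (C \<sigma>) = cell_rank T \<sigma>"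
    and cone_no_line: "\<And>\<sigma> x. \<sigma> \<in> X \<Longrightarrow> x \<in> C \<sigma> \<Longrightarrow> - x \<in> C \<sigma> \<Longrightarrow> x = 0"
    and inj_linear: "\<And>\<sigma> \<tau>. \<sigma> \<in> X \<Longrightarrow> \<tau> \<in> X \<Longrightarrow> cell_le T \<tau> \<sigma> \<Longrightarrow>
      linear_between (cell_space T \<tau>) (cell_space T \<sigma>) (\<iota> \<sigma> \<tau>)"
    and inj_injective: "\<And>\<sigma> \<tau>. \<sigma> \<in> X \<Longrightarrow> \<tau> \<in> X \<Longrightarrow> cell_le T \<tau> \<sigma> \<Longrightarrow>
      inj_on (\<iota> \<sigma> \<tau>) (C \<tau>)"
    and inj_face: "\<And>\<sigma> \<tau>. \<sigma> \<in> X \<Longrightarrow> \<tau> \<in> X \<Longrightarrow> cell_le T \<tau> \<sigma> \<Longrightarrow>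
      cone_face (cell_rank T \<sigma>) (C \<sigma>) (\<iota> \<sigma> \<tau> ` C \<tau>)"
    and face_unique: "\<And>\<sigma> F. \<sigma> \<in> X \<Longrightarrow> cone_face (cell_rank T \<sigma>) (C \<sigma>) F \<Longrightarrow>
      \<exists>!\<tau>. \<tau> \<in> X \<and> cell_le T \<tau> \<sigma> \<and> F = \<iota> \<sigma> \<tau> ` C \<tau>"
    and inj_id: "\<And>\<sigma> x. \<sigma> \<in> X \<Longrightarrow> x \<in> C \<sigma> \<Longrightarrow> \<iota> \<sigma> \<sigma> x = x"
    and inj_comp: "\<And>\<sigma> \<tau> \<upsilon> x. \<sigma> \<in> X \<Longrightarrow> \<tau> \<in> X \<Longrightarrow> \<upsilon> \<in> X \<Longrightarrow>
      cell_le T \<tau> \<sigma> \<Longrightarrow> cell_le T \<upsilon> \<tau> \<Longrightarrow> x \<in> C \<upsilon> \<Longrightarrow> \<iota> \<sigma> \<tau> (\<iota> \<tau> \<upsilon> x) = \<iota> \<sigma> \<upsilon> x"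
    and inj_lattice: "\<And>\<sigma> \<tau>. \<sigma> \<in> X \<Longrightarrow> \<tau> \<in> X \<Longrightarrow> cell_le T \<tau> \<sigma> \<Longrightarrow>
      \<iota> \<sigma> \<tau> ` cell_lattice T \<tau> = \<iota> \<sigma> \<tau> ` cell_space T \<tau> \<inter> cell_lattice T \<sigma>"

text \<open>In the last assumption, additivity of the bijection comes from linearity of \<open>\<iota>\<close>.\<close>

locale monoidal_complex = conical_complex T X C \<iota>
  for T :: "'x topology" and X :: "'x set set"
    and C :: "'x set \<Rightarrow> (nat \<Rightarrow> real) set"
    and \<iota> :: "'x set \<Rightarrow> 'x set \<Rightarrow> (nat \<Rightarrow> real) \<Rightarrow> (nat \<Rightarrow> real)" +
  fixes M :: "'x set \<Rightarrow> (nat \<Rightarrow> real) set"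
  assumes monoid_fin_gen: "\<And>\<sigma>. \<sigma> \<in> X \<Longrightarrow> fin_gen_submonoid (M \<sigma>)"
    and monoid_subset: "\<And>\<sigma>. \<sigma> \<in> X \<Longrightarrow> M \<sigma> \<subseteq> cell_lattice T \<sigma> \<inter> C \<sigma>"
    and monoid_cone: "\<And>\<sigma>. \<sigma> \<in> X \<Longrightarrow> is_convex_cone hull M \<sigma> = C \<sigma>"
    and monoid_iso: "\<And>\<sigma> \<tau>. \<sigma> \<in> X \<Longrightarrow> \<tau> \<in> X \<Longrightarrow> cell_le T \<tau> \<sigma> \<Longrightarrow>
      bij_betw (\<iota> \<sigma> \<tau>) (M \<tau>) (M \<sigma> \<inter> \<iota> \<sigma> \<tau> ` C \<tau>)"

section \<open>The toric face ring\<close>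

type_synonym 'x exponent = "('x set \<times> (nat \<Rightarrow> real)) set"

text \<open>The direct limit is the disjoint union of the monoids modulo the equivalence relation generated
  by identifying each element with its images; \<open>lim_class\<close> is the canonical map into it.\<close>

definition lim_rel ::
    "'x topology \<Rightarrow> 'x set set \<Rightarrow> ('x set \<Rightarrow> 'x set \<Rightarrow> (nat \<Rightarrow> real) \<Rightarrow> (nat \<Rightarrow> real)) \<Rightarrow>
     ('x set \<Rightarrow> (nat \<Rightarrow> real) set) \<Rightarrow> (('x set \<times> (nat \<Rightarrow> real)) \<times> ('x set \<times> (nat \<Rightarrow> real))) set" where
  "lim_rel T X \<iota> M =
    (let r = {((\<tau>, a), (\<sigma>, \<iota> \<sigma> \<tau> a)) | \<sigma> \<tau> a. \<sigma> \<in> X \<and> \<tau> \<in> X \<and> cell_le T \<tau> \<sigma> \<and> a \<in> M \<tau>}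
     in (r \<union> r\<inverse>)\<^sup>*)"

definition lim_set ::
    "'x topology \<Rightarrow> 'x set set \<Rightarrow> ('x set \<Rightarrow> 'x set \<Rightarrow> (nat \<Rightarrow> real) \<Rightarrow> (nat \<Rightarrow> real)) \<Rightarrow>
     ('x set \<Rightarrow> (nat \<Rightarrow> real) set) \<Rightarrow> 'x exponent set" where
  "lim_set T X \<iota> M = (SIGMA \<sigma>:X. M \<sigma>) // lim_rel T X \<iota> M"

definition lim_class ::
    "'x topology \<Rightarrow> 'x set set \<Rightarrow> ('x set \<Rightarrow> 'x set \<Rightarrow> (nat \<Rightarrow> real) \<Rightarrow> (nat \<Rightarrow> real)) \<Rightarrow>
     ('x set \<Rightarrow> (nat \<Rightarrow> real) set) \<Rightarrow> 'x set \<Rightarrow> (nat \<Rightarrow> real) \<Rightarrow> 'x exponent" where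
  "lim_class T X \<iota> M \<sigma> a = lim_rel T X \<iota> M `` {(\<sigma>, a)}"

text \<open>The partial addition as a relation: the sum of a and b exists and equals c.\<close>

definition lim_sum ::
    "'x topology \<Rightarrow> 'x set set \<Rightarrow> ('x set \<Rightarrow> 'x set \<Rightarrow> (nat \<Rightarrow> real) \<Rightarrow> (nat \<Rightarrow> real)) \<Rightarrow>
     ('x set \<Rightarrow> (nat \<Rightarrow> real) set) \<Rightarrow> 'x exponent \<Rightarrow> 'x exponent \<Rightarrow> 'x exponent \<Rightarrow> bool" where
  "lim_sum T X \<iota> M a b c \<longleftrightarrow>
    (\<exists>\<sigma> \<in> X. \<exists>x \<in> M \<sigma>. \<exists>y \<in> M \<sigma>. a = lim_class T X \<iota> M \<sigma> x \<and>
      b = lim_class T X \<iota> M \<sigma> y \<and> c = lim_class T X \<iota> M \<sigma> (x + y))"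

text \<open>An element is represented by its finitely supported coefficient function.\<close>

definition toric_face_ring ::
    "'x topology \<Rightarrow> 'x set set \<Rightarrow> ('x set \<Rightarrow> 'x set \<Rightarrow> (nat \<Rightarrow> real) \<Rightarrow> (nat \<Rightarrow> real)) \<Rightarrow>
     ('x set \<Rightarrow> (nat \<Rightarrow> real) set) \<Rightarrow> ('x exponent \<Rightarrow> 'k::field) ring" where
  "toric_face_ring T X \<iota> M =
    \<lparr>carrier = {f. finite {a. f a \<noteq> 0} \<and> {a. f a \<noteq> 0} \<subseteq> lim_set T X \<iota> M},
     monoid.mult = (\<lambda>f g c.
       \<Sum>(a, b) \<in> {(a, b). f a \<noteq> 0 \<and> g b \<noteq> 0 \<and> lim_sum T X \<iota> M a b c}. f a * g b),
     one = (\<lambda>c. if c = lim_class T X \<iota> M {} 0 then 1 else 0),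
     zero = (\<lambda>c. 0),
     add = (\<lambda>f g c. f c + g c)\<rparr>"

section \<open>The complex of normalizations\<close>

definition semigroup_ring :: "(nat \<Rightarrow> real) set \<Rightarrow> ((nat \<Rightarrow> real) \<Rightarrow> 'k::field) ring" where
  "semigroup_ring S =
    \<lparr>carrier = {f. finite {a. f a \<noteq> 0} \<and> {a. f a \<noteq> 0} \<subseteq> S},
     monoid.mult = (\<lambda>f g c. \<Sum>(a, b) \<in> {(a, b). f a \<noteq> 0 \<and> g b \<noteq> 0 \<and> a + b = c}. f a * g b),
     one = (\<lambda>c. if c = 0 then 1 else 0),
     zero = (\<lambda>c. 0),
     add = (\<lambda>f g c. f c + g c)\<rparr>"

text \<open>The exponents of the normalization of the semigroup ring of \<open>M \<sigma>\<close>.\<close>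

definition normal_monoid :: "('x set \<Rightarrow> (nat \<Rightarrow> real) set) \<Rightarrow>
    ('x set \<Rightarrow> (nat \<Rightarrow> real) set) \<Rightarrow> 'x set \<Rightarrow> (nat \<Rightarrow> real) set" where
  "normal_monoid C M \<sigma> = (is_subgroup hull M \<sigma>) \<inter> C \<sigma>"

text \<open>The surjection from the toric face ring onto the semigroup ring of \<open>M \<sigma>\<close>: it kills the monomials
  with exponent outside \<open>M \<sigma>\<close>.\<close>

definition cell_projection ::
    "'x topology \<Rightarrow> 'x set set \<Rightarrow> ('x set \<Rightarrow> 'x set \<Rightarrow> (nat \<Rightarrow> real) \<Rightarrow> (nat \<Rightarrow> real)) \<Rightarrow>
     ('x set \<Rightarrow> (nat \<Rightarrow> real) set) \<Rightarrow> 'x set \<Rightarrow>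
     ('x exponent \<Rightarrow> 'k::field) \<Rightarrow> (nat \<Rightarrow> real) \<Rightarrow> 'k" where
  "cell_projection T X \<iota> M \<sigma> r =
    (\<lambda>a. if a \<in> M \<sigma> then r (lim_class T X \<iota> M \<sigma> a) else 0)"

definition normalization_module ::
    "'x topology \<Rightarrow> 'x set set \<Rightarrow> ('x set \<Rightarrow> (nat \<Rightarrow> real) set) \<Rightarrow>
     ('x set \<Rightarrow> 'x set \<Rightarrow> (nat \<Rightarrow> real) \<Rightarrow> (nat \<Rightarrow> real)) \<Rightarrow> ('x set \<Rightarrow> (nat \<Rightarrow> real) set) \<Rightarrow>
     'x set \<Rightarrow> ('x exponent \<Rightarrow> 'k::field, (nat \<Rightarrow> real) \<Rightarrow> 'k) module" where
  "normalization_module T X C \<iota> M \<sigma> =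
    (let S = semigroup_ring (normal_monoid C M \<sigma>)
     in make_module (carrier S) \<zero>\<^bsub>S\<^esub> (add S) (\<lambda>r y. cell_projection T X \<iota> M \<sigma> r \<otimes>\<^bsub>S\<^esub> y))"

definition face_projection ::
    "('x set \<Rightarrow> (nat \<Rightarrow> real) set) \<Rightarrow> ('x set \<Rightarrow> 'x set \<Rightarrow> (nat \<Rightarrow> real) \<Rightarrow> (nat \<Rightarrow> real)) \<Rightarrow>
     ('x set \<Rightarrow> (nat \<Rightarrow> real) set) \<Rightarrow> 'x set \<Rightarrow> 'x set \<Rightarrow>
     ((nat \<Rightarrow> real) \<Rightarrow> 'k::field) \<Rightarrow> (nat \<Rightarrow> real) \<Rightarrow> 'k" where
  "face_projection C \<iota> M \<tau> \<sigma> y =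
    (\<lambda>c. if c \<in> normal_monoid C M \<tau> then y (\<iota> \<sigma> \<tau> c) else 0)"

text \<open>In cohomological degree j the summands are indexed by the cells of dimension - j - 1.\<close>

definition plus_I ::
    "'x topology \<Rightarrow> 'x set set \<Rightarrow> ('x set \<Rightarrow> (nat \<Rightarrow> real) set) \<Rightarrow>
     ('x set \<Rightarrow> 'x set \<Rightarrow> (nat \<Rightarrow> real) \<Rightarrow> (nat \<Rightarrow> real)) \<Rightarrow> ('x set \<Rightarrow> (nat \<Rightarrow> real) set) \<Rightarrow>
     ('x set \<Rightarrow> 'x set \<Rightarrow> int) \<Rightarrow>
     ('x exponent \<Rightarrow> 'k::field, 'x set \<Rightarrow> (nat \<Rightarrow> real) \<Rightarrow> 'k) cochain" where
  "plus_I T X C \<iota> M \<epsilon> =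
    \<lparr>obj = (\<lambda>j. direct_sum {\<sigma> \<in> X. cell_dim T \<sigma> = - j - 1} (normalization_module T X C \<iota> M)),
     diff = (\<lambda>j y. \<lambda>\<tau>\<in>{\<tau> \<in> X. cell_dim T \<tau> = - j - 2}. \<lambda>c.
       \<Sum>\<sigma> \<in> {\<sigma> \<in> X. cell_dim T \<sigma> = - j - 1 \<and> cell_le T \<tau> \<sigma>}.
         of_int (\<epsilon> \<sigma> \<tau>) * face_projection C \<iota> M \<tau> \<sigma> (y \<sigma>) c)\<rparr>"

end

theory Submission
  imports Defs "HOL-Algebra.Subrings" "HOL-Library.Poly_Mapping"
begin

text \<open>Write I for the complex of normalizations and let q = a/s be a fraction with q^2 = b and
  q^3 = c in R. Although q need not lie in R, multiplication by q makes sense on I. Indeed I is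
  built from the normal domains k[Z M \<sigma> \<inter> C \<sigma>], each of which contains a unique element q \<sigma> whose
  square and cube are the images of b and c (\<open>cell_root_exists\<close>, \<open>square_cube_unique\<close>). Uniqueness
  makes these elements compatible with passing to a face, so that together they define an R-linear
  chain endomorphism \<alpha> of I with s \<alpha> = a (\<open>root_action_chain_map\<close>, \<open>smult_root_action\<close>).

  On the other hand, the ring of endomorphisms of a dualizing complex D in the derived category is
  R itself. If I and D are isomorphic there, then \<alpha> corresponds to multiplication by some r \<in> R,
  and s \<alpha> = a forces s r = a (\<open>dualizing_complex_divides\<close>). Hence q = r lies in R.

  Three pieces of theory carry this. First, morphisms into D in the derived category are homotopy
  classes of chain maps, because D is a bounded complex of injective modules. This is deduced from
  Baer's criterion: it makes every chain map to D from the acyclic mapping cone of a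
  quasi-isomorphism null homotopic (\<open>homotopy_lift\<close>, \<open>homotopy_unique\<close>). Secondly, k[Z M \<sigma> \<inter> C \<sigma>] contains every
  fraction whose square it contains; this is shown by a long division that terminates because the
  exponents of an almost integral fraction are confined to a bounded part of the cone
  (\<open>divides_if_almost_integral\<close>). Thirdly, R is reduced, as it embeds into a product of the domains
  k[M \<sigma>], and it is noetherian by Hilbert's basis theorem.\<close>

section \<open>Modules and their homomorphisms\<close>

lemma (in abelian_group) eq_if_minus_zero:
  assumes "x \<ominus> y = \<zero>" "x \<in> carrier G" "y \<in> carrier G"
  shows "x = y"
  using assms by (metis a_inv_closed minus_eq minus_equality minus_minus)

lemma (in abelian_group) neg_zero: "\<ominus> \<zero> = \<zero>"
  by (rule minus_equality) auto

lemma (in abelian_group) add_add_neg: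
  assumes "x \<in> carrier G" "y \<in> carrier G"
  shows "y \<oplus> (x \<oplus> \<ominus> y) = x"
  using assms by (simp add: a_lcomm[of y x] r_neg)

lemma (in abelian_group) minus_minus_cancel:
  assumes "x \<in> carrier G" "y \<in> carrier G" "z \<in> carrier G"
  shows "((x \<oplus> (y \<oplus> z)) \<ominus> z) \<ominus> y = x"
  using assms by (simp add: a_assoc minus_eq r_neg2 r_neg)

lemma make_module_simps [simp]:
  "carrier (make_module S z a s) = S" "zero (make_module S z a s) = z"
  "add (make_module S z a s) = a" "smult (make_module S z a s) = s"
  by (simp_all add: make_module_def)

lemma make_moduleI:
  assumes "cring R" and z: "z \<in> S" and cl: "\<And>x y. x \<in> S \<Longrightarrow> y \<in> S \<Longrightarrow> a x y \<in> S"
    and "\<And>x y w. x \<in> S \<Longrightarrow> y \<in> S \<Longrightarrow> w \<in> S \<Longrightarrow> a (a x y) w = a x (a y w)"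
    and "\<And>x y. x \<in> S \<Longrightarrow> y \<in> S \<Longrightarrow> a x y = a y x" and "\<And>x. x \<in> S \<Longrightarrow> a z x = x"
    and "\<And>x. x \<in> S \<Longrightarrow> \<exists>y\<in>S. a y x = z"
    and "\<And>r x. r \<in> carrier R \<Longrightarrow> x \<in> S \<Longrightarrow> s r x \<in> S"
    and "\<And>r t x. r \<in> carrier R \<Longrightarrow> t \<in> carrier R \<Longrightarrow> x \<in> S \<Longrightarrow>
      s (r \<oplus>\<^bsub>R\<^esub> t) x = a (s r x) (s t x)"
    and "\<And>r x y. r \<in> carrier R \<Longrightarrow> x \<in> S \<Longrightarrow> y \<in> S \<Longrightarrow> s r (a x y) = a (s r x) (s r y)"
    and "\<And>r t x. r \<in> carrier R \<Longrightarrow> t \<in> carrier R \<Longrightarrow> x \<in> S \<Longrightarrow> s (r \<otimes>\<^bsub>R\<^esub> t) x = s r (s t x)"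
    and "\<And>x. x \<in> S \<Longrightarrow> s \<one>\<^bsub>R\<^esub> x = x"
  shows "module R (make_module S z a s)"
proof (rule moduleI)
  show "cring R" by fact
  show "abelian_group (make_module S z a s)"
    by (rule abelian_groupI) (use assms in auto)
qed (use assms in auto)

lemma ideal_make_module:
  assumes "cring R" "ideal I R"
  shows "module R (make_module I \<zero>\<^bsub>R\<^esub> (add R) (monoid.mult R))"
proof -
  interpret cring R by fact
  interpret I: ideal I R by fact
  show ?thesis
  proof (rule make_moduleI)
    fix x assume x: "x \<in> I"
    show "\<exists>y\<in>I. y \<oplus>\<^bsub>R\<^esub> x = \<zero>\<^bsub>R\<^esub>"
      using x I.a_inv_closed by (intro bexI[of _ "\<ominus>\<^bsub>R\<^esub> x"]) (auto simp: l_neg I.a_Hcarr)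
  qed (use assms I.a_Hcarr in \<open>auto simp: a_ac m_assoc l_distr r_distr I.I_l_closed\<close>)
qed

lemma ring_as_module_module:
  assumes "cring R" shows "module R (ring_as_module R)"
proof -
  interpret cring R by fact
  show ?thesis
    unfolding ring_as_module_def by (rule ideal_make_module) (use assms oneideal in auto)
qed

lemma ring_as_module_simps [simp]:
  "carrier (ring_as_module R) = carrier R" "zero (ring_as_module R) = zero R"
  "add (ring_as_module R) = add R" "smult (ring_as_module R) = monoid.mult R"
  by (simp_all add: ring_as_module_def)

lemma mod_homI:
  assumes "\<And>x. x \<in> carrier M \<Longrightarrow> f x \<in> carrier N"
    and "\<And>x y. x \<in> carrier M \<Longrightarrow> y \<in> carrier M \<Longrightarrow> f (x \<oplus>\<^bsub>M\<^esub> y) = f x \<oplus>\<^bsub>N\<^esub> f y"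
    and "\<And>r x. r \<in> carrier R \<Longrightarrow> x \<in> carrier M \<Longrightarrow> f (r \<odot>\<^bsub>M\<^esub> x) = r \<odot>\<^bsub>N\<^esub> f x"
  shows "f \<in> mod_hom R M N"
  using assms by (auto simp: mod_hom_def)

lemma mod_hom_closed: "f \<in> mod_hom R M N \<Longrightarrow> x \<in> carrier M \<Longrightarrow> f x \<in> carrier N"
  and mod_hom_add: "f \<in> mod_hom R M N \<Longrightarrow> x \<in> carrier M \<Longrightarrow> y \<in> carrier M \<Longrightarrow>
    f (x \<oplus>\<^bsub>M\<^esub> y) = f x \<oplus>\<^bsub>N\<^esub> f y"
  and mod_hom_smult: "f \<in> mod_hom R M N \<Longrightarrow> r \<in> carrier R \<Longrightarrow> x \<in> carrier M \<Longrightarrow>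
    f (r \<odot>\<^bsub>M\<^esub> x) = r \<odot>\<^bsub>N\<^esub> f x"
  by (auto simp: mod_hom_def)

lemma mod_hom_zero:
  assumes "f \<in> mod_hom R M N" "module R M" "module R N"
  shows "f \<zero>\<^bsub>M\<^esub> = \<zero>\<^bsub>N\<^esub>"
proof -
  interpret M: module R M by fact
  interpret N: module R N by fact
  have "f (\<zero>\<^bsub>R\<^esub> \<odot>\<^bsub>M\<^esub> \<zero>\<^bsub>M\<^esub>) = \<zero>\<^bsub>R\<^esub> \<odot>\<^bsub>N\<^esub> f \<zero>\<^bsub>M\<^esub>"
    by (rule mod_hom_smult[OF assms(1)]) auto
  then show ?thesis using mod_hom_closed[OF assms(1)] by simp
qed

lemma mod_hom_uminus:
  assumes "f \<in> mod_hom R M N" "module R M" "module R N" "x \<in> carrier M"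
  shows "f (\<ominus>\<^bsub>M\<^esub> x) = \<ominus>\<^bsub>N\<^esub> f x"
proof -
  interpret M: module R M by fact
  interpret N: module R N by fact
  have "f ((\<ominus>\<^bsub>R\<^esub> \<one>\<^bsub>R\<^esub>) \<odot>\<^bsub>M\<^esub> x) = (\<ominus>\<^bsub>R\<^esub> \<one>\<^bsub>R\<^esub>) \<odot>\<^bsub>N\<^esub> f x"
    by (rule mod_hom_smult[OF assms(1)]) (use assms in auto)
  then show ?thesis
    using mod_hom_closed[OF assms(1,4)] assms(4) by (simp add: M.smult_l_minus N.smult_l_minus)
qed

lemma mod_hom_minus:
  assumes "f \<in> mod_hom R M N" "module R M" "module R N" "x \<in> carrier M" "y \<in> carrier M"
  shows "f (x \<ominus>\<^bsub>M\<^esub> y) = f x \<ominus>\<^bsub>N\<^esub> f y"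
proof -
  interpret M: module R M by fact
  interpret N: module R N by fact
  show ?thesis
    unfolding M.minus_eq N.minus_eq using assms
    by (simp add: mod_hom_add[OF assms(1)] mod_hom_uminus[OF assms(1-3)])
qed

lemma mod_hom_comp:
  assumes "f \<in> mod_hom R M N" "g \<in> mod_hom R N P"
  shows "(\<lambda>x. g (f x)) \<in> mod_hom R M P"
  using assms by (auto simp: mod_hom_def Pi_iff)

lemma mod_hom_plus:
  assumes "module R N" "f \<in> mod_hom R M N" "g \<in> mod_hom R M N"
  shows "(\<lambda>x. f x \<oplus>\<^bsub>N\<^esub> g x) \<in> mod_hom R M N"
proof -
  interpret N: module R N by fact
  show ?thesis
    by (rule mod_homI) (use assms(2,3) in
      \<open>auto simp: mod_hom_add mod_hom_smult mod_hom_closed N.M.a_ac N.smult_r_distr\<close>)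
qed

lemma mod_hom_scale:
  assumes "module R N" "f \<in> mod_hom R M N" "s \<in> carrier R"
  shows "(\<lambda>x. s \<odot>\<^bsub>N\<^esub> f x) \<in> mod_hom R M N"
proof -
  interpret N: module R N by fact
  show ?thesis
    by (rule mod_homI) (use assms(2,3) in
      \<open>auto simp: mod_hom_add mod_hom_smult mod_hom_closed N.smult_r_distr N.R.m_comm
        simp flip: N.smult_assoc1\<close>)
qed

lemma mod_hom_neg:
  assumes "module R N" "f \<in> mod_hom R M N"
  shows "(\<lambda>x. \<ominus>\<^bsub>N\<^esub> f x) \<in> mod_hom R M N"
proof -
  interpret N: module R N by fact
  show ?thesis
    by (rule mod_homI) (use assms(2) in
      \<open>auto simp: mod_hom_add mod_hom_smult mod_hom_closed N.smult_r_minus N.M.minus_add\<close>)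
qed

lemma mod_hom_diff:
  assumes "module R N" "f \<in> mod_hom R M N" "g \<in> mod_hom R M N"
  shows "(\<lambda>x. f x \<ominus>\<^bsub>N\<^esub> g x) \<in> mod_hom R M N"
proof -
  interpret N: module R N by fact
  show ?thesis
    unfolding N.minus_eq using assms by (intro mod_hom_plus mod_hom_neg)
qed

lemma mod_hom_zero_map:
  assumes "module R N" shows "(\<lambda>x. \<zero>\<^bsub>N\<^esub>) \<in> mod_hom R M N"
proof -
  interpret N: module R N by fact
  show ?thesis by (rule mod_homI) auto
qed

section \<open>Extending homomorphisms into injective modules\<close>

text \<open>Graphs of R-linear maps from a submodule of B to E; by linearity, the last clause makes
  them single-valued. For graphs, unions of chains are plain unions, and a map on the image of
  another map can be given by its set of pairs before it is known to be well defined.\<close>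

definition linear_graph ::
    "('r, 'e) ring_scheme \<Rightarrow> ('r, 'm) module \<Rightarrow> ('r, 'n) module \<Rightarrow> ('m \<times> 'n) set \<Rightarrow> bool" where
  "linear_graph R B E G \<longleftrightarrow> G \<subseteq> carrier B \<times> carrier E \<and> (\<zero>\<^bsub>B\<^esub>, \<zero>\<^bsub>E\<^esub>) \<in> G \<and>
    (\<forall>x u y v. (x, u) \<in> G \<longrightarrow> (y, v) \<in> G \<longrightarrow> (x \<oplus>\<^bsub>B\<^esub> y, u \<oplus>\<^bsub>E\<^esub> v) \<in> G) \<and>
    (\<forall>r\<in>carrier R. \<forall>x u. (x, u) \<in> G \<longrightarrow> (r \<odot>\<^bsub>B\<^esub> x, r \<odot>\<^bsub>E\<^esub> u) \<in> G) \<and>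
    (\<forall>u. (\<zero>\<^bsub>B\<^esub>, u) \<in> G \<longrightarrow> u = \<zero>\<^bsub>E\<^esub>)"

lemma linear_graph_uminus:
  assumes "module R B" "module R E" "linear_graph R B E G" "(x, u) \<in> G"
  shows "(\<ominus>\<^bsub>B\<^esub> x, \<ominus>\<^bsub>E\<^esub> u) \<in> G"
proof -
  interpret B: module R B by fact
  interpret E: module R E by fact
  have "x \<in> carrier B" "u \<in> carrier E" using assms by (auto simp: linear_graph_def)
  moreover have "((\<ominus>\<^bsub>R\<^esub> \<one>\<^bsub>R\<^esub>) \<odot>\<^bsub>B\<^esub> x, (\<ominus>\<^bsub>R\<^esub> \<one>\<^bsub>R\<^esub>) \<odot>\<^bsub>E\<^esub> u) \<in> G"
    using assms B.R.a_inv_closed[OF B.R.one_closed] unfolding linear_graph_def by blast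
  ultimately show ?thesis by (simp add: B.smult_l_minus E.smult_l_minus)
qed

lemma linear_graph_unique:
  assumes "module R B" "module R E" "linear_graph R B E G" "(x, u) \<in> G" "(x, v) \<in> G"
  shows "u = v"
proof -
  interpret B: module R B by fact
  interpret E: module R E by fact
  have c: "x \<in> carrier B" "u \<in> carrier E" "v \<in> carrier E"
    using assms by (auto simp: linear_graph_def)
  have "(x \<oplus>\<^bsub>B\<^esub> \<ominus>\<^bsub>B\<^esub> x, u \<oplus>\<^bsub>E\<^esub> \<ominus>\<^bsub>E\<^esub> v) \<in> G"
    using linear_graph_uminus[OF assms(1-3,5)] assms(3,4) unfolding linear_graph_def by blast
  then have "u \<oplus>\<^bsub>E\<^esub> \<ominus>\<^bsub>E\<^esub> v = \<zero>\<^bsub>E\<^esub>"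
    using assms(3) c by (simp add: B.M.r_neg linear_graph_def)
  then show ?thesis using c
    by (metis E.M.a_inv_closed E.M.add.inv_closed E.M.minus_equality E.M.minus_minus)
qed

lemma linear_graph_Union:
  assumes "\<C> \<noteq> {}" and chain: "\<And>G H. G \<in> \<C> \<Longrightarrow> H \<in> \<C> \<Longrightarrow> G \<subseteq> H \<or> H \<subseteq> G"
    and lin: "\<And>G. G \<in> \<C> \<Longrightarrow> linear_graph R B E G"
  shows "linear_graph R B E (\<Union>\<C>)"
  unfolding linear_graph_def
proof (intro conjI allI impI ballI)
  show "\<Union>\<C> \<subseteq> carrier B \<times> carrier E" using lin unfolding linear_graph_def by blast
  show "(\<zero>\<^bsub>B\<^esub>, \<zero>\<^bsub>E\<^esub>) \<in> \<Union>\<C>" using assms(1) lin unfolding linear_graph_def by blast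
next
  fix x u y v assume "(x, u) \<in> \<Union>\<C>" "(y, v) \<in> \<Union>\<C>"
  then obtain G H where GH: "G \<in> \<C>" "(x, u) \<in> G" "H \<in> \<C>" "(y, v) \<in> H" by blast
  then obtain K where "K \<in> \<C>" "(x, u) \<in> K" "(y, v) \<in> K" using chain[of G H] by blast
  then show "(x \<oplus>\<^bsub>B\<^esub> y, u \<oplus>\<^bsub>E\<^esub> v) \<in> \<Union>\<C>" using lin[of K] unfolding linear_graph_def by blast
next
  fix r x u assume "r \<in> carrier R" "(x, u) \<in> \<Union>\<C>"
  then show "(r \<odot>\<^bsub>B\<^esub> x, r \<odot>\<^bsub>E\<^esub> u) \<in> \<Union>\<C>" using lin unfolding linear_graph_def by blast
next
  fix u assume "(\<zero>\<^bsub>B\<^esub>, u) \<in> \<Union>\<C>"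
  then show "u = \<zero>\<^bsub>E\<^esub>" using lin unfolding linear_graph_def by blast
qed

lemma injective_moduleD:
  fixes A B :: "('r, 'r) module"
  assumes "injective_module R E" "module R A" "module R B"
    "f \<in> mod_hom R A B" "inj_on f (carrier A)" "g \<in> mod_hom R A E"
  shows "\<exists>h\<in>mod_hom R B E. \<forall>a\<in>carrier A. h (f a) = g a"
  using assms unfolding injective_module_def by blast

text \<open>One step of Baer's argument. The scalars r for which r b already lies in the domain form an
  ideal of R, and the graph gives a linear map on this ideal. Injectivity extends that map to R,
  and its value at 1 is a consistent image for b.\<close>

lemma linear_graph_extend:
  assumes inj: "injective_module R E" and B: "module R B" and G: "linear_graph R B E G"
    and b: "b \<in> carrier B"
  shows "\<exists>G'. linear_graph R B E G' \<and> G \<subseteq> G' \<and> b \<in> Domain G'"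
proof -
  interpret B: module R B by fact
  have E: "module R E" using inj by (simp add: injective_module_def)
  interpret E: module R E by fact
  note G' = G[unfolded linear_graph_def]
  have Gadd: "(x \<oplus>\<^bsub>B\<^esub> y, u \<oplus>\<^bsub>E\<^esub> v) \<in> G" if "(x, u) \<in> G" "(y, v) \<in> G" for x u y v
    using G' that by blast
  have Gsm: "(r \<odot>\<^bsub>B\<^esub> x, r \<odot>\<^bsub>E\<^esub> u) \<in> G" if "r \<in> carrier R" "(x, u) \<in> G" for r x u
    using G' that by blast
  have G0: "(\<zero>\<^bsub>B\<^esub>, \<zero>\<^bsub>E\<^esub>) \<in> G" using G' by blast
  note un = linear_graph_unique[OF B E G] linear_graph_uminus[OF B E G]
  have GB: "x \<in> carrier B" "u \<in> carrier E" if "(x, u) \<in> G" for x u using G' that by auto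
  define I where "I = {r \<in> carrier R. r \<odot>\<^bsub>B\<^esub> b \<in> Domain G}"
  have Isub: "I \<subseteq> carrier R" by (auto simp: I_def)
  have I: "ideal I R"
  proof (rule idealI)
    show "ring R" by (rule B.R.ring_axioms)
    show "subgroup I (add_monoid R)"
    proof
      show "\<one>\<^bsub>add_monoid R\<^esub> \<in> I" using G0 b by (auto simp: I_def)
    next
      fix x y assume "x \<in> I" "y \<in> I"
      then show "x \<otimes>\<^bsub>add_monoid R\<^esub> y \<in> I"
        using b by (auto simp: I_def B.smult_l_distr dest: Gadd)
    next
      fix x assume "x \<in> I"
      then show "inv\<^bsub>add_monoid R\<^esub> x \<in> I" using un(2) b
        by (auto simp: I_def B.smult_l_minus simp flip: a_inv_def) 
    qed (use Isub in auto)
  next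
    fix a x assume ax: "a \<in> I" "x \<in> carrier R"
    then show "x \<otimes>\<^bsub>R\<^esub> a \<in> I" using b by (auto simp: I_def B.smult_assoc1 dest: Gsm)
    then show "a \<otimes>\<^bsub>R\<^esub> x \<in> I" using ax Isub by (simp add: B.R.m_comm subset_iff)
  qed
  define p where "p r = (THE u. (r \<odot>\<^bsub>B\<^esub> b, u) \<in> G)" for r
  have p: "p r = u" if "(r \<odot>\<^bsub>B\<^esub> b, u) \<in> G" for r u
    unfolding p_def using that un(1) by blast
  have pG: "(r \<odot>\<^bsub>B\<^esub> b, p r) \<in> G" if "r \<in> I" for r
    using that p by (auto simp: I_def)
  let ?I = "make_module I \<zero>\<^bsub>R\<^esub> (add R) (monoid.mult R)"
  have phom: "p \<in> mod_hom R ?I E"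
    unfolding mod_hom_def
  proof (intro CollectI conjI ballI)
    show "p \<in> carrier ?I \<rightarrow> carrier E" using pG G' by auto
  next
    fix x y assume "x \<in> carrier ?I" "y \<in> carrier ?I"
    then have xy: "x \<in> I" "y \<in> I" by auto
    then have "((x \<oplus>\<^bsub>R\<^esub> y) \<odot>\<^bsub>B\<^esub> b, p x \<oplus>\<^bsub>E\<^esub> p y) \<in> G"
      using Gadd[OF pG pG] Isub b by (auto simp: B.smult_l_distr subset_iff)
    then show "p (x \<oplus>\<^bsub>?I\<^esub> y) = p x \<oplus>\<^bsub>E\<^esub> p y" using p by simp
  next
    fix r x assume "r \<in> carrier R" "x \<in> carrier ?I"
    then have rx: "r \<in> carrier R" "x \<in> I" by auto
    then have "((r \<otimes>\<^bsub>R\<^esub> x) \<odot>\<^bsub>B\<^esub> b, r \<odot>\<^bsub>E\<^esub> p x) \<in> G"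
      using Gsm[OF _ pG] Isub b by (auto simp: B.smult_assoc1 subset_iff)
    then show "p (r \<odot>\<^bsub>?I\<^esub> x) = r \<odot>\<^bsub>E\<^esub> p x" using p by simp
  qed
  have "module R ?I" "module R (ring_as_module R)"
    using ideal_make_module[OF B.R.is_cring I] ring_as_module_module[OF B.R.is_cring] by auto
  moreover have "(\<lambda>x. x) \<in> mod_hom R ?I (ring_as_module R)"
    using Isub by (auto simp: mod_hom_def)
  ultimately obtain h where h: "h \<in> mod_hom R (ring_as_module R) E" "\<And>r. r \<in> I \<Longrightarrow> h r = p r"
    using injective_moduleD[OF inj, of ?I "ring_as_module R" "\<lambda>x. x" p] phom
    by (auto simp: inj_on_def)
  define e where "e = h \<one>\<^bsub>R\<^esub>"
  have e: "e \<in> carrier E" and he: "h r = r \<odot>\<^bsub>E\<^esub> e" if "r \<in> carrier R" for r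
  proof -
    show "e \<in> carrier E" using h(1) by (auto simp: e_def mod_hom_def)
    have "h (r \<otimes>\<^bsub>R\<^esub> \<one>\<^bsub>R\<^esub>) = r \<odot>\<^bsub>E\<^esub> h \<one>\<^bsub>R\<^esub>"
      using h(1) that B.R.one_closed by (simp add: mod_hom_def del: B.R.r_one)
    then show "h r = r \<odot>\<^bsub>E\<^esub> e" using that by (simp add: e_def)
  qed
  have e: "e \<in> carrier E" using e[OF B.R.zero_closed] .
  define G1 where
    "G1 = {(x \<oplus>\<^bsub>B\<^esub> r \<odot>\<^bsub>B\<^esub> b, u \<oplus>\<^bsub>E\<^esub> r \<odot>\<^bsub>E\<^esub> e) | x u r. (x, u) \<in> G \<and> r \<in> carrier R}"
  have G1I: "(x', u') \<in> G1" if "(x, u) \<in> G" "r \<in> carrier R"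
      "x' = x \<oplus>\<^bsub>B\<^esub> r \<odot>\<^bsub>B\<^esub> b" "u' = u \<oplus>\<^bsub>E\<^esub> r \<odot>\<^bsub>E\<^esub> e" for x u r x' u'
    using that by (auto simp: G1_def)
  have "linear_graph R B E G1"
    unfolding linear_graph_def
  proof (intro conjI allI impI ballI)
    show "G1 \<subseteq> carrier B \<times> carrier E" using GB b e by (auto simp: G1_def)
    show "(\<zero>\<^bsub>B\<^esub>, \<zero>\<^bsub>E\<^esub>) \<in> G1"
      by (rule G1I[of "\<zero>\<^bsub>B\<^esub>" "\<zero>\<^bsub>E\<^esub>" "\<zero>\<^bsub>R\<^esub>"]) (use G0 b e in auto)
  next
    fix x u y v assume "(x, u) \<in> G1" "(y, v) \<in> G1"
    then obtain x' u' r y' v' t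
      where *: "(x', u') \<in> G" "r \<in> carrier R" "(y', v') \<in> G" "t \<in> carrier R"
      "x = x' \<oplus>\<^bsub>B\<^esub> r \<odot>\<^bsub>B\<^esub> b" "u = u' \<oplus>\<^bsub>E\<^esub> r \<odot>\<^bsub>E\<^esub> e"
      "y = y' \<oplus>\<^bsub>B\<^esub> t \<odot>\<^bsub>B\<^esub> b" "v = v' \<oplus>\<^bsub>E\<^esub> t \<odot>\<^bsub>E\<^esub> e"
      by (auto simp: G1_def)
    show "(x \<oplus>\<^bsub>B\<^esub> y, u \<oplus>\<^bsub>E\<^esub> v) \<in> G1"
      by (rule G1I[of "x' \<oplus>\<^bsub>B\<^esub> y'" "u' \<oplus>\<^bsub>E\<^esub> v'" "r \<oplus>\<^bsub>R\<^esub> t"])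
        (use * Gadd GB b e in \<open>auto simp: B.smult_l_distr E.smult_l_distr B.M.a_ac E.M.a_ac\<close>)
  next
    fix r x u assume "r \<in> carrier R" "(x, u) \<in> G1"
    then obtain x' u' t where *: "(x', u') \<in> G" "t \<in> carrier R" "r \<in> carrier R"
      "x = x' \<oplus>\<^bsub>B\<^esub> t \<odot>\<^bsub>B\<^esub> b" "u = u' \<oplus>\<^bsub>E\<^esub> t \<odot>\<^bsub>E\<^esub> e"
      by (auto simp: G1_def)
    show "(r \<odot>\<^bsub>B\<^esub> x, r \<odot>\<^bsub>E\<^esub> u) \<in> G1"
      by (rule G1I[of "r \<odot>\<^bsub>B\<^esub> x'" "r \<odot>\<^bsub>E\<^esub> u'" "r \<otimes>\<^bsub>R\<^esub> t"])
        (use * Gsm GB b e in \<open>auto simp: B.smult_r_distr E.smult_r_distr B.smult_assoc1 E.smult_assoc1\<close>)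
  next
    fix u assume "(\<zero>\<^bsub>B\<^esub>, u) \<in> G1"
    then obtain x' u' r where *: "(x', u') \<in> G" "r \<in> carrier R"
      "\<zero>\<^bsub>B\<^esub> = x' \<oplus>\<^bsub>B\<^esub> r \<odot>\<^bsub>B\<^esub> b" "u = u' \<oplus>\<^bsub>E\<^esub> r \<odot>\<^bsub>E\<^esub> e"
      by (auto simp: G1_def)
    then have "\<ominus>\<^bsub>B\<^esub> x' = r \<odot>\<^bsub>B\<^esub> b"
      using GB b by (metis B.M.minus_equality B.M.a_comm B.smult_closed)
    then have "(r \<odot>\<^bsub>B\<^esub> b, \<ominus>\<^bsub>E\<^esub> u') \<in> G" using un(2)[OF *(1)] by simp
    then have "r \<in> I" "p r = \<ominus>\<^bsub>E\<^esub> u'" using p * by (auto simp: I_def)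
    then have "r \<odot>\<^bsub>E\<^esub> e = \<ominus>\<^bsub>E\<^esub> u'" using h(2)[of r] he[of r] * by simp
    then show "u = \<zero>\<^bsub>E\<^esub>" using * GB by (simp add: E.M.r_neg)
  qed
  moreover have "G \<subseteq> G1"
  proof
    fix z assume "z \<in> G"
    then obtain x u where "z = (x, u)" "(x, u) \<in> G" by (cases z) auto
    then show "z \<in> G1" using G1I[of x u "\<zero>\<^bsub>R\<^esub>"] GB b e by auto
  qed
  moreover have "(b, e) \<in> G1"
    by (rule G1I[of "\<zero>\<^bsub>B\<^esub>" "\<zero>\<^bsub>E\<^esub>" "\<one>\<^bsub>R\<^esub>"]) (use G0 b e in auto)
  ultimately show ?thesis by blast
qed

text \<open>By Zorn's lemma there is a maximal graph above the given one, and by the previous step it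
  is defined everywhere. The elements of B may have any type here, whereas the definition of
  injectivity speaks only of modules with elements of the type of R.\<close>

lemma injective_module_extends:
  assumes inj: "injective_module R E" and B: "module R B" and G: "linear_graph R B E G"
  shows "\<exists>h\<in>mod_hom R B E. \<forall>(x, u)\<in>G. h x = u"
proof -
  have E: "module R E" using inj by (simp add: injective_module_def)
  let ?A = "{H. linear_graph R B E H \<and> G \<subseteq> H}"
  have "\<exists>M\<in>?A. \<forall>H\<in>?A. M \<subseteq> H \<longrightarrow> H = M"
  proof (rule subset_Zorn_nonempty)
    show "?A \<noteq> {}" using G by blast
  next
    fix \<C> assume "\<C> \<noteq> {}" "subset.chain ?A \<C>"
    then show "\<Union>\<C> \<in> ?A"
      using linear_graph_Union[of \<C> R B E] unfolding subset_chain_def by blast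
  qed
  then obtain H where HA: "H \<in> ?A" and "\<forall>K\<in>?A. H \<subseteq> K \<longrightarrow> K = H" ..
  then have H: "linear_graph R B E H" "G \<subseteq> H"
    and max: "\<And>K. linear_graph R B E K \<Longrightarrow> H \<subseteq> K \<Longrightarrow> K = H" by auto
  have dom: "b \<in> Domain H" if b: "b \<in> carrier B" for b
  proof -
    obtain K where "linear_graph R B E K" "H \<subseteq> K" "b \<in> Domain K"
      using linear_graph_extend[OF inj B H(1) b] by blast
    then show ?thesis using max by blast
  qed
  define h where "h x = (THE u. (x, u) \<in> H)" for x
  have h: "h x = u" if "(x, u) \<in> H" for x u
    unfolding h_def using that linear_graph_unique[OF B E H(1)] by blast
  have hH: "(x, h x) \<in> H" if "x \<in> carrier B" for x using dom[OF that] h by blast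
  have "h \<in> mod_hom R B E"
    unfolding mod_hom_def
  proof (intro CollectI conjI ballI)
    show "h \<in> carrier B \<rightarrow> carrier E" using hH H(1) unfolding linear_graph_def by auto
    show "h (x \<oplus>\<^bsub>B\<^esub> y) = h x \<oplus>\<^bsub>E\<^esub> h y" if "x \<in> carrier B" "y \<in> carrier B" for x y
      by (rule h) (use that H(1) hH in \<open>simp add: linear_graph_def\<close>)
    show "h (r \<odot>\<^bsub>B\<^esub> x) = r \<odot>\<^bsub>E\<^esub> h x" if "r \<in> carrier R" "x \<in> carrier B" for r x
      by (rule h) (use that H(1) hH in \<open>simp add: linear_graph_def\<close>)
  qed
  then show ?thesis using h H(2) by blast
qed

section \<open>Cohomology and quasi-isomorphisms\<close>

lemma cochain_complexD:
  assumes "cochain_complex R X"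
  shows "module R (obj X i)" "diff X i \<in> mod_hom R (obj X i) (obj X (i + 1))"
    "diff X (i - 1) \<in> mod_hom R (obj X (i - 1)) (obj X i)"
    "x \<in> carrier (obj X i) \<Longrightarrow> diff X (i + 1) (diff X i x) = \<zero>\<^bsub>obj X (i + 2)\<^esub>"
    "x \<in> carrier (obj X (i - 1)) \<Longrightarrow> diff X i (diff X (i - 1) x) = \<zero>\<^bsub>obj X (i + 1)\<^esub>"
proof -
  have *: "\<And>i. module R (obj X i)" "\<And>i. diff X i \<in> mod_hom R (obj X i) (obj X (i + 1))"
    "\<And>i x. x \<in> carrier (obj X i) \<Longrightarrow> diff X (i + 1) (diff X i x) = \<zero>\<^bsub>obj X (i + 2)\<^esub>"
    using assms by (auto simp: cochain_complex_def)
  show "module R (obj X i)" "diff X i \<in> mod_hom R (obj X i) (obj X (i + 1))"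
    "diff X (i - 1) \<in> mod_hom R (obj X (i - 1)) (obj X i)"
    "x \<in> carrier (obj X i) \<Longrightarrow> diff X (i + 1) (diff X i x) = \<zero>\<^bsub>obj X (i + 2)\<^esub>"
    "x \<in> carrier (obj X (i - 1)) \<Longrightarrow> diff X i (diff X (i - 1) x) = \<zero>\<^bsub>obj X (i + 1)\<^esub>"
    using *(1) *(2)[of i] *(2)[of "i - 1"] *(3)[of x i] *(3)[of x "i - 1"]
    by (auto simp: algebra_simps)
qed

lemma coboundaries_closed:
  assumes "cochain_complex R X"
  shows "coboundaries X i \<subseteq> cocycles X i"
    and "x \<in> coboundaries X i \<Longrightarrow> y \<in> coboundaries X i \<Longrightarrow> x \<oplus>\<^bsub>obj X i\<^esub> y \<in> coboundaries X i"
    and "x \<in> coboundaries X i \<Longrightarrow> \<ominus>\<^bsub>obj X i\<^esub> x \<in> coboundaries X i"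
    and "\<zero>\<^bsub>obj X i\<^esub> \<in> coboundaries X i"
proof -
  note Xm = cochain_complexD(1)[OF assms]
  interpret M: module R "obj X i" by (rule Xm)
  interpret M': module R "obj X (i - 1)" by (rule Xm)
  note d = cochain_complexD(3)[OF assms, of i]
  show "coboundaries X i \<subseteq> cocycles X i"
    using mod_hom_closed[OF d] cochain_complexD(5)[OF assms]
    by (auto simp: coboundaries_def cocycles_def)
  show "x \<oplus>\<^bsub>obj X i\<^esub> y \<in> coboundaries X i" if "x \<in> coboundaries X i" "y \<in> coboundaries X i"
    using that by (auto simp: coboundaries_def simp flip: mod_hom_add[OF d])
  show "\<ominus>\<^bsub>obj X i\<^esub> x \<in> coboundaries X i" if "x \<in> coboundaries X i"
    using that by (auto simp: coboundaries_def simp flip: mod_hom_uminus[OF d Xm Xm])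
  show "\<zero>\<^bsub>obj X i\<^esub> \<in> coboundaries X i"
    using M'.M.zero_closed by (auto simp: coboundaries_def simp flip: mod_hom_zero[OF d Xm Xm])
qed

lemma cohomology_carrier:
  "carrier (cohomology X i) = (\<lambda>x. coboundaries X i +>\<^bsub>obj X i\<^esub> x) ` cocycles X i"
  by (simp add: cohomology_def subquotient_def)

text \<open>On representatives, the map that a chain map induces on cohomology is f itself. The next
  two lemmas use this to restate a quasi-isomorphism in terms of elements.\<close>

lemma image_cohomology_class:
  assumes ch: "chain_map R X Y f" and x: "x \<in> cocycles X i"
  shows "(f i ` (coboundaries X i +>\<^bsub>obj X i\<^esub> x)) <+>\<^bsub>obj Y i\<^esub> coboundaries Y i =
    coboundaries Y i +>\<^bsub>obj Y i\<^esub> f i x"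
proof -
  have X: "cochain_complex R X" and Y: "cochain_complex R Y"
    and f: "\<And>i. f i \<in> mod_hom R (obj X i) (obj Y i)"
    and fd: "\<And>i x. x \<in> carrier (obj X i) \<Longrightarrow> f (i + 1) (diff X i x) = diff Y i (f i x)"
    using ch by (auto simp: chain_map_def)
  interpret X: module R "obj X i" by (rule cochain_complexD[OF X])
  interpret Y: module R "obj Y i" by (rule cochain_complexD[OF Y])
  have fB: "f i b \<in> coboundaries Y i" if "b \<in> coboundaries X i" for b
    using that fd[of _ "i - 1"] mod_hom_closed[OF f] by (auto simp: coboundaries_def)
  note BX = coboundaries_closed[OF X, where i = i] and BY = coboundaries_closed[OF Y, where i = i]
  have cX: "b \<in> carrier (obj X i)" if "b \<in> coboundaries X i" for b
    using that BX(1) by (auto simp: cocycles_def)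
  have cY: "b \<in> carrier (obj Y i)" if "b \<in> coboundaries Y i" for b
    using that BY(1) by (auto simp: cocycles_def)
  have xc: "x \<in> carrier (obj X i)" "f i x \<in> carrier (obj Y i)"
    using x mod_hom_closed[OF f] by (auto simp: cocycles_def)
  have "(f i ` (coboundaries X i +>\<^bsub>obj X i\<^esub> x)) <+>\<^bsub>obj Y i\<^esub> coboundaries Y i =
    {f i (b \<oplus>\<^bsub>obj X i\<^esub> x) \<oplus>\<^bsub>obj Y i\<^esub> c | b c. b \<in> coboundaries X i \<and> c \<in> coboundaries Y i}"
    by (auto simp: a_r_coset_def' set_add_def')
  also have "\<dots> = {b \<oplus>\<^bsub>obj Y i\<^esub> f i x | b. b \<in> coboundaries Y i}"
  proof (intro equalityI subsetI)
    fix z assume "z \<in> {f i (b \<oplus>\<^bsub>obj X i\<^esub> x) \<oplus>\<^bsub>obj Y i\<^esub> c | b c. b \<in> coboundaries X i \<and> c \<in> coboundaries Y i}"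
    then obtain b c where bc: "b \<in> coboundaries X i" "c \<in> coboundaries Y i"
      "z = f i (b \<oplus>\<^bsub>obj X i\<^esub> x) \<oplus>\<^bsub>obj Y i\<^esub> c" by auto
    then have "z = (f i b \<oplus>\<^bsub>obj Y i\<^esub> c) \<oplus>\<^bsub>obj Y i\<^esub> f i x"
      using cX cY fB xc by (simp add: mod_hom_add[OF f] Y.M.a_ac)
    then show "z \<in> {b \<oplus>\<^bsub>obj Y i\<^esub> f i x | b. b \<in> coboundaries Y i}" using bc fB BY(2) by blast
  next
    fix z assume "z \<in> {b \<oplus>\<^bsub>obj Y i\<^esub> f i x | b. b \<in> coboundaries Y i}"
    then obtain b where b: "b \<in> coboundaries Y i" "z = b \<oplus>\<^bsub>obj Y i\<^esub> f i x" by auto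
    then have "z = f i (\<zero>\<^bsub>obj X i\<^esub> \<oplus>\<^bsub>obj X i\<^esub> x) \<oplus>\<^bsub>obj Y i\<^esub> b"
      using xc cY by (simp add: Y.M.a_comm)
    then show "z \<in> {f i (b \<oplus>\<^bsub>obj X i\<^esub> x) \<oplus>\<^bsub>obj Y i\<^esub> c | b c.
        b \<in> coboundaries X i \<and> c \<in> coboundaries Y i}" using b BX(4) by blast
  qed
  also have "\<dots> = coboundaries Y i +>\<^bsub>obj Y i\<^esub> f i x" by (auto simp: a_r_coset_def')
  finally show ?thesis .
qed

lemma quasi_iso_injective:
  assumes qi: "quasi_iso R X Y f" and x: "x \<in> cocycles X i" and fx: "f i x \<in> coboundaries Y i"
  shows "x \<in> coboundaries X i"
proof -
  have ch: "chain_map R X Y f" using qi by (simp add: quasi_iso_def)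
  have X: "cochain_complex R X" and Y: "cochain_complex R Y"
    and f: "\<And>i. f i \<in> mod_hom R (obj X i) (obj Y i)"
    using ch by (auto simp: chain_map_def)
  interpret X: module R "obj X i" by (rule cochain_complexD[OF X])
  interpret Y: module R "obj Y i" by (rule cochain_complexD[OF Y])
  note BX = coboundaries_closed[OF X, where i = i] and BY = coboundaries_closed[OF Y, where i = i]
  have z: "\<zero>\<^bsub>obj X i\<^esub> \<in> cocycles X i" using BX(1,4) by blast
  have cY: "b \<in> carrier (obj Y i)" if "b \<in> coboundaries Y i" for b
    using that BY(1) by (auto simp: cocycles_def)
  have fz: "f i \<zero>\<^bsub>obj X i\<^esub> = \<zero>\<^bsub>obj Y i\<^esub>"
    by (rule mod_hom_zero[OF f]) (use X Y cochain_complexD in blast)+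
  have "coboundaries Y i +>\<^bsub>obj Y i\<^esub> f i x = coboundaries Y i"
  proof (intro equalityI subsetI)
    fix b assume b: "b \<in> coboundaries Y i"
    then have "b \<oplus>\<^bsub>obj Y i\<^esub> (\<ominus>\<^bsub>obj Y i\<^esub> f i x) \<in> coboundaries Y i" using fx BY(2,3) by blast
    moreover have "b = (b \<oplus>\<^bsub>obj Y i\<^esub> (\<ominus>\<^bsub>obj Y i\<^esub> f i x)) \<oplus>\<^bsub>obj Y i\<^esub> f i x"
      using cY[OF b] cY[OF fx] by (simp add: Y.M.a_assoc Y.M.l_neg)
    ultimately show "b \<in> coboundaries Y i +>\<^bsub>obj Y i\<^esub> f i x" by (auto simp: a_r_coset_def')
  qed (use fx BY(2) in \<open>auto simp: a_r_coset_def'\<close>)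
  moreover have "coboundaries Y i +>\<^bsub>obj Y i\<^esub> f i \<zero>\<^bsub>obj X i\<^esub> = coboundaries Y i"
    unfolding fz using cY by (force simp: a_r_coset_def')
  moreover have "inj_on (\<lambda>K. (f i ` K) <+>\<^bsub>obj Y i\<^esub> coboundaries Y i) (carrier (cohomology X i))"
    using qi by (auto simp: quasi_iso_def bij_betw_def)
  ultimately have "coboundaries X i +>\<^bsub>obj X i\<^esub> x = coboundaries X i +>\<^bsub>obj X i\<^esub> \<zero>\<^bsub>obj X i\<^esub>"
    using x z image_cohomology_class[OF ch x] image_cohomology_class[OF ch z]
    by (intro inj_onD[of "\<lambda>K. (f i ` K) <+>\<^bsub>obj Y i\<^esub> coboundaries Y i" "carrier (cohomology X i)"]) (auto simp: cohomology_carrier)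
  moreover have "x \<in> coboundaries X i +>\<^bsub>obj X i\<^esub> x"
    using BX(4) x by (force simp: a_r_coset_def' cocycles_def)
  moreover have "coboundaries X i +>\<^bsub>obj X i\<^esub> \<zero>\<^bsub>obj X i\<^esub> = coboundaries X i"
    using BX(1) by (force simp: a_r_coset_def' cocycles_def)
  ultimately show ?thesis by simp
qed

lemma quasi_iso_surjective:
  assumes qi: "quasi_iso R X Y f" and y: "y \<in> cocycles Y i"
  shows "\<exists>x\<in>cocycles X i. \<exists>b\<in>coboundaries Y i. y = b \<oplus>\<^bsub>obj Y i\<^esub> f i x"
proof -
  have ch: "chain_map R X Y f" using qi by (simp add: quasi_iso_def)
  have Y: "cochain_complex R Y" using ch by (auto simp: chain_map_def)
  interpret Y: module R "obj Y i" by (rule cochain_complexD[OF Y])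
  have "coboundaries Y i +>\<^bsub>obj Y i\<^esub> y \<in>
      (\<lambda>K. (f i ` K) <+>\<^bsub>obj Y i\<^esub> coboundaries Y i) ` carrier (cohomology X i)"
    using qi y unfolding quasi_iso_def bij_betw_def by (auto simp: cohomology_carrier)
  then obtain x where x: "x \<in> cocycles X i"
    "coboundaries Y i +>\<^bsub>obj Y i\<^esub> y = coboundaries Y i +>\<^bsub>obj Y i\<^esub> f i x"
    using image_cohomology_class[OF ch] by (auto simp: cohomology_carrier)
  have "y \<in> coboundaries Y i +>\<^bsub>obj Y i\<^esub> y"
    using coboundaries_closed(4)[OF Y] y by (force simp: a_r_coset_def' cocycles_def)
  then obtain b where "b \<in> coboundaries Y i" "y = b \<oplus>\<^bsub>obj Y i\<^esub> f i x"
    unfolding x(2) by (auto simp: a_r_coset_def')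
  then show ?thesis using x(1) by blast
qed

section \<open>Homotopies into bounded complexes of injectives\<close>

definition null_homotopic ::
    "('r, 'e) ring_scheme \<Rightarrow> ('r, 'm) cochain \<Rightarrow> ('r, 'n) cochain \<Rightarrow> (int \<Rightarrow> 'm \<Rightarrow> 'n) \<Rightarrow> bool" where
  "null_homotopic R X Y f \<longleftrightarrow> (\<exists>k. (\<forall>i. k i \<in> mod_hom R (obj X i) (obj Y (i - 1))) \<and>
    (\<forall>i. \<forall>x\<in>carrier (obj X i).
      f i x = diff Y (i - 1) (k i x) \<oplus>\<^bsub>obj Y i\<^esub> k (i + 1) (diff X i x)))"

text \<open>A null homotopy is built upwards in the degree. If s satisfies f a = d (s a) on cocycles,
  then the assignment d a \<mapsto> f a - d (s a) is well defined on coboundaries, and by injectivity it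
  extends to a map t on the next module. As A is acyclic, every cocycle in the next degree is some
  d a, and t inherits the property of s.\<close>

lemma null_homotopy_step:
  assumes ch: "chain_map R A D f" and acyc: "\<And>j. cocycles A j \<subseteq> coboundaries A j"
    and inj: "injective_module R (obj D i)"
    and s: "s \<in> mod_hom R (obj A i) (obj D (i - 1))"
    and C: "\<And>a. a \<in> cocycles A i \<Longrightarrow> f i a = diff D (i - 1) (s a)"
  shows "\<exists>t\<in>mod_hom R (obj A (i + 1)) (obj D i).
    (\<forall>a\<in>carrier (obj A i). f i a = diff D (i - 1) (s a) \<oplus>\<^bsub>obj D i\<^esub> t (diff A i a)) \<and>
    (\<forall>a\<in>cocycles A (i + 1). f (i + 1) a = diff D i (t a))"
proof -
  have A: "cochain_complex R A" and D: "cochain_complex R D"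
    and f: "\<And>i. f i \<in> mod_hom R (obj A i) (obj D i)"
    and fd: "\<And>i x. x \<in> carrier (obj A i) \<Longrightarrow> f (i + 1) (diff A i x) = diff D i (f i x)"
    using ch by (auto simp: chain_map_def)
  note Am = cochain_complexD(1)[OF A] and Dm = cochain_complexD(1)[OF D]
  interpret A: module R "obj A i" by (rule Am)
  interpret A1: module R "obj A (i + 1)" by (rule Am)
  interpret D: module R "obj D i" by (rule Dm)
  interpret D1: module R "obj D (i + 1)" by (rule Dm)
  note dA = cochain_complexD(2)[OF A, of i] and dD = cochain_complexD(3)[OF D, of i]
  define w where "w a = f i a \<ominus>\<^bsub>obj D i\<^esub> diff D (i - 1) (s a)" for a
  have w: "w \<in> mod_hom R (obj A i) (obj D i)"
    unfolding w_def by (intro mod_hom_diff Dm f mod_hom_comp[OF s dD])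
  define G where "G = {(diff A i a, w a) | a. a \<in> carrier (obj A i)}"
  have GI: "(x, u) \<in> G" if "a \<in> carrier (obj A i)" "x = diff A i a" "u = w a" for a x u
    using that by (auto simp: G_def)
  have "linear_graph R (obj A (i + 1)) (obj D i) G"
    unfolding linear_graph_def
  proof (intro conjI allI impI ballI)
    show "G \<subseteq> carrier (obj A (i + 1)) \<times> carrier (obj D i)"
      using mod_hom_closed[OF w] mod_hom_closed[OF dA] by (auto simp: G_def)
    show "(\<zero>\<^bsub>obj A (i + 1)\<^esub>, \<zero>\<^bsub>obj D i\<^esub>) \<in> G"
      using mod_hom_zero[OF w Am Dm] mod_hom_zero[OF dA Am Am] by (intro GI[of "\<zero>\<^bsub>obj A i\<^esub>"]) auto
  next
    fix x u y v assume "(x, u) \<in> G" "(y, v) \<in> G"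
    then obtain a b where "a \<in> carrier (obj A i)" "x = diff A i a" "u = w a"
      "b \<in> carrier (obj A i)" "y = diff A i b" "v = w b" by (auto simp: G_def)
    then show "(x \<oplus>\<^bsub>obj A (i + 1)\<^esub> y, u \<oplus>\<^bsub>obj D i\<^esub> v) \<in> G"
      using mod_hom_add[OF w] mod_hom_add[OF dA] by (intro GI[of "a \<oplus>\<^bsub>obj A i\<^esub> b"]) auto
  next
    fix r x u assume "r \<in> carrier R" "(x, u) \<in> G"
    then obtain a where "a \<in> carrier (obj A i)" "x = diff A i a" "u = w a" "r \<in> carrier R"
      by (auto simp: G_def)
    then show "(r \<odot>\<^bsub>obj A (i + 1)\<^esub> x, r \<odot>\<^bsub>obj D i\<^esub> u) \<in> G"
      using mod_hom_smult[OF w] mod_hom_smult[OF dA] by (intro GI[of "r \<odot>\<^bsub>obj A i\<^esub> a"]) auto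
  next
    fix u assume "(\<zero>\<^bsub>obj A (i + 1)\<^esub>, u) \<in> G"
    then obtain a where a: "a \<in> carrier (obj A i)" "\<zero>\<^bsub>obj A (i + 1)\<^esub> = diff A i a" "u = w a"
      by (auto simp: G_def)
    then have "f i a = diff D (i - 1) (s a)" by (intro C) (auto simp: cocycles_def)
    then show "u = \<zero>\<^bsub>obj D i\<^esub>"
      using a mod_hom_closed[OF f a(1)] by (simp add: w_def D.M.r_neg D.M.minus_eq)
  qed
  from injective_module_extends[OF inj Am this]
  obtain t where t1: "t \<in> mod_hom R (obj A (i + 1)) (obj D i)" and "\<forall>(x, u)\<in>G. t x = u" ..
  then have t: "t \<in> mod_hom R (obj A (i + 1)) (obj D i)" "\<And>x u. (x, u) \<in> G \<Longrightarrow> t x = u"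
    by auto
  have td: "t (diff A i a) = w a" if "a \<in> carrier (obj A i)" for a
    using t(2) that by (auto simp: G_def)
  show ?thesis
  proof (intro bexI[of _ t] conjI ballI t(1))
    fix a assume a: "a \<in> carrier (obj A i)"
    have "diff D (i - 1) (s a) \<in> carrier (obj D i)" "f i a \<in> carrier (obj D i)"
      using a mod_hom_closed[OF dD] mod_hom_closed[OF s] mod_hom_closed[OF f] by auto
    then show "f i a = diff D (i - 1) (s a) \<oplus>\<^bsub>obj D i\<^esub> t (diff A i a)"
      using td[OF a] by (simp add: w_def D.M.minus_eq D.M.a_ac D.M.r_neg D.M.r_neg1 D.M.r_neg2)
  next
    fix a assume "a \<in> cocycles A (i + 1)"
    then have "a \<in> coboundaries A (i + 1)" using acyc by blast
    then obtain b where b: "b \<in> carrier (obj A i)" "a = diff A i b"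
      by (auto simp: coboundaries_def)
    have c: "f i b \<in> carrier (obj D i)" "s b \<in> carrier (obj D (i - 1))"
      "diff D (i - 1) (s b) \<in> carrier (obj D i)"
      using b mod_hom_closed[OF f b(1)] mod_hom_closed[OF s b(1)] mod_hom_closed[OF dD] by auto
    have "diff D i (t a) = diff D i (f i b) \<ominus>\<^bsub>obj D (i + 1)\<^esub> diff D i (diff D (i - 1) (s b))"
      using c b td by (simp add: w_def mod_hom_minus[OF cochain_complexD(2)[OF D] Dm Dm])
    also have "\<dots> = diff D i (f i b)"
      using cochain_complexD(5)[OF D c(2)] mod_hom_closed[OF cochain_complexD(2)[OF D] c(1)]
      by (simp add: D1.M.minus_eq)
    finally show "f (i + 1) a = diff D i (t a)" using fd b by simp
  qed
qed

text \<open>The null homotopy is 0 below degree n - 1, where D vanishes, and from there on the previous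
  lemma continues it.\<close>

lemma null_homotopic_acyclic:
  assumes ch: "chain_map R A D f" and acyc: "\<And>j. cocycles A j \<subseteq> coboundaries A j"
    and inj: "\<And>i. injective_module R (obj D i)"
    and bd: "\<And>i. i < n \<Longrightarrow> carrier (obj D i) = {\<zero>\<^bsub>obj D i\<^esub>}"
  shows "null_homotopic R A D f"
proof -
  have A: "cochain_complex R A" and D: "cochain_complex R D"
    and f: "\<And>i. f i \<in> mod_hom R (obj A i) (obj D i)"
    using ch by (auto simp: chain_map_def)
  note Am = cochain_complexD(1)[OF A] and Dm = cochain_complexD(1)[OF D]
  \<comment> \<open>P is the invariant of the step in degree n - 1 + m, and Q the homotopy equation in that degree.\<close>
  define P where "P m s \<longleftrightarrow> s \<in> mod_hom R (obj A (n - 1 + int m)) (obj D (n - 1 + int m - 1)) \<and>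
    (\<forall>a\<in>cocycles A (n - 1 + int m). f (n - 1 + int m) a = diff D (n - 1 + int m - 1) (s a))" for m s
  define Q where "Q m s t \<longleftrightarrow> (\<forall>a\<in>carrier (obj A (n - 1 + int m)).
    f (n - 1 + int m) a = diff D (n - 1 + int m - 1) (s a) \<oplus>\<^bsub>obj D (n - 1 + int m)\<^esub>
      t (diff A (n - 1 + int m) a))" for m s t
  have "\<exists>g. \<forall>m. P m (g m) \<and> Q m (g m) (g (Suc m))"
  proof (rule dependent_nat_choice)
    have z: "f (n - 1) a = \<zero>\<^bsub>obj D (n - 1)\<^esub>" if "a \<in> cocycles A (n - 1)" for a
      using mod_hom_closed[OF f, of a "n - 1"] that bd[of "n - 1"] by (auto simp: cocycles_def)
    show "\<exists>s. P 0 s"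
      using mod_hom_zero_map[OF Dm, of "n - 2"]
        mod_hom_zero[OF cochain_complexD(3)[OF D, of "n - 1"] Dm Dm] z
      by (intro exI[of _ "\<lambda>x. \<zero>\<^bsub>obj D (n - 2)\<^esub>"]) (auto simp: P_def)
  next
    fix s m assume "P m s"
    then show "\<exists>t. P (Suc m) t \<and> Q m s t"
      using null_homotopy_step[OF ch acyc inj, of s "n - 1 + int m"]
      by (fastforce simp: P_def Q_def algebra_simps)
  qed
  then obtain g where g: "\<And>m. P m (g m)" "\<And>m. Q m (g m) (g (Suc m))" by blast
  define k where "k i = (if i < n - 1 then (\<lambda>x. \<zero>\<^bsub>obj D (i - 1)\<^esub>) else g (nat (i - (n - 1))))" for i
  have k: "k i \<in> mod_hom R (obj A i) (obj D (i - 1))" for i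
    using g(1)[of "nat (i - (n - 1))"] mod_hom_zero_map[OF Dm, of "i - 1"]
    by (auto simp: k_def P_def)
  show ?thesis
    unfolding null_homotopic_def
  proof (intro exI[of _ k] conjI allI ballI k)
    fix i x assume x: "x \<in> carrier (obj A i)"
    show "f i x = diff D (i - 1) (k i x) \<oplus>\<^bsub>obj D i\<^esub> k (i + 1) (diff A i x)"
    proof (cases "i < n - 1")
      case True
      interpret D: module R "obj D i" by (rule Dm)
      have "f i x \<in> carrier (obj D i)" using mod_hom_closed[OF f x] .
      moreover have "diff D (i - 1) (k i x) \<oplus>\<^bsub>obj D i\<^esub> k (i + 1) (diff A i x) \<in> carrier (obj D i)"
        using mod_hom_closed[OF cochain_complexD(3)[OF D] mod_hom_closed[OF k x]]
          mod_hom_closed[OF k mod_hom_closed[OF cochain_complexD(2)[OF A] x]] by simp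
      ultimately show ?thesis using bd[of i] True by simp
    next
      case False
      define m where "m = nat (i - (n - 1))"
      have "n - 1 + int m = i" "k i = g m" "k (i + 1) = g (Suc m)"
        using False by (auto simp: k_def m_def nat_add_distrib algebra_simps
          simp flip: nat_add_distrib intro!: arg_cong[where f = g])
      then show ?thesis using g(2)[of m] x by (simp add: Q_def)
    qed
  qed
qed

definition module_prod :: "('r, 'm) module \<Rightarrow> ('r, 'n) module \<Rightarrow> ('r, 'm \<times> 'n) module" where
  "module_prod M N = make_module (carrier M \<times> carrier N) (\<zero>\<^bsub>M\<^esub>, \<zero>\<^bsub>N\<^esub>)
    (\<lambda>p q. (fst p \<oplus>\<^bsub>M\<^esub> fst q, snd p \<oplus>\<^bsub>N\<^esub> snd q)) (\<lambda>r p. (r \<odot>\<^bsub>M\<^esub> fst p, r \<odot>\<^bsub>N\<^esub> snd p))"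

lemma module_prod_simps [simp]:
  "carrier (module_prod M N) = carrier M \<times> carrier N"
  "zero (module_prod M N) = (\<zero>\<^bsub>M\<^esub>, \<zero>\<^bsub>N\<^esub>)"
  "add (module_prod M N) = (\<lambda>p q. (fst p \<oplus>\<^bsub>M\<^esub> fst q, snd p \<oplus>\<^bsub>N\<^esub> snd q))"
  "smult (module_prod M N) = (\<lambda>r p. (r \<odot>\<^bsub>M\<^esub> fst p, r \<odot>\<^bsub>N\<^esub> snd p))"
  by (simp_all add: module_prod_def)

lemma module_prod_module:
  assumes "module R M" "module R N" shows "module R (module_prod M N)"
proof -
  interpret M: module R M by fact
  interpret N: module R N by fact
  show ?thesis
    unfolding module_prod_def
  proof (rule make_moduleI)
    fix p assume p: "p \<in> carrier M \<times> carrier N"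
    then show "\<exists>q\<in>carrier M \<times> carrier N. (fst q \<oplus>\<^bsub>M\<^esub> fst p, snd q \<oplus>\<^bsub>N\<^esub> snd p) = (\<zero>\<^bsub>M\<^esub>, \<zero>\<^bsub>N\<^esub>)"
      by (intro bexI[of _ "(\<ominus>\<^bsub>M\<^esub> fst p, \<ominus>\<^bsub>N\<^esub> snd p)"]) (auto simp: M.M.l_neg N.M.l_neg)
  qed (auto simp: M.R.is_cring M.M.a_ac N.M.a_ac M.smult_l_distr N.smult_l_distr
      M.smult_r_distr N.smult_r_distr M.smult_assoc1 N.smult_assoc1)
qed

text \<open>The mapping cone of f, moved up by one degree: then the projection to Z preserves degrees,
  and composing it with a chain map from Z needs no shift.\<close>

definition mapping_cone :: "('r, 'm) cochain \<Rightarrow> ('r, 'n) cochain \<Rightarrow> (int \<Rightarrow> 'm \<Rightarrow> 'n) \<Rightarrow> ('r, 'm \<times> 'n) cochain" where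
  "mapping_cone Z Y f = \<lparr>obj = (\<lambda>i. module_prod (obj Z i) (obj Y (i - 1))),
    diff = (\<lambda>i p. (diff Z i (fst p), f i (fst p) \<ominus>\<^bsub>obj Y i\<^esub> diff Y (i - 1) (snd p)))\<rparr>"

lemma mapping_cone_simps [simp]:
  "obj (mapping_cone Z Y f) = (\<lambda>i. module_prod (obj Z i) (obj Y (i - 1)))"
  "diff (mapping_cone Z Y f) = (\<lambda>i p. (diff Z i (fst p), f i (fst p) \<ominus>\<^bsub>obj Y i\<^esub> diff Y (i - 1) (snd p)))"
  by (simp_all add: mapping_cone_def)

lemma module_prod_pair:
  assumes "g \<in> mod_hom R M N" "h \<in> mod_hom R M P"
  shows "(\<lambda>x. (g x, h x)) \<in> mod_hom R M (module_prod N P)"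
  using assms by (auto simp: mod_hom_def)

lemma mod_hom_fst: "fst \<in> mod_hom R (module_prod M N) M"
  and mod_hom_snd: "snd \<in> mod_hom R (module_prod M N) N"
  by (auto simp: mod_hom_def)

lemma mod_hom_inl:
  assumes "module R M" "module R N" shows "(\<lambda>x. (x, \<zero>\<^bsub>N\<^esub>)) \<in> mod_hom R M (module_prod M N)"
proof -
  interpret N: module R N by fact
  show ?thesis by (auto simp: mod_hom_def)
qed

lemma mod_hom_inr:
  assumes "module R M" "module R N" shows "(\<lambda>x. (\<zero>\<^bsub>M\<^esub>, x)) \<in> mod_hom R N (module_prod M N)"
proof -
  interpret N: module R M by fact
  show ?thesis by (auto simp: mod_hom_def)
qed

lemma mapping_cone_complex:
  assumes ch: "chain_map R Z Y f"
  shows "cochain_complex R (mapping_cone Z Y f)"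
proof -
  have Z: "cochain_complex R Z" and Y: "cochain_complex R Y"
    and f: "\<And>i. f i \<in> mod_hom R (obj Z i) (obj Y i)"
    and fd: "\<And>i x. x \<in> carrier (obj Z i) \<Longrightarrow> f (i + 1) (diff Z i x) = diff Y i (f i x)"
    using ch by (auto simp: chain_map_def)
  note Zm = cochain_complexD(1)[OF Z] and Ym = cochain_complexD(1)[OF Y]
  show ?thesis
    unfolding cochain_complex_def
  proof (intro allI conjI ballI)
    fix i
    show "module R (obj (mapping_cone Z Y f) i)" by (simp add: module_prod_module Zm Ym)
    have "diff (mapping_cone Z Y f) i \<in> mod_hom R (module_prod (obj Z i) (obj Y (i - 1)))
      (module_prod (obj Z (i + 1)) (obj Y i))"
      unfolding mapping_cone_simps
      by (intro module_prod_pair mod_hom_diff Ym mod_hom_comp[OF mod_hom_fst cochain_complexD(2)[OF Z]]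
         mod_hom_comp[OF mod_hom_fst f] mod_hom_comp[OF mod_hom_snd cochain_complexD(3)[OF Y]])
    then show "diff (mapping_cone Z Y f) i \<in> mod_hom R (obj (mapping_cone Z Y f) i) (obj (mapping_cone Z Y f) (i + 1))"
      by simp
  next
    fix i p assume p: "p \<in> carrier (obj (mapping_cone Z Y f) i)"
    interpret Y: module R "obj Y i" by (rule Ym)
    interpret Y1: module R "obj Y (i + 1)" by (rule Ym)
    have c: "fst p \<in> carrier (obj Z i)" "snd p \<in> carrier (obj Y (i - 1))" using p by auto
    have c': "f i (fst p) \<in> carrier (obj Y i)" "diff Y (i - 1) (snd p) \<in> carrier (obj Y i)"
      using c mod_hom_closed[OF f] mod_hom_closed[OF cochain_complexD(3)[OF Y]] by auto
    then have "diff Y i (f i (fst p)) \<in> carrier (obj Y (i + 1))"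
      using mod_hom_closed[OF cochain_complexD(2)[OF Y]] by auto
    then show "diff (mapping_cone Z Y f) (i + 1) (diff (mapping_cone Z Y f) i p) = \<zero>\<^bsub>obj (mapping_cone Z Y f) (i + 2)\<^esub>"
      using c c' cochain_complexD(4)[OF Z c(1)] cochain_complexD(5)[OF Y c(2)]
      by (simp add: fd mod_hom_minus[OF cochain_complexD(2)[OF Y] Ym Ym] Y1.M.minus_eq Y1.M.r_neg Y1.M.neg_zero
        add.commute[of 1 i])
  qed
qed

text \<open>The long exact sequence, chased by hand. A cocycle is a pair (z, y) with d z = 0 and f z =
  d y. As f is injective on cohomology, z = d w; as it is surjective, f w - y is cohomologous to f
  v for a cocycle v, and w - v is the first component of a preimage of (z, y).\<close>

lemma mapping_cone_acyclic:
  assumes qi: "quasi_iso R Z Y f"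
  shows "cocycles (mapping_cone Z Y f) i \<subseteq> coboundaries (mapping_cone Z Y f) i"
proof
  have ch: "chain_map R Z Y f" using qi by (simp add: quasi_iso_def)
  have Z: "cochain_complex R Z" and Y: "cochain_complex R Y"
    and f: "\<And>i. f i \<in> mod_hom R (obj Z i) (obj Y i)"
    and fd: "\<And>i x. x \<in> carrier (obj Z i) \<Longrightarrow> f (i + 1) (diff Z i x) = diff Y i (f i x)"
    using ch by (auto simp: chain_map_def)
  note Zm = cochain_complexD(1)[OF Z] and Ym = cochain_complexD(1)[OF Y]
  interpret Y: module R "obj Y i" by (rule Ym)
  interpret Y1: module R "obj Y (i - 1)" by (rule Ym)
  interpret Z: module R "obj Z i" by (rule Zm)
  interpret Z1: module R "obj Z (i - 1)" by (rule Zm)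
  note dZ = cochain_complexD(3)[OF Z, of i] and dY = cochain_complexD(3)[OF Y, of i]
    and dY2 = cochain_complexD(3)[OF Y, of "i - 1"] 
  fix p assume "p \<in> cocycles (mapping_cone Z Y f) i"
  then obtain z y
    where p: "p = (z, y)" and z: "z \<in> carrier (obj Z i)" "diff Z i z = \<zero>\<^bsub>obj Z (i + 1)\<^esub>"
    and y: "y \<in> carrier (obj Y (i - 1))" and e: "f i z \<ominus>\<^bsub>obj Y i\<^esub> diff Y (i - 1) y = \<zero>\<^bsub>obj Y i\<^esub>"
    by (auto simp: cocycles_def)
  have e: "f i z = diff Y (i - 1) y"
    using e mod_hom_closed[OF f z(1)] mod_hom_closed[OF dY y] by (simp add: Y.M.eq_if_minus_zero)
  have "z \<in> coboundaries Z i"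
    by (rule quasi_iso_injective[OF qi]) (use z y e in \<open>auto simp: cocycles_def coboundaries_def\<close>)
  then obtain w where w: "w \<in> carrier (obj Z (i - 1))" "z = diff Z (i - 1) w"
    by (auto simp: coboundaries_def)
  have fw: "f (i - 1) w \<in> carrier (obj Y (i - 1))" by (rule mod_hom_closed[OF f w(1)])
  have "f (i - 1) w \<ominus>\<^bsub>obj Y (i - 1)\<^esub> y \<in> cocycles Y (i - 1)"
    using fw y w e fd[OF w(1)] mod_hom_closed[OF dY y]
    by (simp add: cocycles_def mod_hom_minus[OF dY Ym Ym] Y.M.minus_eq Y.M.r_neg)
  from quasi_iso_surjective[OF qi this] obtain v b where v: "v \<in> cocycles Z (i - 1)"
    and b: "b \<in> coboundaries Y (i - 1)"
    and vb: "f (i - 1) w \<ominus>\<^bsub>obj Y (i - 1)\<^esub> y = b \<oplus>\<^bsub>obj Y (i - 1)\<^esub> f (i - 1) v" by blast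
  from b obtain u where u: "u \<in> carrier (obj Y (i - 2))" "b = diff Y (i - 2) u"
    by (auto simp: coboundaries_def)
  have vc: "v \<in> carrier (obj Z (i - 1))" "diff Z (i - 1) v = \<zero>\<^bsub>obj Z i\<^esub>"
    using v by (auto simp: cocycles_def)
  have fv: "f (i - 1) v \<in> carrier (obj Y (i - 1))" by (rule mod_hom_closed[OF f vc(1)])
  have bc: "b \<in> carrier (obj Y (i - 1))"
    using b coboundaries_closed(1)[OF Y] by (auto simp: cocycles_def)
  have "diff Z (i - 1) (w \<ominus>\<^bsub>obj Z (i - 1)\<^esub> v) = z"
    using w vc z(1) by (simp add: mod_hom_minus[OF dZ Zm Zm] Z.M.minus_eq)
  moreover have "f (i - 1) (w \<ominus>\<^bsub>obj Z (i - 1)\<^esub> v) \<ominus>\<^bsub>obj Y (i - 1)\<^esub> diff Y (i - 2) u = y"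
  proof -
    have "f (i - 1) w = y \<oplus>\<^bsub>obj Y (i - 1)\<^esub> (b \<oplus>\<^bsub>obj Y (i - 1)\<^esub> f (i - 1) v)"
      unfolding vb[symmetric] using fw y by (simp add: Y1.M.minus_eq Y1.M.add_add_neg)
    then show ?thesis
      using w vc y fv bc Y1.M.minus_minus_cancel[OF y bc fv]
      by (simp add: mod_hom_minus[OF f Zm Ym] flip: u(2))
  qed
  ultimately show "p \<in> coboundaries (mapping_cone Z Y f) i"
    unfolding coboundaries_def using p w vc u
    by (intro image_eqI[of _ _ "(w \<ominus>\<^bsub>obj Z (i - 1)\<^esub> v, u)"]) auto
qed

lemma null_homotopicI:
  assumes "\<And>i. k i \<in> mod_hom R (obj X i) (obj Y (i - 1))"
    and "\<And>i x. x \<in> carrier (obj X i) \<Longrightarrow>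
      f i x = diff Y (i - 1) (k i x) \<oplus>\<^bsub>obj Y i\<^esub> k (i + 1) (diff X i x)"
  shows "null_homotopic R X Y f"
  using assms by (auto simp: null_homotopic_def)

lemma chain_mapD:
  assumes "chain_map R X Y f"
  shows "cochain_complex R X" "cochain_complex R Y" "f i \<in> mod_hom R (obj X i) (obj Y i)"
    "x \<in> carrier (obj X i) \<Longrightarrow> f (i + 1) (diff X i x) = diff Y i (f i x)"
    "x \<in> carrier (obj X (i - 1)) \<Longrightarrow> f i (diff X (i - 1) x) = diff Y (i - 1) (f (i - 1) x)"
proof -
  show "cochain_complex R X" "cochain_complex R Y" "f i \<in> mod_hom R (obj X i) (obj Y i)"
    "x \<in> carrier (obj X i) \<Longrightarrow> f (i + 1) (diff X i x) = diff Y i (f i x)"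
    using assms by (auto simp: chain_map_def)
  have "\<And>i x. x \<in> carrier (obj X i) \<Longrightarrow> f (i + 1) (diff X i x) = diff Y i (f i x)"
    using assms by (auto simp: chain_map_def)
  from this[of x "i - 1"]
  show "x \<in> carrier (obj X (i - 1)) \<Longrightarrow> f i (diff X (i - 1) x) = diff Y (i - 1) (f (i - 1) x)" by simp
qed

lemma chain_mapI:
  assumes "cochain_complex R X" "cochain_complex R Y" "\<And>i. f i \<in> mod_hom R (obj X i) (obj Y i)"
    "\<And>i x. x \<in> carrier (obj X i) \<Longrightarrow> f (i + 1) (diff X i x) = diff Y i (f i x)"
  shows "chain_map R X Y f"
  using assms by (auto simp: chain_map_def)

lemma chain_map_comp:
  assumes "chain_map R X Y f" "chain_map R Y W g"
  shows "chain_map R X W (\<lambda>i x. g i (f i x))"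
proof (rule chain_mapI)
  show "(\<lambda>x. g i (f i x)) \<in> mod_hom R (obj X i) (obj W i)" for i
    by (rule mod_hom_comp[OF chain_mapD(3)[OF assms(1)] chain_mapD(3)[OF assms(2)]])
  show "g (i + 1) (f (i + 1) (diff X i x)) = diff W i (g i (f i x))"
    if "x \<in> carrier (obj X i)" for i x
    using that chain_mapD(4)[OF assms(1)] chain_mapD(4)[OF assms(2)]
      mod_hom_closed[OF chain_mapD(3)[OF assms(1)]] by simp
qed (use assms in \<open>auto dest: chain_mapD\<close>)

text \<open>The map (z, y) \<mapsto> g z on the cone is null homotopic, because the cone is acyclic. Of its
  null homotopy, the component on Y is the required chain map h, and the component on Z is a
  homotopy between g and h f. So composition with a quasi-isomorphism is surjective on homotopy
  classes of maps to D.\<close>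

lemma homotopy_lift:
  assumes qi: "quasi_iso R Z Y f" and g: "chain_map R Z D g"
    and inj: "\<And>i. injective_module R (obj D i)"
    and bd: "\<And>i. i < n \<Longrightarrow> carrier (obj D i) = {\<zero>\<^bsub>obj D i\<^esub>}"
  shows "\<exists>h. chain_map R Y D h \<and>
    null_homotopic R Z D (\<lambda>i z. g i z \<ominus>\<^bsub>obj D i\<^esub> h i (f i z))"
proof -
  have f: "chain_map R Z Y f" using qi by (simp add: quasi_iso_def)
  note Z = chain_mapD(1)[OF f] and Y = chain_mapD(2)[OF f] and D = chain_mapD(2)[OF g]
  note Zm = cochain_complexD(1)[OF Z] and Ym = cochain_complexD(1)[OF Y]
    and Dm = cochain_complexD(1)[OF D]
  note dY = cochain_complexD(2)[OF Y] and dZ = cochain_complexD(2)[OF Z] and dD = cochain_complexD(2)[OF D]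
  note gh = chain_mapD(3)[OF g] and fh = chain_mapD(3)[OF f]
  have "chain_map R (mapping_cone Z Y f) D (\<lambda>i p. g i (fst p))"
    by (rule chain_mapI[OF mapping_cone_complex[OF f] D])
      (use chain_mapD(4)[OF g] in \<open>auto intro: mod_hom_comp[OF mod_hom_fst gh]\<close>)
  then have "null_homotopic R (mapping_cone Z Y f) D (\<lambda>i p. g i (fst p))"
    by (rule null_homotopic_acyclic[where n = n]) (use mapping_cone_acyclic[OF qi] inj bd in auto)
  then obtain k
    where k: "\<And>i. k i \<in> mod_hom R (module_prod (obj Z i) (obj Y (i - 1))) (obj D (i - 1))"
    and kh: "\<And>i z y. z \<in> carrier (obj Z i) \<Longrightarrow> y \<in> carrier (obj Y (i - 1)) \<Longrightarrow>
      g i z = diff D (i - 1) (k i (z, y)) \<oplus>\<^bsub>obj D i\<^esub>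
        k (i + 1) (diff Z i z, f i z \<ominus>\<^bsub>obj Y i\<^esub> diff Y (i - 1) y)"
    unfolding null_homotopic_def by fastforce
  define h where "h i y = k (i + 1) (\<zero>\<^bsub>obj Z (i + 1)\<^esub>, y)" for i y
  have h: "h i \<in> mod_hom R (obj Y i) (obj D i)" for i
    using mod_hom_comp[OF mod_hom_inr[OF Zm[of "i + 1"] Ym[of "i + 1 - 1"]] k[of "i + 1"]]
    by (simp add: h_def[abs_def])
  have hd: "h (i + 1) (diff Y i y) = diff D i (h i y)" if y: "y \<in> carrier (obj Y i)" for i y
  proof -
    interpret D: module R "obj D (i + 1)" by (rule Dm)
    interpret Y: module R "obj Y (i + 1)" by (rule Ym)
    interpret Z: module R "obj Z (i + 1)" by (rule Zm)
    have dy: "diff Y i y \<in> carrier (obj Y (i + 1))" by (rule mod_hom_closed[OF dY y])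
    have c: "h (i + 1) (diff Y i y) \<in> carrier (obj D (i + 1))" "diff D i (h i y) \<in> carrier (obj D (i + 1))"
      using mod_hom_closed[OF h dy] mod_hom_closed[OF dD mod_hom_closed[OF h y]] by auto
    have "\<zero>\<^bsub>obj D (i + 1)\<^esub> = diff D i (h i y) \<oplus>\<^bsub>obj D (i + 1)\<^esub>
        h (i + 1) (\<ominus>\<^bsub>obj Y (i + 1)\<^esub> diff Y i y)"
      using kh[of "\<zero>\<^bsub>obj Z (i + 1)\<^esub>" "i + 1" y] y dy mod_hom_zero[OF gh Zm Dm]
        mod_hom_zero[OF dZ Zm Zm] mod_hom_zero[OF fh Zm Ym]
      by (simp add: h_def Y.M.minus_eq)
    then have "diff D i (h i y) \<ominus>\<^bsub>obj D (i + 1)\<^esub> h (i + 1) (diff Y i y) = \<zero>\<^bsub>obj D (i + 1)\<^esub>"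
      by (simp add: mod_hom_uminus[OF h Ym Dm dy] D.M.minus_eq)
    then show ?thesis using c D.M.eq_if_minus_zero by metis
  qed
  define u where "u i z = k i (z, \<zero>\<^bsub>obj Y (i - 1)\<^esub>)" for i z
  have u: "u i \<in> mod_hom R (obj Z i) (obj D (i - 1))" for i
    unfolding u_def by (rule mod_hom_comp[OF mod_hom_inl[OF Zm Ym] k])
  have "null_homotopic R Z D (\<lambda>i z. g i z \<ominus>\<^bsub>obj D i\<^esub> h i (f i z))"
  proof (rule null_homotopicI[OF u])
    fix i z assume z: "z \<in> carrier (obj Z i)"
    interpret D: module R "obj D i" by (rule Dm)
    interpret Y: module R "obj Y (i - 1)" by (rule Ym)
    interpret Y': module R "obj Y i" by (rule Ym)
    interpret Z: module R "obj Z (i + 1)" by (rule Zm)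
    have c: "diff D (i - 1) (u i z) \<in> carrier (obj D i)" "u (i + 1) (diff Z i z) \<in> carrier (obj D i)"
      "h i (f i z) \<in> carrier (obj D i)" "f i z \<in> carrier (obj Y i)" "diff Z i z \<in> carrier (obj Z (i + 1))"
      using mod_hom_closed[OF cochain_complexD(3)[OF D] mod_hom_closed[OF u z]]
        mod_hom_closed[OF u mod_hom_closed[OF dZ z]] mod_hom_closed[OF h mod_hom_closed[OF fh z]]
        mod_hom_closed[OF dZ z] mod_hom_closed[OF fh z] by auto
    have "k (i + 1) (diff Z i z, f i z) = k (i + 1) ((diff Z i z, \<zero>\<^bsub>obj Y i\<^esub>)
        \<oplus>\<^bsub>module_prod (obj Z (i + 1)) (obj Y (i + 1 - 1))\<^esub> (\<zero>\<^bsub>obj Z (i + 1)\<^esub>, f i z))"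
      using c by simp
    also have "\<dots> = u (i + 1) (diff Z i z) \<oplus>\<^bsub>obj D i\<^esub> h i (f i z)"
      using mod_hom_add[OF k, of "(diff Z i z, \<zero>\<^bsub>obj Y i\<^esub>)" "i + 1" "(\<zero>\<^bsub>obj Z (i + 1)\<^esub>, f i z)"] c
      by (simp add: u_def h_def)
    finally have "g i z = diff D (i - 1) (u i z) \<oplus>\<^bsub>obj D i\<^esub> (u (i + 1) (diff Z i z) \<oplus>\<^bsub>obj D i\<^esub> h i (f i z))"
      using kh[OF z, of "\<zero>\<^bsub>obj Y (i - 1)\<^esub>"] c mod_hom_zero[OF cochain_complexD(3)[OF Y] Ym Ym, of i]
      by (simp add: u_def Y'.M.minus_eq Y'.M.neg_zero)
    then show "g i z \<ominus>\<^bsub>obj D i\<^esub> h i (f i z) =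
      diff D (i - 1) (u i z) \<oplus>\<^bsub>obj D i\<^esub> u (i + 1) (diff Z i z)"
      using c by (simp add: D.M.minus_eq D.M.a_assoc D.M.r_neg)
  qed
  then show ?thesis using chain_mapI[OF Y D h hd] by blast
qed

text \<open>With this sign, the map \<open>w\<close> in the proof of \<open>homotopy_unique\<close> commutes with the
  differentials.\<close>

definition shift_down :: "('r, 'm) cochain \<Rightarrow> ('r, 'm) cochain" where
  "shift_down D = \<lparr>obj = (\<lambda>i. obj D (i - 1)), diff = (\<lambda>i x. \<ominus>\<^bsub>obj D i\<^esub> diff D (i - 1) x)\<rparr>"

lemma shift_down_simps [simp]:
  "obj (shift_down D) = (\<lambda>i. obj D (i - 1))"
  "diff (shift_down D) = (\<lambda>i x. \<ominus>\<^bsub>obj D i\<^esub> diff D (i - 1) x)"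
  by (simp_all add: shift_down_def)

lemma shift_down_complex:
  assumes D: "cochain_complex R D" shows "cochain_complex R (shift_down D)"
  unfolding cochain_complex_def
proof (intro allI conjI ballI)
  fix i
  note Dm = cochain_complexD(1)[OF D]
  note d = cochain_complexD(3)[OF D]
  show "module R (obj (shift_down D) i)" using Dm by simp
  show "diff (shift_down D) i \<in> mod_hom R (obj (shift_down D) i) (obj (shift_down D) (i + 1))"
    using mod_hom_neg[OF Dm d] by simp
  fix x assume "x \<in> carrier (obj (shift_down D) i)"
  then have x: "x \<in> carrier (obj D (i - 1))" by simp
  interpret D1: module R "obj D (i + 1)" by (rule Dm)
  have "diff D i (\<ominus>\<^bsub>obj D i\<^esub> diff D (i - 1) x) = \<ominus>\<^bsub>obj D (i + 1)\<^esub> \<zero>\<^bsub>obj D (i + 1)\<^esub>"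
    using mod_hom_uminus[OF cochain_complexD(2)[OF D] Dm Dm mod_hom_closed[OF d x]]
      cochain_complexD(5)[OF D x] by simp
  then show "diff (shift_down D) (i + 1) (diff (shift_down D) i x) = \<zero>\<^bsub>obj (shift_down D) (i + 2)\<^esub>"
    by (simp add: D1.M.neg_zero add.commute[of 1 i])
qed

text \<open>A null homotopy u of h f turns (z, y) \<mapsto> h y - u z into a chain map from the cone to the
  shift of D. It is null homotopic in turn, and the component of its null homotopy on Y is, up to
  sign, a null homotopy of h. So composition with a quasi-isomorphism is also injective on homotopy
  classes.\<close>

lemma homotopy_unique:
  assumes qi: "quasi_iso R Z Y f" and h: "chain_map R Y D h"
    and null: "null_homotopic R Z D (\<lambda>i z. h i (f i z))"
    and inj: "\<And>i. injective_module R (obj D i)"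
    and bd: "\<And>i. i < n \<Longrightarrow> carrier (obj D i) = {\<zero>\<^bsub>obj D i\<^esub>}"
  shows "null_homotopic R Y D h"
proof -
  have f: "chain_map R Z Y f" using qi by (simp add: quasi_iso_def)
  note Z = chain_mapD(1)[OF f] and Y = chain_mapD(2)[OF f] and D = chain_mapD(2)[OF h]
  note Zm = cochain_complexD(1)[OF Z] and Ym = cochain_complexD(1)[OF Y]
    and Dm = cochain_complexD(1)[OF D]
  note dY = cochain_complexD(2)[OF Y] and dZ = cochain_complexD(2)[OF Z] and dD = cochain_complexD(2)[OF D]
  note hh = chain_mapD(3)[OF h] and fh = chain_mapD(3)[OF f]
  obtain u where u: "\<And>i. u i \<in> mod_hom R (obj Z i) (obj D (i - 1))"
    and uh: "\<And>i z. z \<in> carrier (obj Z i) \<Longrightarrow>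
      h i (f i z) = diff D (i - 1) (u i z) \<oplus>\<^bsub>obj D i\<^esub> u (i + 1) (diff Z i z)"
    using null unfolding null_homotopic_def by blast
  define w where "w i p = h (i - 1) (snd p) \<ominus>\<^bsub>obj D (i - 1)\<^esub> u i (fst p)" for i p
  have w: "w i \<in> mod_hom R (module_prod (obj Z i) (obj Y (i - 1))) (obj D (i - 1))" for i
    unfolding w_def
    by (intro mod_hom_diff Dm mod_hom_comp[OF mod_hom_snd hh] mod_hom_comp[OF mod_hom_fst u])
  have "chain_map R (mapping_cone Z Y f) (shift_down D) w"
  proof (rule chain_mapI[OF mapping_cone_complex[OF f] shift_down_complex[OF D]])
    show "w i \<in> mod_hom R (obj (mapping_cone Z Y f) i) (obj (shift_down D) i)" for i using w by simp
  next
    fix i p assume "p \<in> carrier (obj (mapping_cone Z Y f) i)"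
    then have p: "fst p \<in> carrier (obj Z i)" "snd p \<in> carrier (obj Y (i - 1))" by auto
    interpret D: module R "obj D i" by (rule Dm)
    have c: "h (i - 1) (snd p) \<in> carrier (obj D (i - 1))" "u i (fst p) \<in> carrier (obj D (i - 1))"
       "diff Y (i - 1) (snd p) \<in> carrier (obj Y i)" "f i (fst p) \<in> carrier (obj Y i)"
      using mod_hom_closed[OF hh p(2)] mod_hom_closed[OF u p(1)]
        mod_hom_closed[OF cochain_complexD(3)[OF Y] p(2)] mod_hom_closed[OF fh p(1)] by auto
    have c': "diff D (i - 1) (h (i - 1) (snd p)) \<in> carrier (obj D i)"
      "diff D (i - 1) (u i (fst p)) \<in> carrier (obj D i)"
      "u (i + 1) (diff Z i (fst p)) \<in> carrier (obj D i)"
      using c p mod_hom_closed[OF cochain_complexD(3)[OF D]]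
        mod_hom_closed[OF u mod_hom_closed[OF dZ p(1)]] by auto
    have "w (i + 1) (diff (mapping_cone Z Y f) i p) =
        (h i (f i (fst p)) \<ominus>\<^bsub>obj D i\<^esub> diff D (i - 1) (h (i - 1) (snd p))) \<ominus>\<^bsub>obj D i\<^esub> u (i + 1) (diff Z i (fst p))"
      using c chain_mapD(5)[OF h p(2)] by (simp add: w_def mod_hom_minus[OF hh Ym Dm])
    also have "\<dots> = diff D (i - 1) (u i (fst p)) \<ominus>\<^bsub>obj D i\<^esub> diff D (i - 1) (h (i - 1) (snd p))"
      using c' uh[OF p(1)]
      by (simp add: D.M.minus_eq D.M.a_ac D.M.r_neg D.M.l_neg D.M.r_neg1 D.M.r_neg2)
    also have "\<dots> = \<ominus>\<^bsub>obj D i\<^esub> diff D (i - 1) (w i p)"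
      using c c' by (simp add: w_def mod_hom_minus[OF cochain_complexD(3)[OF D] Dm Dm]
          D.M.minus_eq D.M.minus_add D.M.a_ac)
    finally show "w (i + 1) (diff (mapping_cone Z Y f) i p) = diff (shift_down D) i (w i p)" by simp
  qed
  then have "null_homotopic R (mapping_cone Z Y f) (shift_down D) w"
    by (rule null_homotopic_acyclic[where n = n]) (use mapping_cone_acyclic[OF qi] inj bd in auto)
  then obtain k
    where k: "\<And>i. k i \<in> mod_hom R (module_prod (obj Z i) (obj Y (i - 1))) (obj D (i - 2))"
    and kh: "\<And>i z y. z \<in> carrier (obj Z i) \<Longrightarrow> y \<in> carrier (obj Y (i - 1)) \<Longrightarrow>
      w i (z, y) = (\<ominus>\<^bsub>obj D (i - 1)\<^esub> diff D (i - 2) (k i (z, y))) \<oplus>\<^bsub>obj D (i - 1)\<^esub>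
        k (i + 1) (diff Z i z, f i z \<ominus>\<^bsub>obj Y i\<^esub> diff Y (i - 1) y)"
    unfolding null_homotopic_def by fastforce
  define v where "v i y = \<ominus>\<^bsub>obj D (i - 1)\<^esub> k (i + 1) (\<zero>\<^bsub>obj Z (i + 1)\<^esub>, y)" for i y
  have v': "(\<lambda>y. k (i + 1) (\<zero>\<^bsub>obj Z (i + 1)\<^esub>, y)) \<in> mod_hom R (obj Y i) (obj D (i - 1))" for i
    using mod_hom_comp[OF mod_hom_inr[OF Zm[of "i + 1"] Ym[of "i + 1 - 1"]] k[of "i + 1"]] by simp
  have v: "v i \<in> mod_hom R (obj Y i) (obj D (i - 1))" for i
    unfolding v_def by (rule mod_hom_neg[OF Dm v'])
  show ?thesis
  proof (rule null_homotopicI[OF v])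
    fix i y assume y: "y \<in> carrier (obj Y i)"
    interpret D: module R "obj D i" by (rule Dm)
    interpret Y: module R "obj Y (i + 1)" by (rule Ym)
    interpret Z: module R "obj Z (i + 1)" by (rule Zm)
    have dy: "diff Y i y \<in> carrier (obj Y (i + 1))" by (rule mod_hom_closed[OF dY y])
    have "w (i + 1) (\<zero>\<^bsub>obj Z (i + 1)\<^esub>, y) = h i y"
      using mod_hom_zero[OF u Zm Dm, of "i + 1"] mod_hom_closed[OF hh y]
      by (simp add: w_def D.M.minus_eq D.M.neg_zero)
    then have "h i y = (\<ominus>\<^bsub>obj D i\<^esub> diff D (i - 1) (k (i + 1) (\<zero>\<^bsub>obj Z (i + 1)\<^esub>, y))) \<oplus>\<^bsub>obj D i\<^esub>
        k (i + 2) (\<zero>\<^bsub>obj Z (i + 2)\<^esub>, \<ominus>\<^bsub>obj Y (i + 1)\<^esub> diff Y i y)"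
      using kh[of "\<zero>\<^bsub>obj Z (i + 1)\<^esub>" "i + 1" y] y dy
        mod_hom_zero[OF dZ Zm Zm, of "i + 1"] mod_hom_zero[OF fh Zm Ym]
      by (simp add: Y.M.minus_eq add.commute[of 1 i] add.commute[of 2 i])
    also have "k (i + 2) (\<zero>\<^bsub>obj Z (i + 2)\<^esub>, \<ominus>\<^bsub>obj Y (i + 1)\<^esub> diff Y i y) = v (i + 1) (diff Y i y)"
      using mod_hom_uminus[OF v' Ym Dm dy] by (simp add: v_def add.commute[of 2 i])
    also have "\<ominus>\<^bsub>obj D i\<^esub> diff D (i - 1) (k (i + 1) (\<zero>\<^bsub>obj Z (i + 1)\<^esub>, y)) = diff D (i - 1) (v i y)"
      using mod_hom_uminus[OF cochain_complexD(3)[OF D] Dm Dm mod_hom_closed[OF v' y]]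
      by (simp add: v_def)
    finally show "h i y = diff D (i - 1) (v i y) \<oplus>\<^bsub>obj D i\<^esub> v (i + 1) (diff Y i y)" .
  qed
qed

section \<open>Endomorphisms of a dualizing complex\<close>

lemma null_homotopic_cong:
  assumes "null_homotopic R X Y f" "\<And>i x. x \<in> carrier (obj X i) \<Longrightarrow> f i x = g i x"
  shows "null_homotopic R X Y g"
  using assms unfolding null_homotopic_def by metis

lemma null_homotopic_comp_left:
  assumes nh: "null_homotopic R X Y f" and X: "cochain_complex R X" and g: "chain_map R Y W g"
  shows "null_homotopic R X W (\<lambda>i x. g i (f i x))"
proof -
  obtain k where k: "\<And>i. k i \<in> mod_hom R (obj X i) (obj Y (i - 1))"
    and kh: "\<And>i x. x \<in> carrier (obj X i) \<Longrightarrow>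
      f i x = diff Y (i - 1) (k i x) \<oplus>\<^bsub>obj Y i\<^esub> k (i + 1) (diff X i x)"
    using nh unfolding null_homotopic_def by blast
  show ?thesis
  proof (rule null_homotopicI[where k = "\<lambda>i x. g (i - 1) (k i x)"])
    show "(\<lambda>x. g (i - 1) (k i x)) \<in> mod_hom R (obj X i) (obj W (i - 1))" for i
      by (rule mod_hom_comp[OF k chain_mapD(3)[OF g]])
    fix i x assume x: "x \<in> carrier (obj X i)"
    have "k (i + 1) (diff X i x) \<in> carrier (obj Y i)"
      using mod_hom_closed[OF k mod_hom_closed[OF cochain_complexD(2)[OF X] x]] by simp
    then show "g i (f i x) = diff W (i - 1) (g (i - 1) (k i x)) \<oplus>\<^bsub>obj W i\<^esub> g (i + 1 - 1) (k (i + 1) (diff X i x))"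
      using mod_hom_closed[OF cochain_complexD(3)[OF chain_mapD(1)[OF g]] mod_hom_closed[OF k x]]
        chain_mapD(5)[OF g mod_hom_closed[OF k x]]
      by (simp add: kh[OF x] mod_hom_add[OF chain_mapD(3)[OF g]])
  qed
qed

lemma null_homotopic_plus:
  assumes "null_homotopic R X Y f" "null_homotopic R X Y g" "cochain_complex R X" "cochain_complex R Y"
  shows "null_homotopic R X Y (\<lambda>i x. f i x \<oplus>\<^bsub>obj Y i\<^esub> g i x)"
proof -
  note Ym = cochain_complexD(1)[OF assms(4)] and d = cochain_complexD(3)[OF assms(4)]
  obtain k where k: "\<And>i. k i \<in> mod_hom R (obj X i) (obj Y (i - 1))"
    and kh: "\<And>i x. x \<in> carrier (obj X i) \<Longrightarrow>
      f i x = diff Y (i - 1) (k i x) \<oplus>\<^bsub>obj Y i\<^esub> k (i + 1) (diff X i x)"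
    using assms(1) unfolding null_homotopic_def by blast
  obtain l where l: "\<And>i. l i \<in> mod_hom R (obj X i) (obj Y (i - 1))"
    and lh: "\<And>i x. x \<in> carrier (obj X i) \<Longrightarrow>
      g i x = diff Y (i - 1) (l i x) \<oplus>\<^bsub>obj Y i\<^esub> l (i + 1) (diff X i x)"
    using assms(2) unfolding null_homotopic_def by blast
  show ?thesis
  proof (rule null_homotopicI[OF mod_hom_plus[OF Ym k l]])
    fix i x assume x: "x \<in> carrier (obj X i)"
    interpret Y: module R "obj Y i" by (rule Ym)
    note c = mod_hom_closed[OF k x] mod_hom_closed[OF l x]
      mod_hom_closed[OF d mod_hom_closed[OF k x]] mod_hom_closed[OF d mod_hom_closed[OF l x]]
      mod_hom_closed[OF k mod_hom_closed[OF cochain_complexD(2)[OF assms(3)] x]]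
      mod_hom_closed[OF l mod_hom_closed[OF cochain_complexD(2)[OF assms(3)] x]]
    show "f i x \<oplus>\<^bsub>obj Y i\<^esub> g i x =
      diff Y (i - 1) (k i x \<oplus>\<^bsub>obj Y (i - 1)\<^esub> l i x) \<oplus>\<^bsub>obj Y i\<^esub>
        (k (i + 1) (diff X i x) \<oplus>\<^bsub>obj Y (i + 1 - 1)\<^esub> l (i + 1) (diff X i x))"
      using c by (simp add: kh[OF x] lh[OF x] mod_hom_add[OF d] Y.M.a_ac)
  qed
qed

lemma smult_chain_map:
  assumes X: "cochain_complex R X" and s: "s \<in> carrier R"
  shows "chain_map R X X (\<lambda>i x. s \<odot>\<^bsub>obj X i\<^esub> x)"
proof (rule chain_mapI[OF X X])
  fix i
  interpret M: module R "obj X i" by (rule cochain_complexD[OF X])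
  show "(\<odot>\<^bsub>obj X i\<^esub>) s \<in> mod_hom R (obj X i) (obj X i)"
    by (rule mod_hom_scale[OF M.module_axioms _ s, of "\<lambda>x. x"]) (simp add: mod_hom_def)
  show "s \<odot>\<^bsub>obj X (i + 1)\<^esub> diff X i x = diff X i (s \<odot>\<^bsub>obj X i\<^esub> x)" if "x \<in> carrier (obj X i)" for x
    using mod_hom_smult[OF cochain_complexD(2)[OF X] s that] by simp
qed

lemma null_homotopic_scale:
  assumes "null_homotopic R X Y f" "cochain_complex R X" "cochain_complex R Y" "s \<in> carrier R"
  shows "null_homotopic R X Y (\<lambda>i x. s \<odot>\<^bsub>obj Y i\<^esub> f i x)"
  using null_homotopic_comp_left[OF assms(1,2) smult_chain_map[OF assms(3,4)]] .

lemma chain_map_minus: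
  assumes f: "chain_map R X Y f" and g: "chain_map R X Y g"
  shows "chain_map R X Y (\<lambda>i x. f i x \<ominus>\<^bsub>obj Y i\<^esub> g i x)"
proof (rule chain_mapI[OF chain_mapD(1,2)[OF f]])
  note Ym = cochain_complexD(1)[OF chain_mapD(2)[OF f]]
  note fh = chain_mapD(3)[OF f] and gh = chain_mapD(3)[OF g]
  fix i
  show "(\<lambda>x. f i x \<ominus>\<^bsub>obj Y i\<^esub> g i x) \<in> mod_hom R (obj X i) (obj Y i)"
    by (rule mod_hom_diff[OF Ym fh gh])
  show "f (i + 1) (diff X i x) \<ominus>\<^bsub>obj Y (i + 1)\<^esub> g (i + 1) (diff X i x) =
    diff Y i (f i x \<ominus>\<^bsub>obj Y i\<^esub> g i x)" if x: "x \<in> carrier (obj X i)" for x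
    using chain_mapD(4)[OF f x] chain_mapD(4)[OF g x] mod_hom_closed[OF fh x] mod_hom_closed[OF gh x]
    by (simp add: mod_hom_minus[OF cochain_complexD(2)[OF chain_mapD(2)[OF f]] Ym Ym])
qed

lemma hom_complex_simps [simp]:
  "obj (hom_complex R X Y) = hom_obj R X Y" "diff (hom_complex R X Y) = hom_diff X Y"
  by (simp_all add: hom_complex_def)

lemma mod_hom_restrict:
  assumes "module R M" "f \<in> mod_hom R M N"
  shows "restrict f (carrier M) \<in> mod_hom R M N"
proof -
  interpret M: module R M by fact
  show ?thesis using assms(2) by (auto simp: mod_hom_def)
qed

text \<open>An element of degree -1 of the Hom complex is a family of maps of the shape of a homotopy,
  and in that degree the two terms of the differential are added. The Hom complex consists of
  extensional functions, hence the hypothesis on f.\<close>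

lemma hom_coboundary_iff_null_homotopic:
  assumes X: "cochain_complex R X" and f: "\<And>i. f i \<in> extensional (carrier (obj X i))"
  shows "f \<in> coboundaries (hom_complex R X Y) 0 \<longleftrightarrow> null_homotopic R X Y f"
proof
  note Xm = cochain_complexD(1)[OF X] and d = cochain_complexD(2)[OF X]
  assume "f \<in> coboundaries (hom_complex R X Y) 0"
  then obtain k where "k \<in> carrier (hom_obj R X Y (-1))" "f = hom_diff X Y (-1) k"
    by (auto simp: coboundaries_def)
  then show "null_homotopic R X Y f"
    by (intro null_homotopicI[where k = k]) (auto simp: hom_obj_def hom_diff_def Let_def)
next
  note Xm = cochain_complexD(1)[OF X] and d = cochain_complexD(2)[OF X]
  assume "null_homotopic R X Y f"
  then obtain k where k: "\<And>i. k i \<in> mod_hom R (obj X i) (obj Y (i - 1))"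
    and kh: "\<And>i x. x \<in> carrier (obj X i) \<Longrightarrow>
      f i x = diff Y (i - 1) (k i x) \<oplus>\<^bsub>obj Y i\<^esub> k (i + 1) (diff X i x)"
    unfolding null_homotopic_def by blast
  define l where "l i = restrict (k i) (carrier (obj X i))" for i
  have "l \<in> carrier (hom_obj R X Y (-1))"
    using mod_hom_restrict[OF Xm k] by (auto simp: hom_obj_def l_def)
  moreover have "f = hom_diff X Y (-1) l"
  proof (intro ext)
    fix i x show "f i x = hom_diff X Y (-1) l i x"
    proof (cases "x \<in> carrier (obj X i)")
      case True
      then show ?thesis using mod_hom_closed[OF d True] by (simp add: hom_diff_def l_def kh)
    next
      case False
      then show ?thesis using f[of i] by (auto simp: hom_diff_def extensional_def)
    qed
  qed
  ultimately show "f \<in> coboundaries (hom_complex R X Y) 0" by (auto simp: coboundaries_def)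
qed

text \<open>This and the next lemma say that the map from R to the endomorphisms of D up to homotopy is
  bijective: they spell out the defining quasi-isomorphism of a dualizing complex in degree 0.\<close>

lemma homothety_null_homotopic:
  assumes D: "dualizing_complex R D" and u: "u \<in> carrier R"
    and nh: "null_homotopic R D D (\<lambda>i x. u \<odot>\<^bsub>obj D i\<^esub> x)"
  shows "u = \<zero>\<^bsub>R\<^esub>"
proof -
  have Dc: "cochain_complex R D" and qi: "quasi_iso R (ring_as_complex R) (hom_complex R D D) (homothety D)"
    using D by (auto simp: dualizing_complex_def)
  have "null_homotopic R D D (homothety D 0 u)"
    by (rule null_homotopic_cong[OF nh]) (simp add: homothety_def)
  then have "homothety D 0 u \<in> coboundaries (hom_complex R D D) 0"
    by (subst hom_coboundary_iff_null_homotopic[OF Dc]) (auto simp: homothety_def)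
  moreover have "u \<in> cocycles (ring_as_complex R) 0"
    using u by (auto simp: cocycles_def ring_as_complex_def)
  ultimately have "u \<in> coboundaries (ring_as_complex R) 0"
    by (intro quasi_iso_injective[OF qi])
  then show ?thesis by (auto simp: coboundaries_def ring_as_complex_def)
qed

lemma homotopic_to_homothety:
  assumes D: "dualizing_complex R D" and f: "chain_map R D D f"
  shows "\<exists>r\<in>carrier R. null_homotopic R D D (\<lambda>i x. f i x \<ominus>\<^bsub>obj D i\<^esub> r \<odot>\<^bsub>obj D i\<^esub> x)"
proof -
  have Dc: "cochain_complex R D" and qi: "quasi_iso R (ring_as_complex R) (hom_complex R D D) (homothety D)"
    using D by (auto simp: dualizing_complex_def)
  note Dm = cochain_complexD(1)[OF Dc] and d = cochain_complexD(2)[OF Dc]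
  note fh = chain_mapD(3)[OF f]
  define g where "g i = restrict (f i) (carrier (obj D i))" for i
  have gc: "g \<in> carrier (hom_obj R D D 0)"
    using mod_hom_restrict[OF Dm fh] by (auto simp: hom_obj_def g_def)
  have "hom_diff D D 0 g = \<zero>\<^bsub>hom_obj R D D 1\<^esub>"
  proof (intro ext)
    fix i x
    interpret D: module R "obj D (i + 1)" by (rule Dm)
    show "hom_diff D D 0 g i x = \<zero>\<^bsub>hom_obj R D D 1\<^esub> i x"
    proof (cases "x \<in> carrier (obj D i)")
      case True
      have "diff D i (f i x) \<in> carrier (obj D (i + 1))"
        by (rule mod_hom_closed[OF d mod_hom_closed[OF fh True]])
      then show ?thesis
        using True mod_hom_closed[OF d True] chain_mapD(4)[OF f True]
        by (simp add: hom_diff_def hom_obj_def g_def D.M.minus_eq D.M.r_neg)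
    qed (simp add: hom_diff_def hom_obj_def)
  qed
  then have "g \<in> cocycles (hom_complex R D D) 0" using gc by (auto simp: cocycles_def)
  from quasi_iso_surjective[OF qi this] obtain r b where r: "r \<in> carrier R"
    and b: "b \<in> coboundaries (hom_complex R D D) 0"
    and g: "g = b \<oplus>\<^bsub>hom_obj R D D 0\<^esub> homothety D 0 r"
    by (auto simp: cocycles_def ring_as_complex_def)
  have bc: "b \<in> carrier (hom_obj R D D 0)"
    using b coboundaries_closed(1)[OF chain_mapD(2)[of R "ring_as_complex R" "hom_complex R D D"]] qi
    by (auto simp: cocycles_def quasi_iso_def)
  then have bx: "b i \<in> mod_hom R (obj D i) (obj D i)" "b i \<in> extensional (carrier (obj D i))" for i
    by (auto simp: hom_obj_def)
  have "null_homotopic R D D b" using hom_coboundary_iff_null_homotopic[OF Dc bx(2)] b by blast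
  moreover have "b i x = f i x \<ominus>\<^bsub>obj D i\<^esub> r \<odot>\<^bsub>obj D i\<^esub> x" if x: "x \<in> carrier (obj D i)" for i x
  proof -
    interpret D: module R "obj D i" by (rule Dm)
    have "f i x = b i x \<oplus>\<^bsub>obj D i\<^esub> r \<odot>\<^bsub>obj D i\<^esub> x"
      using fun_cong[OF fun_cong[OF g, of i], of x] x by (simp add: g_def hom_obj_def homothety_def)
    then show ?thesis
      using mod_hom_closed[OF bx(1) x] x r by (simp add: D.M.minus_eq D.M.a_assoc D.M.r_neg)
  qed
  ultimately show ?thesis using r by (blast intro: null_homotopic_cong)
qed

text \<open>In the derived category, Y is isomorphic to D, whose endomorphisms are the multiplications
  by elements of R. So \<alpha> corresponds to some r, and s \<alpha> = a becomes s r = a. To see this with chain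
  maps, let f and g be the quasi-isomorphisms from Z to Y and D. Choose h with h f homotopic to g,
  and then \<psi> with \<psi> g homotopic to h \<alpha> f. Then (a - s \<psi>) g is homotopic to h (a - s \<alpha>) f = 0, so s
  \<psi> is homotopic to a. Finally \<psi> is homotopic to multiplication by some r.\<close>

theorem dualizing_complex_divides:
  fixes D :: "('r, 'd) cochain" and Y :: "('r, 'm) cochain"
  assumes D: "dualizing_complex R D" and der: "derived_isomorphic TYPE('z) R Y D"
    and \<alpha>: "chain_map R Y Y \<alpha>" and s: "s \<in> carrier R" and a: "a \<in> carrier R"
    and s\<alpha>: "\<And>i y. y \<in> carrier (obj Y i) \<Longrightarrow> s \<odot>\<^bsub>obj Y i\<^esub> \<alpha> i y = a \<odot>\<^bsub>obj Y i\<^esub> y"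
  shows "\<exists>r\<in>carrier R. a = s \<otimes>\<^bsub>R\<^esub> r"
proof -
  obtain Z :: "('r, 'z) cochain" and f g where f: "quasi_iso R Z Y f" and g: "quasi_iso R Z D g"
    using der by (auto simp: derived_isomorphic_def)
  have fc: "chain_map R Z Y f" and gc: "chain_map R Z D g" using f g by (auto simp: quasi_iso_def)
  have Dc: "cochain_complex R D" and inj: "\<And>i. injective_module R (obj D i)"
    using D by (auto simp: dualizing_complex_def)
  obtain b where b: "\<And>i. \<bar>i\<bar> > b \<Longrightarrow> carrier (obj D i) = {\<zero>\<^bsub>obj D i\<^esub>}"
    using D by (auto simp: dualizing_complex_def)
  have bd: "carrier (obj D i) = {\<zero>\<^bsub>obj D i\<^esub>}" if "i < - \<bar>b\<bar>" for i using that by (intro b) auto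
  note Zc = chain_mapD(1)[OF fc]
  note Dm = cochain_complexD(1)[OF Dc]
  obtain h where h: "chain_map R Y D h"
    and n1: "null_homotopic R Z D (\<lambda>i z. g i z \<ominus>\<^bsub>obj D i\<^esub> h i (f i z))"
    using homotopy_lift[OF f gc inj bd] by blast
  have "chain_map R Z D (\<lambda>i z. h i (\<alpha> i (f i z)))"
    using chain_map_comp[OF chain_map_comp[OF fc \<alpha>] h] .
  from homotopy_lift[OF g this inj bd] obtain \<psi> where \<psi>: "chain_map R D D \<psi>"
    and n2: "null_homotopic R Z D (\<lambda>i z. h i (\<alpha> i (f i z)) \<ominus>\<^bsub>obj D i\<^esub> \<psi> i (g i z))" by blast
  have \<chi>: "chain_map R D D (\<lambda>i x. a \<odot>\<^bsub>obj D i\<^esub> x \<ominus>\<^bsub>obj D i\<^esub> s \<odot>\<^bsub>obj D i\<^esub> \<psi> i x)"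
    by (rule chain_map_minus[OF smult_chain_map[OF Dc a] chain_map_comp[OF \<psi> smult_chain_map[OF Dc s]]])
  have "null_homotopic R Z D
      (\<lambda>i z. a \<odot>\<^bsub>obj D i\<^esub> g i z \<ominus>\<^bsub>obj D i\<^esub> s \<odot>\<^bsub>obj D i\<^esub> \<psi> i (g i z))"
  proof (rule null_homotopic_cong[OF null_homotopic_plus[OF null_homotopic_scale[OF n1 Zc Dc a]
          null_homotopic_scale[OF n2 Zc Dc s] Zc Dc]])
    fix i z assume z: "z \<in> carrier (obj Z i)"
    interpret D: module R "obj D i" by (rule Dm)
    note fz = mod_hom_closed[OF chain_mapD(3)[OF fc] z]
    note \<alpha>z = mod_hom_closed[OF chain_mapD(3)[OF \<alpha>] fz]
    note c = mod_hom_closed[OF chain_mapD(3)[OF gc] z] mod_hom_closed[OF chain_mapD(3)[OF h] fz]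
      mod_hom_closed[OF chain_mapD(3)[OF h] \<alpha>z]
    note c4 = mod_hom_closed[OF chain_mapD(3)[OF \<psi>] c(1)]
    have e: "s \<odot>\<^bsub>obj D i\<^esub> h i (\<alpha> i (f i z)) = a \<odot>\<^bsub>obj D i\<^esub> h i (f i z)"
      using mod_hom_smult[OF chain_mapD(3)[OF h] s \<alpha>z] mod_hom_smult[OF chain_mapD(3)[OF h] a fz] s\<alpha>[OF fz]
      by simp
    show "a \<odot>\<^bsub>obj D i\<^esub> (g i z \<ominus>\<^bsub>obj D i\<^esub> h i (f i z)) \<oplus>\<^bsub>obj D i\<^esub>
        s \<odot>\<^bsub>obj D i\<^esub> (h i (\<alpha> i (f i z)) \<ominus>\<^bsub>obj D i\<^esub> \<psi> i (g i z)) =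
      a \<odot>\<^bsub>obj D i\<^esub> g i z \<ominus>\<^bsub>obj D i\<^esub> s \<odot>\<^bsub>obj D i\<^esub> \<psi> i (g i z)"
      using c c4 a s
      by (simp add: D.M.minus_eq D.smult_r_distr D.smult_r_minus e D.M.a_assoc D.M.r_neg1)
  qed
  from homotopy_unique[OF g \<chi> this inj bd]
  have n3: "null_homotopic R D D (\<lambda>i x. a \<odot>\<^bsub>obj D i\<^esub> x \<ominus>\<^bsub>obj D i\<^esub> s \<odot>\<^bsub>obj D i\<^esub> \<psi> i x)" by blast
  obtain r where r: "r \<in> carrier R"
    and n4: "null_homotopic R D D (\<lambda>i x. \<psi> i x \<ominus>\<^bsub>obj D i\<^esub> r \<odot>\<^bsub>obj D i\<^esub> x)"
    using homotopic_to_homothety[OF D \<psi>] by blast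
  interpret R: cring R using Dm by (rule module.axioms)
  have "null_homotopic R D D (\<lambda>i x. (a \<ominus>\<^bsub>R\<^esub> s \<otimes>\<^bsub>R\<^esub> r) \<odot>\<^bsub>obj D i\<^esub> x)"
  proof (rule null_homotopic_cong[OF null_homotopic_plus[OF n3 null_homotopic_scale[OF n4 Dc Dc s] Dc Dc]])
    fix i x assume x: "x \<in> carrier (obj D i)"
    interpret D: module R "obj D i" by (rule Dm)
    have "\<psi> i x \<in> carrier (obj D i)" by (rule mod_hom_closed[OF chain_mapD(3)[OF \<psi>] x])
    then show "(a \<odot>\<^bsub>obj D i\<^esub> x \<ominus>\<^bsub>obj D i\<^esub> s \<odot>\<^bsub>obj D i\<^esub> \<psi> i x) \<oplus>\<^bsub>obj D i\<^esub>
        s \<odot>\<^bsub>obj D i\<^esub> (\<psi> i x \<ominus>\<^bsub>obj D i\<^esub> r \<odot>\<^bsub>obj D i\<^esub> x) = (a \<ominus>\<^bsub>R\<^esub> s \<otimes>\<^bsub>R\<^esub> r) \<odot>\<^bsub>obj D i\<^esub> x"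
      using x a s r
      by (simp add: D.M.minus_eq R.minus_eq D.smult_r_distr D.smult_r_minus D.smult_l_distr
          D.smult_l_minus D.smult_assoc1 D.M.a_assoc D.M.r_neg1)
  qed
  then have "a \<ominus>\<^bsub>R\<^esub> s \<otimes>\<^bsub>R\<^esub> r = \<zero>\<^bsub>R\<^esub>"
    using homothety_null_homotopic[OF D] a s r by simp
  then show ?thesis using a s r by (intro bexI[of _ r]) (auto intro: R.eq_if_minus_zero)
qed

section \<open>Noetherian rings\<close>

context cring
begin

text \<open>Ideals of a subring A, described inside the ambient ring R. The basis theorem below is
  applied to a chain of subrings of one fixed ring, each obtained from the previous one by
  adjoining an element.\<close>

definition ideal_in :: "'a set \<Rightarrow> 'a set \<Rightarrow> bool" where
  "ideal_in A J \<longleftrightarrow> J \<subseteq> A \<and> \<zero> \<in> J \<and> (\<forall>x\<in>J. \<forall>y\<in>J. x \<oplus> y \<in> J) \<and> (\<forall>a\<in>A. \<forall>x\<in>J. a \<otimes> x \<in> J)"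

text \<open>Finite generation of ideals, expressed by the universal property of the ideal generated by
  F.\<close>

definition noetherian_in :: "'a set \<Rightarrow> bool" where
  "noetherian_in A \<longleftrightarrow> (\<forall>J. ideal_in A J \<longrightarrow>
    (\<exists>F\<subseteq>J. finite F \<and> (\<forall>K. ideal_in A K \<and> F \<subseteq> K \<longrightarrow> J \<subseteq> K)))"

text \<open>The values at x of polynomials of degree below n over A. As x may be algebraic over A, an
  element has no degree of its own; it only has such bounds.\<close>

primrec polys_below :: "'a set \<Rightarrow> 'a \<Rightarrow> nat \<Rightarrow> 'a set" where
  "polys_below A x 0 = {\<zero>}"
| "polys_below A x (Suc n) = {p \<oplus> a \<otimes> x [^] n | p a. p \<in> polys_below A x n \<and> a \<in> A}"

definition adjoin :: "'a set \<Rightarrow> 'a \<Rightarrow> 'a set" where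
  "adjoin A x = (\<Union>n. polys_below A x n)"

context
  fixes A :: "'a set" and x :: 'a
  assumes A: "subring A R" and x: "x \<in> carrier R"
begin

lemma A_carrier: "a \<in> A \<Longrightarrow> a \<in> carrier R" 
  and A_zero: "\<zero> \<in> A" and A_one: "\<one> \<in> A"
  and A_add: "a \<in> A \<Longrightarrow> b \<in> A \<Longrightarrow> a \<oplus> b \<in> A"
  and A_mult: "a \<in> A \<Longrightarrow> b \<in> A \<Longrightarrow> a \<otimes> b \<in> A"
  and A_neg: "a \<in> A \<Longrightarrow> \<ominus> a \<in> A"
  using subringE[OF A] by auto

lemma polys_below_SucI:
  "p \<in> polys_below A x n \<Longrightarrow> a \<in> A \<Longrightarrow> q = p \<oplus> a \<otimes> x [^] n \<Longrightarrow> q \<in> polys_below A x (Suc n)"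
  by auto

lemma polys_below_carrier: "p \<in> polys_below A x n \<Longrightarrow> p \<in> carrier R"
  by (induction n arbitrary: p) (use x A_carrier in auto)

lemma polys_below_zero: "\<zero> \<in> polys_below A x n"
proof (induction n)
  case (Suc n)
  have "\<zero> = \<zero> \<oplus> \<zero> \<otimes> x [^] n" using x by simp
  then show ?case using Suc A_zero by auto
qed simp

lemma polys_below_Suc: "polys_below A x n \<subseteq> polys_below A x (Suc n)"
proof
  fix p assume p: "p \<in> polys_below A x n"
  have "p = p \<oplus> \<zero> \<otimes> x [^] n" using x polys_below_carrier[OF p] by simp
  then show "p \<in> polys_below A x (Suc n)" using p A_zero by auto
qed

lemma polys_below_mono: "m \<le> n \<Longrightarrow> polys_below A x m \<subseteq> polys_below A x n"
  by (rule lift_Suc_mono_le[of "polys_below A x", OF polys_below_Suc])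

lemma polys_below_add:
  "p \<in> polys_below A x n \<Longrightarrow> q \<in> polys_below A x n \<Longrightarrow> p \<oplus> q \<in> polys_below A x n"
proof (induction n arbitrary: p q)
  case (Suc n)
  then obtain p' a q' b where *: "p = p' \<oplus> a \<otimes> x [^] n" "q = q' \<oplus> b \<otimes> x [^] n"
    "p' \<in> polys_below A x n" "q' \<in> polys_below A x n" "a \<in> A" "b \<in> A" by auto
  then have "p \<oplus> q = (p' \<oplus> q') \<oplus> (a \<oplus> b) \<otimes> x [^] n"
    using x polys_below_carrier A_carrier by (simp add: l_distr a_ac)
  then show ?case
    using Suc.IH[OF *(3,4)] A_add[OF *(5,6)] by (intro polys_below_SucI[of "p' \<oplus> q'" n "a \<oplus> b"])
qed simp

lemma polys_below_smult:
  "a \<in> A \<Longrightarrow> p \<in> polys_below A x n \<Longrightarrow> a \<otimes> p \<in> polys_below A x n"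
proof (induction n arbitrary: p)
  case (Suc n)
  then obtain p' b where *: "p = p' \<oplus> b \<otimes> x [^] n" "p' \<in> polys_below A x n" "b \<in> A" by auto
  then have "a \<otimes> p = a \<otimes> p' \<oplus> (a \<otimes> b) \<otimes> x [^] n"
    using x polys_below_carrier A_carrier Suc.prems by (simp add: r_distr m_assoc)
  then show ?case
    using Suc.IH[OF Suc.prems(1) *(2)] A_mult[OF Suc.prems(1) *(3)]
    by (intro polys_below_SucI[of "a \<otimes> p'" n "a \<otimes> b"])
qed (use A_carrier in simp)

lemma polys_below_shift:
  "p \<in> polys_below A x n \<Longrightarrow> x \<otimes> p \<in> polys_below A x (Suc n)"
proof (induction n arbitrary: p)
  case 0
  then show ?case using x polys_below_zero[of 1] by simp
next
  case (Suc n)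
  then obtain p' b where *: "p = p' \<oplus> b \<otimes> x [^] n" "p' \<in> polys_below A x n" "b \<in> A" by auto
  then have "x \<otimes> p = x \<otimes> p' \<oplus> b \<otimes> x [^] Suc n"
    using x polys_below_carrier A_carrier by (simp add: r_distr m_ac)
  moreover have "x \<otimes> p' \<in> polys_below A x (Suc n)" using Suc.IH * by blast
  ultimately show ?case using * unfolding polys_below.simps(2)[of A x "Suc n"] by blast
qed

lemma polys_below_shift_power:
  "p \<in> polys_below A x n \<Longrightarrow> x [^] m \<otimes> p \<in> polys_below A x (m + n)"
proof (induction m)
  case 0
  then show ?case using polys_below_carrier by simp
next
  case (Suc m)
  then have "x \<otimes> (x [^] m \<otimes> p) \<in> polys_below A x (Suc (m + n))" by (intro polys_below_shift) blast
  then show ?case using x polys_below_carrier[OF Suc.prems] by (simp add: m_ac)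
qed

lemma polys_below_mult:
  "p \<in> polys_below A x m \<Longrightarrow> q \<in> polys_below A x n \<Longrightarrow> p \<otimes> q \<in> polys_below A x (m + n)"
proof (induction m arbitrary: p)
  case 0
  then show ?case using polys_below_zero polys_below_carrier by simp
next
  case (Suc m)
  then obtain p' a where *: "p = p' \<oplus> a \<otimes> x [^] m" "p' \<in> polys_below A x m" "a \<in> A" by auto
  have "p \<otimes> q = p' \<otimes> q \<oplus> a \<otimes> (x [^] m \<otimes> q)"
    using * x polys_below_carrier A_carrier Suc.prems by (simp add: l_distr m_assoc)
  moreover have "p' \<otimes> q \<in> polys_below A x (Suc m + n)"
    using Suc.IH[OF *(2) Suc.prems(2)] polys_below_mono[of "m + n" "Suc m + n"] by auto
  moreover have "a \<otimes> (x [^] m \<otimes> q) \<in> polys_below A x (Suc m + n)"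
    using polys_below_smult[OF *(3) polys_below_shift_power[OF Suc.prems(2)]]
      polys_below_mono[of "m + n" "Suc m + n"] by auto
  ultimately show ?case
    using polys_below_add[of "p' \<otimes> q" "Suc m + n"] by (simp del: polys_below.simps)
qed

lemma polys_below_neg: "p \<in> polys_below A x n \<Longrightarrow> \<ominus> p \<in> polys_below A x n"
  using polys_below_smult[of "\<ominus> \<one>" p n] A_neg[OF A_one] polys_below_carrier by (simp add: l_minus)

lemma A_subset_adjoin: "A \<subseteq> adjoin A x"
proof
  fix a assume a: "a \<in> A"
  then have "a = \<zero> \<oplus> a \<otimes> x [^] (0::nat)" using A_carrier by simp
  then have "a \<in> polys_below A x (Suc 0)" using a by auto
  then show "a \<in> adjoin A x" unfolding adjoin_def by blast
qed

lemma in_adjoin: "x \<in> adjoin A x"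
proof -
  have "\<one> \<in> polys_below A x (Suc 0)"
    using A_one by (intro polys_below_SucI[of \<zero> 0 \<one>]) auto
  then have "x \<otimes> \<one> \<in> polys_below A x (Suc (Suc 0))" by (rule polys_below_shift)
  then have "x \<in> polys_below A x (Suc (Suc 0))" using x by (simp del: polys_below.simps)
  then show ?thesis unfolding adjoin_def by blast
qed

lemma adjoin_subring: "subring (adjoin A x) R"
proof (rule subringI)
  show "adjoin A x \<subseteq> carrier R" using polys_below_carrier by (auto simp: adjoin_def)
  show "\<one> \<in> adjoin A x" using A_subset_adjoin A_one by blast
  show "\<ominus> h \<in> adjoin A x" if "h \<in> adjoin A x" for h
    using that polys_below_neg by (auto simp: adjoin_def)
  show "h1 \<otimes> h2 \<in> adjoin A x" if "h1 \<in> adjoin A x" "h2 \<in> adjoin A x" for h1 h2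
    using that polys_below_mult by (fastforce simp: adjoin_def)
  show "h1 \<oplus> h2 \<in> adjoin A x" if h: "h1 \<in> adjoin A x" "h2 \<in> adjoin A x" for h1 h2
  proof -
    obtain m n
      where "h1 \<in> polys_below A x m" "h2 \<in> polys_below A x n" using h by (auto simp: adjoin_def)
    then have "h1 \<in> polys_below A x (max m n)" "h2 \<in> polys_below A x (max m n)"
      using polys_below_mono[of m "max m n"] polys_below_mono[of n "max m n"] by auto
    then show ?thesis using polys_below_add unfolding adjoin_def by blast
  qed
qed

definition lead_coeffs :: "'a set \<Rightarrow> nat \<Rightarrow> 'a set" where
  "lead_coeffs J n = {a \<in> A. \<exists>p\<in>polys_below A x n. p \<oplus> a \<otimes> x [^] n \<in> J}"

lemma lead_coeffs_ideal:
  assumes J: "ideal_in (adjoin A x) J"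
  shows "ideal_in A (lead_coeffs J n)"
  unfolding ideal_in_def
proof (intro conjI ballI)
  have J': "\<zero> \<in> J" "\<And>u v. u \<in> J \<Longrightarrow> v \<in> J \<Longrightarrow> u \<oplus> v \<in> J"
    "\<And>a u. a \<in> A \<Longrightarrow> u \<in> J \<Longrightarrow> a \<otimes> u \<in> J"
    using J A_subset_adjoin unfolding ideal_in_def by auto
  show "lead_coeffs J n \<subseteq> A" by (auto simp: lead_coeffs_def)
  have "\<zero> \<oplus> \<zero> \<otimes> x [^] n \<in> J" using J' x by simp
  then show "\<zero> \<in> lead_coeffs J n" using polys_below_zero A_zero unfolding lead_coeffs_def by blast
  fix a assume "a \<in> lead_coeffs J n"
  then obtain p where a: "a \<in> A" and p: "p \<in> polys_below A x n" "p \<oplus> a \<otimes> x [^] n \<in> J"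
    by (auto simp: lead_coeffs_def)
  {
    fix b assume "b \<in> lead_coeffs J n"
    then obtain q where b: "b \<in> A" and q: "q \<in> polys_below A x n" "q \<oplus> b \<otimes> x [^] n \<in> J"
      by (auto simp: lead_coeffs_def)
    have "(p \<oplus> q) \<oplus> (a \<oplus> b) \<otimes> x [^] n = (p \<oplus> a \<otimes> x [^] n) \<oplus> (q \<oplus> b \<otimes> x [^] n)"
      using a b p q x polys_below_carrier A_carrier by (simp add: l_distr a_ac)
    then have "(p \<oplus> q) \<oplus> (a \<oplus> b) \<otimes> x [^] n \<in> J" using J'(2)[OF p(2) q(2)] by simp
    then show "a \<oplus> b \<in> lead_coeffs J n"
      using polys_below_add[OF p(1) q(1)] A_add[OF a b] unfolding lead_coeffs_def by blast
  }
  {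
    fix c assume c: "c \<in> A"
    have "c \<otimes> p \<oplus> (c \<otimes> a) \<otimes> x [^] n = c \<otimes> (p \<oplus> a \<otimes> x [^] n)"
      using a c p x polys_below_carrier A_carrier by (simp add: r_distr m_assoc)
    then have "c \<otimes> p \<oplus> (c \<otimes> a) \<otimes> x [^] n \<in> J" using J'(3)[OF c p(2)] by simp
    then show "c \<otimes> a \<in> lead_coeffs J n"
      using polys_below_smult[OF c p(1)] A_mult[OF c a] unfolding lead_coeffs_def by blast
  }
qed

lemma lead_coeffs_mono:
  assumes J: "ideal_in (adjoin A x) J"
  shows "m \<le> n \<Longrightarrow> lead_coeffs J m \<subseteq> lead_coeffs J n"
proof (rule lift_Suc_mono_le[of "lead_coeffs J"])
  fix n show "lead_coeffs J n \<subseteq> lead_coeffs J (Suc n)"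
  proof
    fix a assume "a \<in> lead_coeffs J n"
    then obtain p where a: "a \<in> A" and p: "p \<in> polys_below A x n" "p \<oplus> a \<otimes> x [^] n \<in> J"
      by (auto simp: lead_coeffs_def)
    have "x \<otimes> (p \<oplus> a \<otimes> x [^] n) \<in> J" using J in_adjoin p(2) by (auto simp: ideal_in_def)
    moreover have "x \<otimes> (p \<oplus> a \<otimes> x [^] n) = x \<otimes> p \<oplus> a \<otimes> x [^] Suc n"
      using a p x polys_below_carrier A_carrier by (simp add: r_distr m_ac)
    ultimately show "a \<in> lead_coeffs J (Suc n)"
      using polys_below_shift[OF p(1)] a unfolding lead_coeffs_def by auto
  qed
qed

text \<open>Hilbert's argument with leading coefficients. The ideals L n of leading coefficients of the
  elements of J of degree at most n increase and are all contained in some L N. Lifts to J of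
  generators of L 0, ..., L N generate J: given an element of J, subtract a combination of lifts
  with the same leading coefficient and induct on the degree. That an element can have several
  leading coefficients does no harm, since the induction is on the bound n.\<close>

theorem Hilbert_basis:
  assumes noeth: "noetherian_in A"
  shows "noetherian_in (adjoin A x)"
  unfolding noetherian_in_def
proof (intro allI impI)
  fix J assume J: "ideal_in (adjoin A x) J"
  have noethE: "\<exists>F\<subseteq>I. finite F \<and> (\<forall>K. ideal_in A K \<and> F \<subseteq> K \<longrightarrow> I \<subseteq> K)" if "ideal_in A I" for I
    using noeth that unfolding noetherian_in_def by blast
  define L where "L = (\<Union>n. lead_coeffs J n)"
  have "ideal_in A L"
    unfolding ideal_in_def
  proof (intro conjI ballI)
    show "L \<subseteq> A" by (auto simp: L_def lead_coeffs_def)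
    show "\<zero> \<in> L" using lead_coeffs_ideal[OF J] unfolding L_def ideal_in_def by blast
    show "a \<otimes> y \<in> L" if "a \<in> A" "y \<in> L" for a y
      using that lead_coeffs_ideal[OF J] unfolding L_def ideal_in_def by blast
    fix y z assume "y \<in> L" "z \<in> L"
    then obtain m n where "y \<in> lead_coeffs J m" "z \<in> lead_coeffs J n" by (auto simp: L_def)
    then have "y \<in> lead_coeffs J (max m n)" "z \<in> lead_coeffs J (max m n)"
      using lead_coeffs_mono[OF J, of m "max m n"] lead_coeffs_mono[OF J, of n "max m n"] by auto
    then show "y \<oplus> z \<in> L" using lead_coeffs_ideal[OF J] unfolding L_def ideal_in_def by blast
  qed
  from noethE[OF this] obtain F where F: "F \<subseteq> L" "finite F"
    and gen: "\<And>K. ideal_in A K \<Longrightarrow> F \<subseteq> K \<Longrightarrow> L \<subseteq> K" by blast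
  have "\<exists>N. F \<subseteq> lead_coeffs J N"
    using F(2,1)
  proof (induction F)
    case (insert a F)
    then obtain N m where "F \<subseteq> lead_coeffs J N" "a \<in> lead_coeffs J m" by (auto simp: L_def)
    then have "insert a F \<subseteq> lead_coeffs J (max m N)"
      using lead_coeffs_mono[OF J, of m "max m N"] lead_coeffs_mono[OF J, of N "max m N"] by auto
    then show ?case by blast
  qed simp
  then obtain N where N: "F \<subseteq> lead_coeffs J N" by blast
  have LN: "lead_coeffs J n \<subseteq> lead_coeffs J N" for n
    using gen[OF lead_coeffs_ideal[OF J] N] by (auto simp: L_def)
  have "\<forall>n. \<exists>F\<subseteq>lead_coeffs J n. finite F \<and> (\<forall>K. ideal_in A K \<and> F \<subseteq> K \<longrightarrow> lead_coeffs J n \<subseteq> K)"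
    using noethE[OF lead_coeffs_ideal[OF J]] by blast
  then obtain G where G: "\<And>n. G n \<subseteq> lead_coeffs J n" "\<And>n. finite (G n)"
    and Ggen: "\<And>n K. ideal_in A K \<Longrightarrow> G n \<subseteq> K \<Longrightarrow> lead_coeffs J n \<subseteq> K" by metis
  have "\<forall>n a. \<exists>u. a \<in> lead_coeffs J n \<longrightarrow> u \<in> J \<and> (\<exists>p\<in>polys_below A x n. u = p \<oplus> a \<otimes> x [^] n)"
    unfolding lead_coeffs_def by blast
  then obtain u where u: "\<And>n a. a \<in> lead_coeffs J n \<Longrightarrow> u n a \<in> J"
    "\<And>n a. a \<in> lead_coeffs J n \<Longrightarrow> \<exists>p\<in>polys_below A x n. u n a = p \<oplus> a \<otimes> x [^] n" by metis
  define H where "H = (\<Union>n\<in>{..N}. u n ` G n)"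
  have HJ: "H \<subseteq> J" using G(1) u(1) by (fastforce simp: H_def)
  have "J \<subseteq> K" if K: "ideal_in (adjoin A x) K" and HK: "H \<subseteq> K" for K
  proof -
    \<comment> \<open>It suffices that every leading coefficient of J is one of \<open>J \<inter> K\<close>.\<close>
    have JK: "ideal_in (adjoin A x) (J \<inter> K)" using J K by (auto simp: ideal_in_def)
    have low: "lead_coeffs J n \<subseteq> lead_coeffs (J \<inter> K) n" if n: "n \<le> N" for n
    proof (rule Ggen[OF lead_coeffs_ideal[OF JK]])
      show "G n \<subseteq> lead_coeffs (J \<inter> K) n"
      proof
        fix a assume a: "a \<in> G n"
        then have "u n a \<in> J \<inter> K" using HK HJ n unfolding H_def by blast
        moreover have "a \<in> A" using a G(1) by (auto simp: lead_coeffs_def)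
        ultimately show "a \<in> lead_coeffs (J \<inter> K) n"
          using u(2)[of a n] a G(1) unfolding lead_coeffs_def by fastforce
      qed
    qed
    have all: "lead_coeffs J n \<subseteq> lead_coeffs (J \<inter> K) n" for n
      using low[of n] LN[of n] low[of N] lead_coeffs_mono[OF JK, of N n] by (cases "n \<le> N") auto
    have Jsub: "J \<subseteq> carrier R" using J subringE(1)[OF adjoin_subring] by (auto simp: ideal_in_def)
    have Jneg: "\<ominus> \<one> \<otimes> z \<in> J" if "z \<in> J" for z
      using J that subringE(3,5)[OF adjoin_subring] by (auto simp: ideal_in_def)
    have "J \<inter> polys_below A x n \<subseteq> K" for n
    proof (induction n)
      case 0
      then show ?case using K by (auto simp: ideal_in_def)
    next
      case (Suc n)
      show ?case
      proof
        fix z assume z: "z \<in> J \<inter> polys_below A x (Suc n)"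
        then obtain p a where pa: "z = p \<oplus> a \<otimes> x [^] n" "p \<in> polys_below A x n" "a \<in> A" by auto
        then have "a \<in> lead_coeffs J n" using z by (auto simp: lead_coeffs_def)
        then obtain q where q: "q \<in> polys_below A x n" "q \<oplus> a \<otimes> x [^] n \<in> J" "q \<oplus> a \<otimes> x [^] n \<in> K"
          using all[of n] by (auto simp: lead_coeffs_def)
        note c = polys_below_carrier[OF pa(2)] polys_below_carrier[OF q(1)] A_carrier[OF pa(3)] x
        have "p \<ominus> q = z \<oplus> \<ominus> \<one> \<otimes> (q \<oplus> a \<otimes> x [^] n)"
          using c by (simp add: pa l_minus minus_add minus_eq a_ac r_neg2 r_neg1 r_neg)
        then have "p \<ominus> q \<in> J" using z Jneg[OF q(2)] J by (auto simp: ideal_in_def)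
        moreover have "p \<ominus> q \<in> polys_below A x n"
          unfolding minus_eq by (intro polys_below_add polys_below_neg pa q)
        ultimately have "p \<ominus> q \<in> K" using Suc.IH by blast
        moreover have "z = (p \<ominus> q) \<oplus> (q \<oplus> a \<otimes> x [^] n)"
          using c by (simp add: pa minus_eq a_ac r_neg2 r_neg1 r_neg)
        ultimately show "z \<in> K" using K q(3) by (auto simp: ideal_in_def)
      qed
    qed
    moreover have "J \<subseteq> (\<Union>n. polys_below A x n)" using J by (simp only: ideal_in_def adjoin_def)
    ultimately show "J \<subseteq> K" by blast
  qed
  moreover have "finite H" using G(2) by (auto simp: H_def)
  ultimately show "\<exists>F\<subseteq>J. finite F \<and> (\<forall>K. ideal_in (adjoin A x) K \<and> F \<subseteq> K \<longrightarrow> J \<subseteq> K)"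
    using HJ by blast
qed

end

lemma noetherian_in_adjoin_finite:
  assumes "finite G" "G \<subseteq> carrier R" "subring A R" "noetherian_in A"
  shows "\<exists>B. subring B R \<and> noetherian_in B \<and> A \<subseteq> B \<and> G \<subseteq> B"
  using assms
proof (induction G)
  case (insert x G)
  then obtain B where B: "subring B R" "noetherian_in B" "A \<subseteq> B" "G \<subseteq> B" by auto
  have x: "x \<in> carrier R" using insert by simp
  show ?case
    using adjoin_subring[OF B(1) x] Hilbert_basis[OF B(1) x B(2)] A_subset_adjoin[OF B(1) x]
      in_adjoin[OF B(1) x] B by (intro exI[of _ "adjoin B x"]) auto
qed auto

theorem noetherian_ring_if_finitely_generated:
  assumes G: "finite G" "G \<subseteq> carrier R" and A: "subring A R" "noetherian_in A"
    and gen: "\<And>B. subring B R \<Longrightarrow> A \<subseteq> B \<Longrightarrow> G \<subseteq> B \<Longrightarrow> carrier R \<subseteq> B"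
  shows "noetherian_ring R"
proof (rule noetherian_ringI)
  obtain B where B: "subring B R" "noetherian_in B" "A \<subseteq> B" "G \<subseteq> B"
    using noetherian_in_adjoin_finite[OF G A] by blast
  then have BR: "B = carrier R" using gen[OF B(1,3,4)] subringE(1)[OF B(1)] by blast
  fix I assume I: "ideal I R"
  interpret I: ideal I R by (rule I)
  have toI: "ideal_in (carrier R) K" if K: "ideal K R" for K
  proof -
    interpret K: ideal K R by (rule K)
    show ?thesis by (auto simp: ideal_in_def K.a_Hcarr K.I_l_closed)
  qed
  have "\<exists>F\<subseteq>I. finite F \<and> (\<forall>K. ideal_in (carrier R) K \<and> F \<subseteq> K \<longrightarrow> I \<subseteq> K)"
    using B(2)[unfolded BR noetherian_in_def] toI[OF I] by (elim allE[of _ I] impE)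
  then obtain F where F: "F \<subseteq> I" "finite F"
    and least: "\<forall>K. ideal_in (carrier R) K \<and> F \<subseteq> K \<longrightarrow> I \<subseteq> K" by (elim exE conjE)
  have FR: "F \<subseteq> carrier R" using F(1) I.a_subset by (rule subset_trans)
  have "I \<subseteq> Idl F" 
    using least toI[OF genideal_ideal[OF FR]] genideal_self[OF FR]
    by (elim allE[of _ "Idl F"] impE conjI)
  moreover have "Idl F \<subseteq> I" using genideal_minimal[OF I F(1)] .
  ultimately show "\<exists>A\<subseteq>carrier R. finite A \<and> I = Idl A"
    using F(2) FR by (intro exI[of _ F] conjI equalityI)
qed

end

section \<open>Polynomials with real exponent vectors\<close>

type_synonym 'k poly_fun = "(nat \<Rightarrow> real) \<Rightarrow>\<^sub>0 'k"

abbreviation lookup where "lookup \<equiv> Poly_Mapping.lookup"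
abbreviation keys where "keys \<equiv> Poly_Mapping.keys"
abbreviation single where "single \<equiv> Poly_Mapping.single"

text \<open>The coefficients of a product in the form used for semigroup rings and toric face rings.\<close>

lemma lookup_times_sum:
  fixes f g :: "'a::monoid_add \<Rightarrow>\<^sub>0 'k::semiring_0"
  shows "lookup (f * g) c = (\<Sum>(u, v)\<in>{(u, v). lookup f u \<noteq> 0 \<and> lookup g v \<noteq> 0 \<and> u + v = c}.
    lookup f u * lookup g v)"
proof -
  have "lookup (f * g) c = (\<Sum>(u, v). lookup f u * lookup g v when c = u + v)"
    by (simp add: times_poly_mapping.rep_eq prod_fun_unfold_prod)
  also have "\<dots> = (\<Sum>(u, v)\<in>keys f \<times> keys g. lookup f u * lookup g v when c = u + v)"
    by (rule Sum_any.expand_superset) (auto simp: in_keys_iff)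
  also have "\<dots> = (\<Sum>(u, v)\<in>{(u, v). lookup f u \<noteq> 0 \<and> lookup g v \<noteq> 0 \<and> u + v = c}.
    lookup f u * lookup g v)"
    by (rule sum.mono_neutral_cong_right) (auto simp: in_keys_iff when_def split: if_splits)
  finally show ?thesis .
qed

definition add_functional :: "((nat \<Rightarrow> real) \<Rightarrow> real) \<Rightarrow> bool" where
  "add_functional w \<longleftrightarrow> (\<forall>x y. w (x + y) = w x + w y)"

lemma add_functionalD:
  assumes "add_functional w"
  shows "w (x + y) = w x + w y" "w (x - y) = w x - w y" "w 0 = 0"
proof -
  show a: "w (x + y) = w x + w y" for x y using assms by (auto simp: add_functional_def)
  show "w (x - y) = w x - w y" using a[of "x - y" y] by simp
  show "w 0 = 0" using a[of 0 0] by simp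
qed

text \<open>The lexicographic order, refined by letting the functional w decide first. It is total on
  \<open>real_space n\<close> and invariant under translation, so the least exponent of a product is the sum of
  the least exponents. The choice w = 0 gives the lexicographic order itself; other choices control
  the values of w on the exponents.\<close>

definition before :: "((nat \<Rightarrow> real) \<Rightarrow> real) \<Rightarrow> (nat \<Rightarrow> real) \<Rightarrow> (nat \<Rightarrow> real) \<Rightarrow> bool" where
  "before w x y \<longleftrightarrow> w x < w y \<or> (w x = w y \<and> less_fun x y)"

lemma before_irrefl: "\<not> before w x x"
  by (simp add: before_def less_fun_irrefl)

lemma before_trans: "before w x y \<Longrightarrow> before w y z \<Longrightarrow> before w x z"
  by (auto simp: before_def intro: less_fun_trans)

lemma before_total:
  assumes "x \<in> real_space n" "y \<in> real_space n"
  shows "before w x y \<or> x = y \<or> before w y x"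
proof -
  have "{k. x k \<noteq> y k} \<subseteq> {..<n}"
    using assms by (auto simp: real_space_def) (metis not_less)
  then have "finite {k. x k \<noteq> y k}" by (rule finite_subset) simp
  from less_fun_trichotomy[OF this] show ?thesis by (auto simp: before_def)
qed

lemma before_add:
  assumes "add_functional w"
  shows "before w (x + z) (y + z) \<longleftrightarrow> before w x y"
  by (auto simp: before_def less_fun_def add_functionalD[OF assms])

lemma before_add_mono:
  assumes "add_functional w" "before w x y" "before w u v"
  shows "before w (x + u) (y + v)"
proof -
  have "before w (x + u) (y + u)" using assms by (simp add: before_add)
  moreover have "before w (u + y) (v + y)" using assms by (simp add: before_add)
  ultimately show ?thesis by (metis add.commute before_trans)
qed

definition is_lead :: "((nat \<Rightarrow> real) \<Rightarrow> real) \<Rightarrow> 'k::zero poly_fun \<Rightarrow> (nat \<Rightarrow> real) \<Rightarrow> bool" where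
  "is_lead w f x \<longleftrightarrow> x \<in> keys f \<and> (\<forall>y\<in>keys f. y \<noteq> x \<longrightarrow> before w x y)"

lemma is_lead_le: "is_lead w f x \<Longrightarrow> y \<in> keys f \<Longrightarrow> w x \<le> w y"
  by (cases "y = x") (auto simp: is_lead_def before_def)

lemma lead_exists:
  assumes "f \<noteq> 0" "keys f \<subseteq> real_space n"
  shows "\<exists>x. is_lead w f x"
proof -
  have "\<exists>x\<in>S. \<forall>y\<in>S. y \<noteq> x \<longrightarrow> before w x y" if "finite S" "S \<noteq> {}" "S \<subseteq> real_space n" for S
    using that
  proof (induction rule: finite_ne_induct)
    case (insert a S)
    then obtain x where x: "x \<in> S" "\<forall>y\<in>S. y \<noteq> x \<longrightarrow> before w x y" by auto
    from before_total[of a n x w] x(1) insert.prems consider "before w a x" | "a = x" | "before w x a"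
      by blast
    then show ?case
    proof cases
      case 1
      then show ?thesis using x by (auto intro: before_trans)
    next
      case 3
      then show ?thesis using x by auto
    qed (use x in auto)
  qed auto
  from this[of "keys f"] assms show ?thesis by (auto simp: is_lead_def keys_eq_empty)
qed

lemma lead_unique:
  assumes "is_lead w f x" "is_lead w f y" shows "x = y"
proof (rule ccontr)
  assume "x \<noteq> y"
  then have "before w x y" "before w y x" using assms by (auto simp: is_lead_def)
  then show False using before_irrefl before_trans by blast
qed

lemma lead_mult:
  fixes f g :: "'k::idom poly_fun"
  assumes w: "add_functional w" and f: "is_lead w f x" and g: "is_lead w g y"
  shows "is_lead w (f * g) (x + y)" "lookup (f * g) (x + y) = lookup f x * lookup g y"
proof -
  have le: "(u = x \<and> v = y) \<or> before w (x + y) (u + v)" if "u \<in> keys f" "v \<in> keys g" for u v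
  proof -
    have "u = x \<or> before w x u" "v = y \<or> before w y v" using f g that by (auto simp: is_lead_def)
    then show ?thesis
    proof (elim disjE)
      assume "u = x" "before w y v"
      then have "before w (y + x) (v + x)" by (simp only: before_add[OF w])
      then show ?thesis using \<open>u = x\<close> by (simp only: add.commute[of _ x] simp_thms)
    next
      assume "before w x u" "v = y"
      then have "before w (x + y) (u + y)" by (simp only: before_add[OF w])
      then show ?thesis using \<open>v = y\<close> by (simp only: simp_thms)
    qed (use before_add_mono[OF w, of x u y v] in blast)+
  qed
  have "{(u, v). lookup f u \<noteq> 0 \<and> lookup g v \<noteq> 0 \<and> u + v = x + y} = {(x, y)}"
  proof -
    have "u = x \<and> v = y" if "u \<in> keys f" "v \<in> keys g" "u + v = x + y" for u v
      using le[OF that(1,2)] that(3) before_irrefl[of w "x + y"] by (simp only: simp_thms)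
    then show ?thesis using f g by (fastforce simp: is_lead_def in_keys_iff)
  qed
  then show l: "lookup (f * g) (x + y) = lookup f x * lookup g y"
    by (simp add: lookup_times_sum)
  show "is_lead w (f * g) (x + y)"
    unfolding is_lead_def
  proof (intro conjI ballI impI)
    show "x + y \<in> keys (f * g)" using l f g by (simp add: is_lead_def in_keys_iff)
    fix z assume "z \<in> keys (f * g)" "z \<noteq> x + y"
    then obtain u v where "u \<in> keys f" "v \<in> keys g" "z = u + v" using keys_mult[of f g] by blast
    then show "before w (x + y) z" using le \<open>z \<noteq> x + y\<close> by blast
  qed
qed

lemma lead_one: "is_lead w (1 :: 'k::zero_neq_one poly_fun) 0"
  by (simp add: is_lead_def)

lemma lead_power:
  fixes f :: "'k::idom poly_fun"
  assumes w: "add_functional w" and f: "is_lead w f x"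
  shows "is_lead w (f ^ m) (scale (real m) x)"
proof (induction m)
  case 0
  have "scale (real 0) x = 0" by (auto simp: scale_def)
  then show ?case using lead_one[of w] by (simp only: power_0)
next
  case (Suc m)
  have "x + scale (real m) x = scale (real (Suc m)) x" by (auto simp: scale_def algebra_simps)
  then show ?case using lead_mult(1)[OF w f Suc] by simp
qed

lemma add_functional_scale:
  assumes "add_functional w" shows "w (scale (real m) x) = real m * w x"
proof (induction m)
  case 0
  have "scale (real 0) x = 0" by (auto simp: scale_def)
  then show ?case using add_functionalD(3)[OF assms] by (simp only: of_nat_0 mult_zero_left)
next
  case (Suc m)
  have "scale (real (Suc m)) x = x + scale (real m) x" by (auto simp: scale_def algebra_simps)
  then have "w (scale (real (Suc m)) x) = w x + real m * w x"
    using Suc add_functionalD(1)[OF assms] by simp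
  then show ?case by (simp add: algebra_simps)
qed

lemma add_functional_zero: "add_functional (\<lambda>x. 0)"
  and add_functional_coord: "add_functional (\<lambda>x. c * x i)"
  and add_functional_dot: "add_functional (\<lambda>x. \<Sum>i<n. a i * x i)"
  by (auto simp: add_functional_def algebra_simps sum.distrib)

lemma real_space_closed:
  "x \<in> real_space n \<Longrightarrow> y \<in> real_space n \<Longrightarrow> x + y \<in> real_space n" "0 \<in> real_space n"
  by (auto simp: real_space_def)

definition keys_in :: "(nat \<Rightarrow> real) set \<Rightarrow> 'k::zero poly_fun set" where
  "keys_in S = {f. keys f \<subseteq> S}"

lemma keys_in_mult:
  fixes f g :: "'k::idom poly_fun"
  assumes "is_submonoid S" "f \<in> keys_in S" "g \<in> keys_in S"
  shows "f * g \<in> keys_in S"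
proof -
  have "keys (f * g) \<subseteq> {a + b | a b. a \<in> keys f \<and> b \<in> keys g}" by (rule keys_mult)
  also have "\<dots> \<subseteq> S" using assms unfolding keys_in_def is_submonoid_def by blast
  finally show ?thesis by (simp add: keys_in_def)
qed

lemma keys_in_one: "is_submonoid S \<Longrightarrow> (1 :: 'k::idom poly_fun) \<in> keys_in S"
  by (simp add: keys_in_def is_submonoid_def)

lemma keys_in_zero: "0 \<in> keys_in S" by (simp add: keys_in_def)

lemma keys_in_power:
  fixes f :: "'k::idom poly_fun"
  assumes "is_submonoid S" "f \<in> keys_in S"
  shows "f ^ m \<in> keys_in S"
proof (induction m)
  case (Suc m)
  then show ?case using keys_in_mult[OF assms] by (simp only: power_Suc)
qed (use keys_in_one[OF assms(1)] in simp)

lemma keys_in_add: "f \<in> keys_in S \<Longrightarrow> g \<in> keys_in S \<Longrightarrow> f + g \<in> keys_in S"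
  using Poly_Mapping.keys_add[of f g] unfolding keys_in_def by blast

lemma keys_in_uminus: "f \<in> keys_in S \<Longrightarrow> - (f :: 'k::idom poly_fun) \<in> keys_in S"
  by (simp add: keys_in_def subset_iff in_keys_iff)

lemma keys_in_diff: "f \<in> keys_in S \<Longrightarrow> g \<in> keys_in S \<Longrightarrow> f - (g :: 'k::idom poly_fun) \<in> keys_in S"
  using keys_in_add[of f S "- g"] keys_in_uminus[of g S] by (simp only: add_uminus_conv_diff)

lemma keys_in_sum:
  assumes "\<And>i. i \<in> I \<Longrightarrow> f i \<in> keys_in S"
  shows "sum f I \<in> keys_in S"
  using assms by (induction I rule: infinite_finite_induct) (simp_all add: keys_in_add keys_in_zero)

lemma keys_in_mono: "S \<subseteq> S' \<Longrightarrow> keys_in S \<subseteq> keys_in S'"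
  by (auto simp: keys_in_def)

lemma real_space_submonoid: "is_submonoid (real_space n)"
  by (simp add: is_submonoid_def real_space_def)

lemma mult_eq_0_real_space:
  fixes f g :: "'k::idom poly_fun"
  assumes "f \<in> keys_in (real_space n)" "g \<in> keys_in (real_space n)" "f * g = 0"
  shows "f = 0 \<or> g = 0"
proof (rule ccontr)
  assume "\<not> (f = 0 \<or> g = 0)"
  then have "f \<noteq> 0" "g \<noteq> 0" by auto
  then obtain x y where "is_lead (\<lambda>x. 0) f x" "is_lead (\<lambda>x. 0) g y"
    using lead_exists[of f n "\<lambda>x. 0"] lead_exists[of g n "\<lambda>x. 0"] assms(1,2)
    by (auto simp only: keys_in_def mem_Collect_eq)
  from lead_mult(1)[OF add_functional_zero this] show False
    using assms(3) by (simp add: is_lead_def)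
qed

lemma power_eq_0_real_space:
  fixes f :: "'k::idom poly_fun"
  assumes "f \<in> keys_in (real_space n)" "f ^ m = 0"
  shows "f = 0"
  using assms(2)
proof (induction m)
  case (Suc m)
  then have "f * f ^ m = 0" by (simp only: power_Suc)
  then have "f = 0 \<or> f ^ m = 0"
    by (rule mult_eq_0_real_space[OF assms(1) keys_in_power[OF real_space_submonoid assms(1)]])
  then show ?case using Suc.IH by blast
qed simp

text \<open>A nonzero g is the quotient of its cube by its square.\<close>

lemma square_cube_unique:
  fixes f g :: "'k::idom poly_fun"
  assumes f: "f \<in> keys_in (real_space n)" and g: "g \<in> keys_in (real_space n)"
    and 2: "f ^ 2 = g ^ 2" and 3: "f ^ 3 = g ^ 3"
  shows "f = g"
proof (cases "g = 0")
  case True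
  have "f ^ 2 = 0" unfolding 2 True by (simp add: power2_eq_square)
  then show ?thesis using power_eq_0_real_space[OF f] True by blast
next
  case False
  have cube: "h * h ^ 2 = h ^ 3" for h :: "'k poly_fun"
    by (simp only: power2_eq_square power3_eq_cube mult.assoc)
  have "f * g ^ 2 = f ^ 3" using cube[of f] by (simp only: 2)
  moreover have "g * g ^ 2 = f ^ 3" using cube[of g] by (simp only: 3)
  ultimately have "(f - g) * g ^ 2 = 0" by (simp only: left_diff_distrib diff_self)
  then have "f - g = 0 \<or> g ^ 2 = 0"
    by (rule mult_eq_0_real_space[OF keys_in_diff[OF f g] keys_in_power[OF real_space_submonoid g]])
  then show ?thesis using False power_eq_0_real_space[OF g] by (metis right_minus_eq)
qed

lemma int_lattice_box_finite:
  "finite {x \<in> int_lattice n. \<forall>i<n. l i \<le> x i \<and> x i \<le> u i}"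
proof -
  define B where "B = (\<lambda>i. (real_of_int ` {\<lfloor>l i\<rfloor>..\<lceil>u i\<rceil>}))"
  have "{x \<in> int_lattice n. \<forall>i<n. l i \<le> x i \<and> x i \<le> u i} \<subseteq>
    (\<lambda>f i. if i < n then f i else 0) ` (\<Pi>\<^sub>E i\<in>{..<n}. B i)"
  proof
    fix x assume x: "x \<in> {x \<in> int_lattice n. \<forall>i<n. l i \<le> x i \<and> x i \<le> u i}"
    have "x i \<in> B i" if "i < n" for i
    proof -
      obtain z where z: "x i = of_int z" using x by (auto simp: int_lattice_def Ints_def)
      have "l i \<le> of_int z" "of_int z \<le> u i" using x z that by auto
      then have "\<lfloor>l i\<rfloor> \<le> \<lfloor>real_of_int z\<rfloor>" "\<lceil>real_of_int z\<rceil> \<le> \<lceil>u i\<rceil>"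
        by (auto intro: floor_mono ceiling_mono simp del: floor_of_int ceiling_of_int)
      then show ?thesis using z by (auto simp: B_def)
    qed
    then have "restrict x {..<n} \<in> (\<Pi>\<^sub>E i\<in>{..<n}. B i)" by auto
    moreover have "x = (\<lambda>i. if i < n then restrict x {..<n} i else 0)"
      using x by (auto simp: int_lattice_def real_space_def)
    ultimately show "x \<in> (\<lambda>f i. if i < n then f i else 0) ` (\<Pi>\<^sub>E i\<in>{..<n}. B i)" by blast
  qed
  moreover have "finite ((\<lambda>f i. if i < n then f i else 0) ` (\<Pi>\<^sub>E i\<in>{..<n}. B i))"
    by (intro finite_imageI finite_PiE) (auto simp: B_def)
  ultimately show ?thesis by (rule finite_subset)
qed

section \<open>Division in normal affine semigroup rings\<close>

lemma nonneg_if_affine_bounded_below: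
  fixes A B t :: real
  assumes "\<And>m::nat. A \<le> B + real m * t"
  shows "0 \<le> t"
proof (rule ccontr)
  assume "\<not> 0 \<le> t"
  then obtain m :: nat where "B - A < real m * (- t)"
    using reals_Archimedean3[of "- t"] by auto
  with assms[of m] show False by simp
qed

lemma lead_single: "c \<noteq> 0 \<Longrightarrow> is_lead w (single x c) x"
  by (simp add: is_lead_def)

lemma keys_in_of_nat:
  "is_submonoid S \<Longrightarrow> (of_nat m :: 'k::idom poly_fun) \<in> keys_in S"
  by (induction m) (simp_all add: keys_in_add keys_in_zero keys_in_one)

lemma normal_monoid_submonoid:
  assumes "is_subgroup G" "G \<subseteq> int_lattice n" "polyhedral_cone n C"
  shows "is_submonoid (G \<inter> C)" "G \<inter> C \<subseteq> real_space n"
proof -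
  obtain A where C: "C = {x \<in> real_space n. \<forall>a\<in>A. 0 \<le> (\<Sum>i<n. a i * x i)}"
    using assms(3) by (auto simp: polyhedral_cone_def)
  have G: "x + y \<in> G" if "x \<in> G" "y \<in> G" for x y
  proof -
    have "0 - y \<in> G" using assms(1) that unfolding is_subgroup_def by blast
    then have "x - (0 - y) \<in> G" using assms(1) that unfolding is_subgroup_def by blast
    then show ?thesis by simp
  qed
  show "is_submonoid (G \<inter> C)"
    unfolding is_submonoid_def
  proof (intro conjI ballI)
    show "0 \<in> G \<inter> C" using assms(1) real_space_closed(2) by (auto simp: is_subgroup_def C)
    fix x y assume xy: "x \<in> G \<inter> C" "y \<in> G \<inter> C"
    have "x + y \<in> C"
      using xy real_space_closed(1)[of x n y] by (auto simp: C distrib_left sum.distrib)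
    then show "x + y \<in> G \<inter> C" using xy G by auto
  qed
  show "G \<inter> C \<subseteq> real_space n" by (auto simp: C)
qed

text \<open>The leading exponent z of e is y + m (x - y) by additivity of leading exponents. It is
  recorded through the values of additive functionals.\<close>

lemma lead_almost_integral:
  fixes a s e :: "'k::idom poly_fun"
  assumes w: "add_functional w" and a: "is_lead w a x" and s: "is_lead w s y"
    and e: "keys e \<subseteq> real_space n" "s * a ^ m = s ^ m * e"
  shows "\<exists>z. is_lead w e z \<and> (\<forall>v. add_functional v \<longrightarrow> v z = v y + real m * (v x - v y))"
proof -
  have l: "is_lead w (s ^ m * e) (y + scale (real m) x)"
    unfolding e(2)[symmetric] by (rule lead_mult(1)[OF w s lead_power[OF w a]])
  have "e \<noteq> 0" using l by (auto simp: is_lead_def)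
  then obtain z where z: "is_lead w e z" using lead_exists e(1) by blast
  have "y + scale (real m) x = scale (real m) y + z"
    by (rule lead_unique[OF l lead_mult(1)[OF w lead_power[OF w s] z]])
  then have "v y + real m * v x = real m * v y + v z" if "add_functional v" for v
    using add_functionalD(1)[OF that] add_functional_scale[OF that] by metis
  then show ?thesis using z by (intro exI[of _ z]) (auto simp: algebra_simps)
qed

text \<open>Long division of a by s. The hypothesis on e says that a/s is almost integral: s times
  every power of a/s lies in the ring. So y + m (x - y) is the exponent of an element of the ring
  for all m, where x and y are the leading exponents of a and s. Letting m grow shows that g = x -
  y lies in the cone; comparing leading exponents for the coordinate functionals and their
  negatives shows in the same way that g lies in the box from l to u. Hence the first term of the
  quotient is an element of the ring, and subtracting it from the quotient preserves all
  hypotheses. Since g increases with each step and the box contains only finitely many lattice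
  points, the division stops.\<close>

lemma divides_if_almost_integral:
  fixes a s :: "'k::field poly_fun" and l u :: "nat \<Rightarrow> real"
  assumes G: "is_subgroup G" "G \<subseteq> int_lattice n" and C: "polyhedral_cone n C"
    and s: "s \<in> keys_in (G \<inter> C)" and y: "is_lead (\<lambda>x. 0) s y"
    and ym: "\<And>i. is_lead (\<lambda>x. 1 * x i) s (ym i)" and yM: "\<And>i. is_lead (\<lambda>x. - 1 * x i) s (yM i)"
    and "a \<in> keys_in (G \<inter> C)"
    and "\<And>m. \<exists>e\<in>keys_in (G \<inter> C). s * a ^ m = s ^ m * e"
    and "\<And>i x. x \<in> keys a \<Longrightarrow> l i + ym i i \<le> x i \<and> x i \<le> u i + yM i i"
  shows "\<exists>q\<in>keys_in (G \<inter> C). a = q * s"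
  using assms(8-10)
proof (induction "card {h \<in> {h \<in> int_lattice n. \<forall>i<n. l i \<le> h i \<and> h i \<le> u i}.
    \<forall>x. is_lead (\<lambda>x. 0) a x \<longrightarrow> \<not> before (\<lambda>x. 0) h (x - y)}" arbitrary: a rule: less_induct)
  case (less a)
  let ?N = "G \<inter> C" and ?o = "\<lambda>x :: nat \<Rightarrow> real. 0 :: real"
  define Box where "Box = {h \<in> int_lattice n. \<forall>i<n. l i \<le> h i \<and> h i \<le> u i}"
  note N = normal_monoid_submonoid[OF G C]
  have keysN: "keys f \<subseteq> real_space n" if "f \<in> keys_in ?N" for f :: "'k poly_fun"
    using that N(2) by (auto simp: keys_in_def)
  show ?case
  proof (cases "a = 0")
    case True
    then show ?thesis by (intro bexI[of _ 0]) (auto simp: keys_in_zero)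
  next
    case False
    then obtain x where x: "is_lead ?o a x" using lead_exists keysN[OF less.prems(1)] by blast
    define g where "g = x - y"
    have xN: "x \<in> ?N" and yN: "y \<in> ?N"
      using x y less.prems(1) s by (auto simp: is_lead_def keys_in_def)
    \<comment> \<open>The least value of w on the quotient bounds the value of w at its first exponent g.\<close>
    have bound: "c \<le> w g" if w: "add_functional w" and y': "is_lead w s y'"
      and c: "\<And>z. z \<in> keys a \<Longrightarrow> c + w y' \<le> w z" for w c y'
    proof -
      obtain x' where x': "is_lead w a x'" using lead_exists False keysN[OF less.prems(1)] by blast
      have "w y' - w y \<le> 0 + real m * (w g - c)" for m
      proof -
        obtain e where e: "e \<in> keys_in ?N" "s * a ^ m = s ^ m * e" using less.prems(2) by blast
        obtain z where z: "is_lead ?o e z" "w z = w y + real m * (w x - w y)"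
          using lead_almost_integral[OF add_functional_zero x y keysN[OF e(1)] e(2)] w by blast
        obtain z' where z': "is_lead w e z'" "w z' = w y' + real m * (w x' - w y')"
          using lead_almost_integral[OF w x' y' keysN[OF e(1)] e(2)] w by blast
        have "w z' \<le> w z" using is_lead_le[OF z'(1)] z(1) by (auto simp: is_lead_def)
        moreover have "real m * c \<le> real m * (w x' - w y')"
          using c[of x'] x' by (intro mult_left_mono) (auto simp: is_lead_def)
        ultimately show ?thesis
          using z(2) z'(2) by (simp add: g_def add_functionalD(2)[OF w] algebra_simps)
      qed
      then have "0 \<le> w g - c" by (rule nonneg_if_affine_bounded_below)
      then show ?thesis by simp
    qed
    have gl: "l i \<le> g i" for i
      using bound[OF add_functional_coord ym, of "l i" i] less.prems(3) by simp
    have gu: "g i \<le> u i" for i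
      using bound[OF add_functional_coord yM, of "- u i" i] less.prems(3)
      by (simp add: algebra_simps)
    have gG: "g \<in> G" using xN yN G(1) by (simp add: g_def is_subgroup_def)
    have gC: "g \<in> C"
    proof -
      obtain A where A: "C = {x \<in> real_space n. \<forall>a\<in>A. 0 \<le> (\<Sum>i<n. a i * x i)}"
        using C by (auto simp: polyhedral_cone_def)
      have "0 \<le> (\<Sum>i<n. \<alpha> i * g i)" if \<alpha>: "\<alpha> \<in> A" for \<alpha>
      proof -
        let ?w = "\<lambda>x. \<Sum>i<n. \<alpha> i * x i"
        have w: "add_functional ?w" by (rule add_functional_dot)
        have "0 \<le> ?w y + real m * ?w g" for m
        proof -
          obtain e where e: "e \<in> keys_in ?N" "s * a ^ m = s ^ m * e" using less.prems(2) by blast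
          obtain z where z: "is_lead ?o e z" "?w z = ?w y + real m * (?w x - ?w y)"
            using lead_almost_integral[OF add_functional_zero x y keysN[OF e(1)] e(2)] w by blast
          have "z \<in> C" using z(1) e(1) by (auto simp: is_lead_def keys_in_def)
          then have "0 \<le> ?w z" using \<alpha> A by blast
          then show ?thesis unfolding z(2) g_def add_functionalD(2)[OF w] .
        qed
        then show ?thesis by (rule nonneg_if_affine_bounded_below)
      qed
      moreover have "g \<in> real_space n" using gG G(2) by (auto simp: int_lattice_def)
      ultimately show ?thesis by (simp add: A)
    qed
    \<comment> \<open>The first term of the quotient, and the new dividend.\<close>
    define c where "c = lookup a x / lookup s y"
    define r where "r = single g c"
    have c0: "c \<noteq> 0" using x y by (simp add: c_def is_lead_def in_keys_iff)
    have rN: "r \<in> keys_in ?N" using gG gC by (simp add: r_def keys_in_def)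
    define a' where "a' = a - r * s"
    have gy: "g + y = x" by (simp add: g_def)
    have rs: "is_lead ?o (r * s) x" "lookup (r * s) x = c * lookup s y"
      using lead_mult[OF add_functional_zero lead_single[OF c0] y, of g] gy by (simp_all add: r_def)
    have a'N: "a' \<in> keys_in ?N"
      unfolding a'_def by (intro keys_in_diff less.prems(1) keys_in_mult N(1) rN s)
    have xa': "x \<notin> keys a'"
      using rs(2) y by (simp add: a'_def in_keys_iff lookup_minus c_def is_lead_def)
    have keysa': "z \<in> keys a \<or> z \<in> keys (r * s)" if "z \<in> keys a'" for z
      using that by (auto simp: a'_def in_keys_iff lookup_minus)
    have keysrs: "\<exists>v\<in>keys s. z = g + v" if "z \<in> keys (r * s)" for z
      using keys_mult[of r s] that c0 by (auto simp: r_def)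
    show ?thesis
    proof (cases "a' = 0")
      case True
      then show ?thesis using rN by (intro bexI[of _ r]) (auto simp: a'_def)
    next
      case False
      then obtain x' where x': "is_lead ?o a' x'" using lead_exists keysN[OF a'N] by blast
      have xx': "before ?o x x'"
      proof -
        have "x' \<in> keys a'" "x' \<noteq> x" using x' xa' by (auto simp: is_lead_def)
        then show ?thesis using keysa'[of x'] x rs(1) by (auto simp: is_lead_def)
      qed
      have gg': "before ?o g (x' - y)"
        using xx' before_add[OF add_functional_zero, of "x - y" y "x' - y"] by (simp add: g_def)
      have gBox: "g \<in> Box" using gl gu gG G(2) by (auto simp: Box_def)
      have "\<exists>q\<in>keys_in ?N. a' = q * s"
      proof (rule less.hyps)
        have fin: "finite Box" unfolding Box_def by (rule int_lattice_box_finite)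
        have "{h \<in> Box. \<forall>x. is_lead ?o a' x \<longrightarrow> \<not> before ?o h (x - y)} \<subset>
          {h \<in> Box. \<forall>x. is_lead ?o a x \<longrightarrow> \<not> before ?o h (x - y)}"
        proof (rule psubsetI)
          show "{h \<in> Box. \<forall>x. is_lead ?o a' x \<longrightarrow> \<not> before ?o h (x - y)} \<subseteq>
            {h \<in> Box. \<forall>x. is_lead ?o a x \<longrightarrow> \<not> before ?o h (x - y)}"
          proof (intro subsetI CollectI conjI allI impI notI)
            fix h assume h: "h \<in> {h \<in> Box. \<forall>x. is_lead ?o a' x \<longrightarrow> \<not> before ?o h (x - y)}"
            then show "h \<in> Box" by simp
            fix x2 assume "is_lead ?o a x2" "before ?o h (x2 - y)"
            then have "before ?o h g" using lead_unique[OF x] by (simp add: g_def)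
            then have "before ?o h (x' - y)" using gg' by (rule before_trans)
            then show False using h x' by simp
          qed
          have "g \<in> {h \<in> Box. \<forall>x. is_lead ?o a x \<longrightarrow> \<not> before ?o h (x - y)}"
          proof (intro CollectI conjI allI impI gBox)
            fix x2 assume "is_lead ?o a x2"
            then have "x2 - y = g" using lead_unique[OF x] by (simp add: g_def)
            then show "\<not> before ?o g (x2 - y)" using before_irrefl by simp
          qed
          moreover have "g \<notin> {h \<in> Box. \<forall>x. is_lead ?o a' x \<longrightarrow> \<not> before ?o h (x - y)}"
            using gg' x' by blast
          ultimately show "{h \<in> Box. \<forall>x. is_lead ?o a' x \<longrightarrow> \<not> before ?o h (x - y)} \<noteq>
            {h \<in> Box. \<forall>x. is_lead ?o a x \<longrightarrow> \<not> before ?o h (x - y)}" by blast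
        qed
        then show "card {h \<in> {h \<in> int_lattice n. \<forall>i<n. l i \<le> h i \<and> h i \<le> u i}.
            \<forall>x. is_lead ?o a' x \<longrightarrow> \<not> before ?o h (x - y)} <
          card {h \<in> {h \<in> int_lattice n. \<forall>i<n. l i \<le> h i \<and> h i \<le> u i}.
            \<forall>x. is_lead ?o a x \<longrightarrow> \<not> before ?o h (x - y)}"
          unfolding Box_def[symmetric] using fin by (intro psubset_card_mono) auto
        show "a' \<in> keys_in ?N" by (rule a'N)
        show "l i + ym i i \<le> z i \<and> z i \<le> u i + yM i i" if z: "z \<in> keys a'" for i z
        proof -
          consider "z \<in> keys a" | v where "v \<in> keys s" "z = g + v"
            using keysa'[OF z] keysrs[of z] by (elim disjE) auto
          then show ?thesis
          proof cases
            case 2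
            then show ?thesis
              using is_lead_le[OF ym[of i] 2(1)] is_lead_le[OF yM[of i] 2(1)] gl[of i] gu[of i]
              by simp
          qed (use less.prems(3) in blast)
        qed
        show "\<exists>e\<in>keys_in ?N. s * a' ^ m = s ^ m * e" for m
        proof -
          \<comment> \<open>Expand a power of a/s - r by the binomial theorem.\<close>
          obtain e where e: "\<And>m. e m \<in> keys_in ?N" "\<And>m. s * a ^ m = s ^ m * e m"
            using choice[of "\<lambda>m e. e \<in> keys_in ?N \<and> s * a ^ m = s ^ m * e"] less.prems(2) by auto
          define f where "f = (\<Sum>k\<le>m. of_nat (m choose k) * (e k * (- r) ^ (m - k)))"
          have "s * a' ^ m = s * (a + (- r) * s) ^ m" by (simp add: a'_def)
          also have "\<dots> = (\<Sum>k\<le>m. s * (of_nat (m choose k) * a ^ k * ((- r) * s) ^ (m - k)))"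
            by (simp only: binomial_ring sum_distrib_left)
          also have "\<dots> = (\<Sum>k\<le>m. s ^ m * (of_nat (m choose k) * (e k * (- r) ^ (m - k))))"
          proof (rule sum.cong[OF refl])
            fix k assume k: "k \<in> {..m}"
            have "s * (of_nat (m choose k) * a ^ k * ((- r) * s) ^ (m - k)) =
              of_nat (m choose k) * (s * a ^ k) * (- r) ^ (m - k) * s ^ (m - k)"
              by (simp only: power_mult_distrib mult_ac)
            also have "\<dots> = (s ^ k * s ^ (m - k)) * (of_nat (m choose k) * (e k * (- r) ^ (m - k)))"
              by (simp only: e(2) mult_ac)
            also have "s ^ k * s ^ (m - k) = s ^ m" using k by (simp flip: power_add)
            finally show "s * (of_nat (m choose k) * a ^ k * ((- r) * s) ^ (m - k)) =
              s ^ m * (of_nat (m choose k) * (e k * (- r) ^ (m - k)))" .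
          qed
          also have "\<dots> = s ^ m * f" by (simp only: f_def sum_distrib_left)
          finally have "s * a' ^ m = s ^ m * f" .
          moreover have "f \<in> keys_in ?N"
            unfolding f_def
            by (intro keys_in_sum keys_in_mult N(1) keys_in_of_nat e(1) keys_in_power keys_in_uminus rN)
          ultimately show ?thesis by blast
        qed
      qed
      then obtain q where q: "q \<in> keys_in ?N" "a' = q * s" by blast
      have "a = (q + r) * s" using q(2) by (simp add: a'_def distrib_right diff_eq_eq)
      then show ?thesis using keys_in_add[OF q(1) rN] by blast
    qed
  qed
qed

text \<open>A fraction whose square lies in the ring is almost integral: s (a/s)^m equals s b^k if m =
  2k, and a b^k if m = 2k + 1.\<close>

theorem normal_monoid_ring_root_closed:
  fixes a b s :: "'k::field poly_fun"
  assumes G: "is_subgroup G" "G \<subseteq> int_lattice n" and C: "polyhedral_cone n C"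
    and a: "a \<in> keys_in (G \<inter> C)" and b: "b \<in> keys_in (G \<inter> C)" and s: "s \<in> keys_in (G \<inter> C)" "s \<noteq> 0"
    and eq: "a ^ 2 = b * s ^ 2"
  shows "\<exists>q\<in>keys_in (G \<inter> C). a = q * s"
proof -
  note N = normal_monoid_submonoid[OF G C]
  have ks: "keys s \<subseteq> real_space n" using s(1) N(2) by (auto simp: keys_in_def)
  have lead: "\<exists>x. is_lead w s x" for w by (rule lead_exists[OF s(2) ks])
  obtain y where y: "is_lead (\<lambda>x. 0) s y" using lead by blast
  have "\<forall>i. \<exists>x. is_lead (\<lambda>x. 1 * x i) s x" "\<forall>i. \<exists>x. is_lead (\<lambda>x. - 1 * x i) s x"
    by (intro allI lead)+
  from choice[OF this(1)] choice[OF this(2)] obtain ym yM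
    where "\<forall>i. is_lead (\<lambda>x. 1 * x i) s (ym i)" "\<forall>i. is_lead (\<lambda>x. - 1 * x i) s (yM i)"
    by (elim exE)
  note ym = this(1)[rule_format] and yM = this(2)[rule_format]
  define l where "l i = Min ((\<lambda>x. x i) ` keys a) - ym i i" for i
  define u where "u i = Max ((\<lambda>x. x i) ` keys a) - yM i i" for i
  show ?thesis
  proof (rule divides_if_almost_integral[OF G C s(1) y ym yM a])
    show "l i + ym i i \<le> x i \<and> x i \<le> u i + yM i i" if "x \<in> keys a" for i x
      using that by (simp add: l_def u_def)
    show "\<exists>e\<in>keys_in (G \<inter> C). s * a ^ m = s ^ m * e" for m
    proof -
      have ev: "a ^ (2 * k) = b ^ k * s ^ (2 * k)" for k
        by (simp only: power_mult eq power_mult_distrib)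
      show ?thesis
      proof (cases "even m")
        case True
        then obtain k where k: "m = 2 * k" by blast
        have "s * a ^ m = s ^ m * (s * b ^ k)" unfolding k ev by (simp only: mult_ac)
        then show ?thesis using keys_in_mult[OF N(1) s(1) keys_in_power[OF N(1) b]] by blast
      next
        case False
        then obtain k where k: "m = Suc (2 * k)" by (auto elim: oddE)
        have "s * a ^ m = s ^ m * (a * b ^ k)" unfolding k power_Suc ev by (simp only: mult_ac)
        then show ?thesis using keys_in_mult[OF N(1) a keys_in_power[OF N(1) b]] by blast
      qed
    qed
  qed
qed

section \<open>Faces and the direct limit of a monoidal complex\<close>

lemma linear_between_basis_sum:
  assumes lin: "linear_between (real_space m) (real_space n) f" and x: "x \<in> real_space m"
  shows "f x = (\<lambda>j. \<Sum>i<m. x i * f (\<lambda>k. if k = i then 1 else 0) j)"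
proof -
  let ?e = "\<lambda>i k. if k = i then 1 else (0::real)"
  have add: "f (u + v) = f u + f v" if "u \<in> real_space m" "v \<in> real_space m" for u v
    using lin that by (auto simp: linear_between_def)
  have sc: "f (scale c u) = scale c (f u)" if "u \<in> real_space m" for c u
    using lin that by (auto simp: linear_between_def)
  have e: "?e i \<in> real_space m" if "i < m" for i using that by (auto simp: real_space_def)
  define p where "p k = (\<lambda>j. if j < k then x j else 0)" for k
  have p: "p k \<in> real_space m" if "k \<le> m" for k using that by (auto simp: p_def real_space_def)
  have partial: "f (p k) = (\<lambda>j. \<Sum>i<k. x i * f (?e i) j)" if "k \<le> m" for k
    using that
  proof (induction k)
    case 0
    have "scale 0 x = 0" "p 0 = 0" by (auto simp: scale_def p_def)
    then have "f (p 0) = 0" using sc[OF x, of 0] by (auto simp: scale_def)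
    then show ?case by auto
  next
    case (Suc k)
    have "p (Suc k) = p k + scale (x k) (?e k)"
      by (auto simp: p_def scale_def fun_eq_iff less_Suc_eq)
    moreover have "scale (x k) (?e k) \<in> real_space m"
      using Suc.prems by (auto simp: scale_def real_space_def)
    ultimately have "f (p (Suc k)) = f (p k) + scale (x k) (f (?e k))"
      using add[OF p] sc[OF e] Suc.prems by simp
    then show ?case using Suc by (auto simp: scale_def)
  qed
  have "p m = x" using x by (auto simp: p_def real_space_def)
  then show ?thesis using partial[of m] by simp
qed

lemma cell_le_trans: "cell_le T \<upsilon> \<tau> \<Longrightarrow> cell_le T \<tau> \<sigma> \<Longrightarrow> cell_le T \<upsilon> \<sigma>"
  using closure_of_minimal[of \<tau> "T closure_of \<sigma>" T] by (auto simp: cell_le_def)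

context monoidal_complex
begin

abbreviation cell_class where "cell_class \<equiv> lim_class T X \<iota> M"

lemma cell_le_refl: "\<sigma> \<in> X \<Longrightarrow> cell_le T \<sigma> \<sigma>"
  using cells_cover closure_of_subset[of \<sigma> T] by (auto simp: cell_le_def)

lemma cell_meet:
  assumes "\<sigma> \<in> X" "\<rho> \<in> X"
  obtains \<kappa> where "\<kappa> \<in> X" "cell_le T \<kappa> \<sigma>" "cell_le T \<kappa> \<rho>"
    "\<And>\<tau>. cell_le T \<tau> \<sigma> \<Longrightarrow> cell_le T \<tau> \<rho> \<Longrightarrow> cell_le T \<tau> \<kappa>"
proof -
  obtain \<kappa> where k: "\<kappa> \<in> X" "T closure_of \<kappa> = T closure_of \<sigma> \<inter> T closure_of \<rho>"
    using intersection_property[OF assms] by blast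
  have "cell_le T \<kappa> \<kappa>" by (rule cell_le_refl[OF k(1)])
  then show ?thesis using that[of \<kappa>] k by (auto simp: cell_le_def)
qed

lemma cone_space: "\<sigma> \<in> X \<Longrightarrow> C \<sigma> \<subseteq> cell_space T \<sigma>"
  using cone_polyhedral by (auto simp: polyhedral_cone_def)

lemma cone_add: "\<sigma> \<in> X \<Longrightarrow> x \<in> C \<sigma> \<Longrightarrow> y \<in> C \<sigma> \<Longrightarrow> x + y \<in> C \<sigma>"
  using cone_polyhedral[of \<sigma>]
  by (auto simp: polyhedral_cone_def real_space_def distrib_left sum.distrib)

lemma cone_zero: "\<sigma> \<in> X \<Longrightarrow> 0 \<in> C \<sigma>"
  using cone_polyhedral[of \<sigma>] by (auto simp: polyhedral_cone_def real_space_def)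

lemma monoid_submonoid: "\<sigma> \<in> X \<Longrightarrow> is_submonoid (M \<sigma>)"
proof -
  assume "\<sigma> \<in> X"
  then obtain G where "M \<sigma> = is_submonoid hull G"
    using monoid_fin_gen by (auto simp: fin_gen_submonoid_def)
  moreover have "is_submonoid (is_submonoid hull G)"
    by (rule hull_in) (auto simp: is_submonoid_def)
  ultimately show ?thesis by simp
qed

lemma monoid_add: "\<sigma> \<in> X \<Longrightarrow> x \<in> M \<sigma> \<Longrightarrow> y \<in> M \<sigma> \<Longrightarrow> x + y \<in> M \<sigma>"
  and monoid_zero: "\<sigma> \<in> X \<Longrightarrow> 0 \<in> M \<sigma>"
  using monoid_submonoid by (auto simp: is_submonoid_def)

lemma monoid_in_cone: "\<sigma> \<in> X \<Longrightarrow> x \<in> M \<sigma> \<Longrightarrow> x \<in> C \<sigma>"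
  using monoid_subset by blast

context
  fixes \<sigma> \<tau>
  assumes \<sigma>: "\<sigma> \<in> X" and \<tau>: "\<tau> \<in> X" and le: "cell_le T \<tau> \<sigma>"
begin

lemma inj_add: "x \<in> C \<tau> \<Longrightarrow> y \<in> C \<tau> \<Longrightarrow> \<iota> \<sigma> \<tau> (x + y) = \<iota> \<sigma> \<tau> x + \<iota> \<sigma> \<tau> y"
  using inj_linear[OF \<sigma> \<tau> le] subsetD[OF cone_space[OF \<tau>], of x] subsetD[OF cone_space[OF \<tau>], of y]
  unfolding linear_between_def by blast

lemma inj_eq: "x \<in> C \<tau> \<Longrightarrow> y \<in> C \<tau> \<Longrightarrow> \<iota> \<sigma> \<tau> x = \<iota> \<sigma> \<tau> y \<longleftrightarrow> x = y"
  using inj_injective[OF \<sigma> \<tau> le] by (auto simp: inj_on_def)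

lemma inj_cone: "x \<in> C \<tau> \<Longrightarrow> \<iota> \<sigma> \<tau> x \<in> C \<sigma>"
  using inj_face[OF \<sigma> \<tau> le] by (auto simp: cone_face_def)

lemma inj_zero: "\<iota> \<sigma> \<tau> 0 = 0"
  using inj_add[of 0 0] cone_zero[OF \<tau>] by simp

lemma inj_monoid_iff: "x \<in> C \<tau> \<Longrightarrow> \<iota> \<sigma> \<tau> x \<in> M \<sigma> \<longleftrightarrow> x \<in> M \<tau>"
proof
  have b: "\<iota> \<sigma> \<tau> ` M \<tau> = M \<sigma> \<inter> \<iota> \<sigma> \<tau> ` C \<tau>"
    using monoid_iso[OF \<sigma> \<tau> le] by (auto simp: bij_betw_def)
  show "\<iota> \<sigma> \<tau> x \<in> M \<sigma>" if "x \<in> M \<tau>" using b that by blast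
  assume x: "x \<in> C \<tau>" "\<iota> \<sigma> \<tau> x \<in> M \<sigma>"
  then obtain y where "y \<in> M \<tau>" "\<iota> \<sigma> \<tau> x = \<iota> \<sigma> \<tau> y" using b by blast
  then show "x \<in> M \<tau>" using inj_eq[OF x(1), of y] monoid_in_cone[OF \<tau>] by auto
qed

lemma inj_monoid: "x \<in> M \<tau> \<Longrightarrow> \<iota> \<sigma> \<tau> x \<in> M \<sigma>"
  using inj_monoid_iff monoid_in_cone[OF \<tau>] by blast

text \<open>A functional that cuts out the face is nonnegative on both summands and vanishes on their
  sum.\<close>

lemma face_summand:
  assumes u: "u \<in> C \<sigma>" and v: "v \<in> C \<sigma>" and uv: "u + v \<in> \<iota> \<sigma> \<tau> ` C \<tau>"
  shows "u \<in> \<iota> \<sigma> \<tau> ` C \<tau>"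
proof -
  obtain a where a: "\<And>x. x \<in> C \<sigma> \<Longrightarrow> 0 \<le> (\<Sum>i<cell_rank T \<sigma>. a i * x i)"
    and F: "\<iota> \<sigma> \<tau> ` C \<tau> = {x \<in> C \<sigma>. (\<Sum>i<cell_rank T \<sigma>. a i * x i) = 0}"
    using inj_face[OF \<sigma> \<tau> le] by (auto simp: cone_face_def)
  have "(\<Sum>i<cell_rank T \<sigma>. a i * u i) + (\<Sum>i<cell_rank T \<sigma>. a i * v i) = 0"
    using uv unfolding F by (auto simp: distrib_left sum.distrib)
  then have "(\<Sum>i<cell_rank T \<sigma>. a i * u i) = 0" using a[OF u] a[OF v] by linarith
  then show ?thesis using u unfolding F by simp
qed

lemma face_summands:
  assumes "u \<in> C \<sigma>" "v \<in> C \<sigma>" "x \<in> C \<tau>" "u + v = \<iota> \<sigma> \<tau> x"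
  obtains u' v' where "u' \<in> C \<tau>" "v' \<in> C \<tau>" "u = \<iota> \<sigma> \<tau> u'" "v = \<iota> \<sigma> \<tau> v'" "u' + v' = x"
proof -
  have "u + v \<in> \<iota> \<sigma> \<tau> ` C \<tau>" "v + u \<in> \<iota> \<sigma> \<tau> ` C \<tau>" using assms by (auto simp: add.commute)
  then obtain u' v' where *: "u' \<in> C \<tau>" "v' \<in> C \<tau>" "u = \<iota> \<sigma> \<tau> u'" "v = \<iota> \<sigma> \<tau> v'"
    using face_summand[of u v] face_summand[of v u] assms by blast
  then have "\<iota> \<sigma> \<tau> (u' + v') = \<iota> \<sigma> \<tau> x" using assms by (simp add: inj_add)
  then have "u' + v' = x" using inj_eq[OF cone_add[OF \<tau> *(1,2)] assms(3)] by simp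
  then show ?thesis using that * by blast
qed

text \<open>A functional that cuts out F pulls back along \<iota>. As functionals are given by coefficient
  vectors, the pullback is read off from the values of \<iota> on the unit vectors.\<close>

lemma face_preimage:
  assumes "cone_face (cell_rank T \<sigma>) (C \<sigma>) F"
  shows "cone_face (cell_rank T \<tau>) (C \<tau>) {x \<in> C \<tau>. \<iota> \<sigma> \<tau> x \<in> F}"
proof -
  obtain a where a: "\<And>x. x \<in> C \<sigma> \<Longrightarrow> 0 \<le> (\<Sum>i<cell_rank T \<sigma>. a i * x i)"
    and F: "F = {x \<in> C \<sigma>. (\<Sum>i<cell_rank T \<sigma>. a i * x i) = 0}"
    using assms by (auto simp: cone_face_def)
  define b where "b k = (\<Sum>i<cell_rank T \<sigma>. a i * \<iota> \<sigma> \<tau> (\<lambda>j. if j = k then 1 else 0) i)" for k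
  have b: "(\<Sum>i<cell_rank T \<sigma>. a i * \<iota> \<sigma> \<tau> x i) = (\<Sum>k<cell_rank T \<tau>. b k * x k)" if "x \<in> C \<tau>" for x
  proof -
    have "x \<in> cell_space T \<tau>" using cone_space[OF \<tau>] that by blast
    from linear_between_basis_sum[OF inj_linear[OF \<sigma> \<tau> le] this]
    have "(\<Sum>i<cell_rank T \<sigma>. a i * \<iota> \<sigma> \<tau> x i) = (\<Sum>i<cell_rank T \<sigma>. \<Sum>k<cell_rank T \<tau>.
      a i * (x k * \<iota> \<sigma> \<tau> (\<lambda>j. if j = k then 1 else 0) i))" by (simp add: sum_distrib_left)
    also have "\<dots> = (\<Sum>k<cell_rank T \<tau>. \<Sum>i<cell_rank T \<sigma>.
      a i * (x k * \<iota> \<sigma> \<tau> (\<lambda>j. if j = k then 1 else 0) i))" by (rule sum.swap)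
    also have "\<dots> = (\<Sum>k<cell_rank T \<tau>. b k * x k)"
      unfolding b_def sum_distrib_right by (intro sum.cong refl) (simp add: mult_ac)
    finally show ?thesis .
  qed
  show ?thesis
    unfolding cone_face_def F using a[OF inj_cone] b inj_cone by (intro exI[of _ b]) auto
qed

end

lemma face_cellE:
  assumes "\<sigma> \<in> X" "cone_face (cell_rank T \<sigma>) (C \<sigma>) F"
  obtains \<tau> where "\<tau> \<in> X" "cell_le T \<tau> \<sigma>" "F = \<iota> \<sigma> \<tau> ` C \<tau>"
  using ex1_implies_ex[OF face_unique[OF assms]] by (elim exE conjE)

lemma face_cell_unique:
  assumes "\<sigma> \<in> X" "\<tau> \<in> X" "cell_le T \<tau> \<sigma>" "\<upsilon> \<in> X" "cell_le T \<upsilon> \<sigma>" "\<iota> \<sigma> \<tau> ` C \<tau> = \<iota> \<sigma> \<upsilon> ` C \<upsilon>"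
  shows "\<tau> = \<upsilon>"
  by (rule Uniq_D[OF conjunct2[OF iffD1[OF ex1_iff_ex_Uniq
      face_unique[OF assms(1) inj_face[OF assms(1-3)]]]]]) (use assms in simp_all)

text \<open>The preimage in C \<pi> of the smaller face is a face of C \<pi>, so it belongs to a cell below \<pi>.
  In C \<rho> that cell has the same face as \<upsilon>, hence it is \<upsilon>.\<close>

lemma face_subset_imp_le:
  assumes X: "\<rho> \<in> X" "\<upsilon> \<in> X" "\<pi> \<in> X" and le: "cell_le T \<upsilon> \<rho>" "cell_le T \<pi> \<rho>"
    and sub: "\<iota> \<rho> \<upsilon> ` C \<upsilon> \<subseteq> \<iota> \<rho> \<pi> ` C \<pi>"
  shows "cell_le T \<upsilon> \<pi>"
proof -
  let ?F = "\<iota> \<rho> \<upsilon> ` C \<upsilon>"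
  have F: "cone_face (cell_rank T \<rho>) (C \<rho>) ?F" by (rule inj_face[OF X(1,2) le(1)])
  obtain \<tau> where \<tau>: "\<tau> \<in> X" "cell_le T \<tau> \<pi>" "{x \<in> C \<pi>. \<iota> \<rho> \<pi> x \<in> ?F} = \<iota> \<pi> \<tau> ` C \<tau>"
    by (rule face_cellE[OF X(3) face_preimage[OF X(1,3) le(2) F]])
  have "\<iota> \<rho> \<tau> ` C \<tau> = \<iota> \<rho> \<pi> ` \<iota> \<pi> \<tau> ` C \<tau>"
    using inj_comp[OF X(1,3) \<tau>(1) le(2) \<tau>(2)] by (auto simp: image_image)
  also have "\<dots> = ?F"
    unfolding \<tau>(3)[symmetric]
  proof (intro equalityI subsetI)
    fix y assume y: "y \<in> ?F"
    obtain x where "y = \<iota> \<rho> \<pi> x" "x \<in> C \<pi>" using subsetD[OF sub y] by (rule imageE)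
    then show "y \<in> \<iota> \<rho> \<pi> ` {x \<in> C \<pi>. \<iota> \<rho> \<pi> x \<in> ?F}" using y by (intro image_eqI[of _ _ x]) simp_all
  qed auto
  finally have "\<tau> = \<upsilon>"
    by (intro face_cell_unique[OF X(1) \<tau>(1) cell_le_trans[OF \<tau>(2) le(2)] X(2) le(1)])
  then show ?thesis using \<tau>(2) by simp
qed

text \<open>The intersection of two faces is a face, cut out by the sum of the two functionals. It
  belongs to a cell \<zeta>, and \<zeta> lies below both cells by the previous lemma.\<close>

lemma common_face:
  assumes X: "\<rho> \<in> X" "\<upsilon> \<in> X" "\<pi> \<in> X" and le: "cell_le T \<upsilon> \<rho>" "cell_le T \<pi> \<rho>"
    and z: "z \<in> M \<upsilon>" and w: "w \<in> M \<pi>" and eq: "\<iota> \<rho> \<upsilon> z = \<iota> \<rho> \<pi> w"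
  shows "\<exists>\<zeta>\<in>X. cell_le T \<zeta> \<upsilon> \<and> cell_le T \<zeta> \<pi> \<and> (\<exists>t\<in>M \<zeta>. \<iota> \<upsilon> \<zeta> t = z \<and> \<iota> \<pi> \<zeta> t = w)"
proof -
  let ?F = "\<iota> \<rho> \<upsilon> ` C \<upsilon>" and ?G = "\<iota> \<rho> \<pi> ` C \<pi>" and ?n = "cell_rank T \<rho>"
  obtain a where a: "\<And>x. x \<in> C \<rho> \<Longrightarrow> 0 \<le> (\<Sum>i<?n. a i * x i)"
    and F: "?F = {x \<in> C \<rho>. (\<Sum>i<?n. a i * x i) = 0}"
    using inj_face[OF X(1,2) le(1)] by (auto simp: cone_face_def)
  obtain b where b: "\<And>x. x \<in> C \<rho> \<Longrightarrow> 0 \<le> (\<Sum>i<?n. b i * x i)"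
    and G: "?G = {x \<in> C \<rho>. (\<Sum>i<?n. b i * x i) = 0}"
    using inj_face[OF X(1,3) le(2)] by (auto simp: cone_face_def)
  have "cone_face ?n (C \<rho>) (?F \<inter> ?G)"
    unfolding cone_face_def F G
  proof (intro exI[of _ "\<lambda>i. a i + b i"] conjI ballI)
    show "0 \<le> (\<Sum>i<?n. (a i + b i) * x i)" if "x \<in> C \<rho>" for x
      using a[OF that] b[OF that] by (simp add: distrib_right sum.distrib)
    have "(\<Sum>i<?n. (a i + b i) * x i) = 0 \<longleftrightarrow> (\<Sum>i<?n. a i * x i) = 0 \<and> (\<Sum>i<?n. b i * x i) = 0"
      if "x \<in> C \<rho>" for x
      using a[OF that] b[OF that] by (simp add: distrib_right sum.distrib add_nonneg_eq_0_iff)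
    then show "{x \<in> C \<rho>. (\<Sum>i<?n. a i * x i) = 0} \<inter> {x \<in> C \<rho>. (\<Sum>i<?n. b i * x i) = 0} =
      {x \<in> C \<rho>. (\<Sum>i<?n. (a i + b i) * x i) = 0}" by blast
  qed
  then obtain \<zeta> where \<zeta>: "\<zeta> \<in> X" "cell_le T \<zeta> \<rho>" "?F \<inter> ?G = \<iota> \<rho> \<zeta> ` C \<zeta>"
    by (rule face_cellE[OF X(1)])
  have l: "cell_le T \<zeta> \<upsilon>" "cell_le T \<zeta> \<pi>"
    using face_subset_imp_le[OF X(1) \<zeta>(1) X(2) \<zeta>(2) le(1)]
      face_subset_imp_le[OF X(1) \<zeta>(1) X(3) \<zeta>(2) le(2)] \<zeta>(3) by blast+
  have zw: "z \<in> C \<upsilon>" "w \<in> C \<pi>" using z w monoid_in_cone X by auto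
  have "\<iota> \<rho> \<upsilon> z \<in> ?F" by (rule imageI[OF zw(1)])
  moreover have "\<iota> \<rho> \<upsilon> z \<in> ?G" unfolding eq by (rule imageI[OF zw(2)])
  ultimately have "\<iota> \<rho> \<upsilon> z \<in> ?F \<inter> ?G" by blast
  then obtain t where t: "t \<in> C \<zeta>" "\<iota> \<rho> \<upsilon> z = \<iota> \<rho> \<zeta> t" using \<zeta>(3) by blast
  have "\<iota> \<rho> \<upsilon> (\<iota> \<upsilon> \<zeta> t) = \<iota> \<rho> \<upsilon> z" using inj_comp[OF X(1,2) \<zeta>(1) le(1) l(1) t(1)] t(2) by simp
  then have 1: "\<iota> \<upsilon> \<zeta> t = z"
    using inj_eq[OF X(1,2) le(1) inj_cone[OF X(2) \<zeta>(1) l(1) t(1)] zw(1)] by simp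
  have "\<iota> \<rho> \<pi> (\<iota> \<pi> \<zeta> t) = \<iota> \<rho> \<pi> w" using inj_comp[OF X(1,3) \<zeta>(1) le(2) l(2) t(1)] t(2) eq by simp
  then have 2: "\<iota> \<pi> \<zeta> t = w"
    using inj_eq[OF X(1,3) le(2) inj_cone[OF X(3) \<zeta>(1) l(2) t(1)] zw(2)] by simp
  have "t \<in> M \<zeta>" using inj_monoid_iff[OF X(2) \<zeta>(1) l(1) t(1)] 1 z by simp
  then show ?thesis using \<zeta>(1) l 1 2 by blast
qed

text \<open>Points of two cells that come from one common face. By \<open>lim_rel_imp_same_point\<close>, zigzags of
  such identifications give nothing more, so this is equality in the direct limit.\<close>

definition same_point :: "'x set \<Rightarrow> (nat \<Rightarrow> real) \<Rightarrow> 'x set \<Rightarrow> (nat \<Rightarrow> real) \<Rightarrow> bool" where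
  "same_point \<sigma> x \<rho> y \<longleftrightarrow> (\<exists>\<upsilon>\<in>X. cell_le T \<upsilon> \<sigma> \<and> cell_le T \<upsilon> \<rho> \<and>
    (\<exists>z\<in>M \<upsilon>. \<iota> \<sigma> \<upsilon> z = x \<and> \<iota> \<rho> \<upsilon> z = y))"

lemma same_pointI:
  "\<upsilon> \<in> X \<Longrightarrow> cell_le T \<upsilon> \<sigma> \<Longrightarrow> cell_le T \<upsilon> \<rho> \<Longrightarrow> z \<in> M \<upsilon> \<Longrightarrow> \<iota> \<sigma> \<upsilon> z = x \<Longrightarrow> \<iota> \<rho> \<upsilon> z = y \<Longrightarrow>
    same_point \<sigma> x \<rho> y"
  unfolding same_point_def by blast

definition glue_step :: "(('x set \<times> (nat \<Rightarrow> real)) \<times> ('x set \<times> (nat \<Rightarrow> real))) set" where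
  "glue_step = {((\<tau>, a), (\<sigma>, \<iota> \<sigma> \<tau> a)) | \<sigma> \<tau> a. \<sigma> \<in> X \<and> \<tau> \<in> X \<and> cell_le T \<tau> \<sigma> \<and> a \<in> M \<tau>}"

lemma lim_rel_eq: "lim_rel T X \<iota> M = (glue_step \<union> glue_step\<inverse>)\<^sup>*"
  by (simp only: lim_rel_def glue_step_def Let_def)

text \<open>By induction on the length of a zigzag. A step up to a larger cell keeps the common face; a
  step down to a smaller one replaces it by the face of \<open>common_face\<close>.\<close>

lemma lim_rel_imp_same_point:
  assumes "(p, q) \<in> lim_rel T X \<iota> M" and "fst p \<in> X" "snd p \<in> M (fst p)"
  shows "fst q \<in> X \<and> snd q \<in> M (fst q) \<and> same_point (fst p) (snd p) (fst q) (snd q)"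
  using assms(1) unfolding lim_rel_eq
proof (induction rule: rtrancl_induct)
  case base
  have "\<iota> (fst p) (fst p) (snd p) = snd p"
    using inj_id monoid_in_cone assms by auto
  then show ?case using assms cell_le_refl unfolding same_point_def by blast
next
  case (step q s)
  obtain \<rho> y where q: "q = (\<rho>, y)" by (cases q)
  obtain \<pi> w where s: "s = (\<pi>, w)" by (cases s)
  define \<sigma> where "\<sigma> = fst p"
  define x where "x = snd p"
  have \<sigma>: "\<sigma> \<in> X" using assms by (simp add: \<sigma>_def)
  have \<rho>: "\<rho> \<in> X" "y \<in> M \<rho>" and sp: "same_point \<sigma> x \<rho> y" using step.IH by (auto simp: q \<sigma>_def x_def)
  obtain \<upsilon> z where \<upsilon>: "\<upsilon> \<in> X" "cell_le T \<upsilon> \<sigma>" "cell_le T \<upsilon> \<rho>" "z \<in> M \<upsilon>" "\<iota> \<sigma> \<upsilon> z = x" "\<iota> \<rho> \<upsilon> z = y"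
    using sp unfolding same_point_def by blast
  from step.hyps(2) consider
      "\<pi> \<in> X" "cell_le T \<rho> \<pi>" "w = \<iota> \<pi> \<rho> y" | "\<pi> \<in> X" "cell_le T \<pi> \<rho>" "w \<in> M \<pi>" "y = \<iota> \<rho> \<pi> w"
    unfolding q s glue_step_def by auto
  then have "\<pi> \<in> X \<and> w \<in> M \<pi> \<and> same_point \<sigma> x \<pi> w"
  proof cases
    case 1
    have "\<iota> \<pi> \<upsilon> z = w"
      using inj_comp[OF 1(1) \<rho>(1) \<upsilon>(1) 1(2) \<upsilon>(3) monoid_in_cone[OF \<upsilon>(1,4)]] 1(3) \<upsilon>(6) by simp
    from same_pointI[OF \<upsilon>(1,2) cell_le_trans[OF \<upsilon>(3) 1(2)] \<upsilon>(4,5) this]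
    show ?thesis using 1 inj_monoid[OF 1(1) \<rho>(1) 1(2) \<rho>(2)] by simp
  next
    case 2
    obtain \<zeta> t
      where \<zeta>: "\<zeta> \<in> X" "cell_le T \<zeta> \<upsilon>" "cell_le T \<zeta> \<pi>" "t \<in> M \<zeta>" "\<iota> \<upsilon> \<zeta> t = z" "\<iota> \<pi> \<zeta> t = w"
      using common_face[OF \<rho>(1) \<upsilon>(1) 2(1) \<upsilon>(3) 2(2) \<upsilon>(4) 2(3)] 2(4) \<upsilon>(6) by auto
    have "\<iota> \<sigma> \<zeta> t = x"
      using inj_comp[OF \<sigma> \<upsilon>(1) \<zeta>(1) \<upsilon>(2) \<zeta>(2) monoid_in_cone[OF \<zeta>(1,4)]] \<zeta>(5) \<upsilon>(5) by simp
    from same_pointI[OF \<zeta>(1) cell_le_trans[OF \<zeta>(2) \<upsilon>(2)] \<zeta>(3,4) this \<zeta>(6)]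
    show ?thesis using 2 by simp
  qed
  then show ?case by (simp add: s \<sigma>_def x_def)
qed

lemma lim_rel_sym: "sym (lim_rel T X \<iota> M)"
  unfolding lim_rel_eq by (intro sym_rtrancl sym_Un_converse)

lemma lim_rel_trans: "trans (lim_rel T X \<iota> M)"
  unfolding lim_rel_eq by (rule trans_rtrancl)

lemma cell_class_eq_lim_rel: "cell_class \<sigma> x = cell_class \<rho> y \<longleftrightarrow> ((\<sigma>, x), (\<rho>, y)) \<in> lim_rel T X \<iota> M"
proof
  assume e: "cell_class \<sigma> x = cell_class \<rho> y"
  have "(\<rho>, y) \<in> cell_class \<rho> y" by (simp add: lim_class_def lim_rel_eq)
  then show "((\<sigma>, x), (\<rho>, y)) \<in> lim_rel T X \<iota> M" unfolding e[symmetric] by (simp add: lim_class_def)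
next
  assume "((\<sigma>, x), (\<rho>, y)) \<in> lim_rel T X \<iota> M"
  then show "cell_class \<sigma> x = cell_class \<rho> y"
    using lim_rel_sym lim_rel_trans unfolding lim_class_def sym_def trans_def by blast
qed

lemma cell_class_eq_iff:
  assumes "\<sigma> \<in> X" "x \<in> M \<sigma>" "\<rho> \<in> X" "y \<in> M \<rho>"
  shows "cell_class \<sigma> x = cell_class \<rho> y \<longleftrightarrow> same_point \<sigma> x \<rho> y"
  unfolding cell_class_eq_lim_rel
proof
  show "same_point \<sigma> x \<rho> y" if "((\<sigma>, x), (\<rho>, y)) \<in> lim_rel T X \<iota> M"
    using lim_rel_imp_same_point[OF that] assms by simp
  assume "same_point \<sigma> x \<rho> y"
  then obtain \<upsilon> z
    where "\<upsilon> \<in> X" "cell_le T \<upsilon> \<sigma>" "cell_le T \<upsilon> \<rho>" "z \<in> M \<upsilon>" "\<iota> \<sigma> \<upsilon> z = x" "\<iota> \<rho> \<upsilon> z = y"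
    unfolding same_point_def by blast
  then have "((\<upsilon>, z), (\<sigma>, x)) \<in> glue_step" "((\<upsilon>, z), (\<rho>, y)) \<in> glue_step"
    using assms unfolding glue_step_def by auto
  then show "((\<sigma>, x), (\<rho>, y)) \<in> lim_rel T X \<iota> M"
    unfolding lim_rel_eq by (meson UnI1 UnI2 converseI r_into_rtrancl rtrancl_trans)
qed

lemma cell_class_inj:
  "\<sigma> \<in> X \<Longrightarrow> x \<in> M \<sigma> \<Longrightarrow> y \<in> M \<sigma> \<Longrightarrow> cell_class \<sigma> x = cell_class \<sigma> y \<Longrightarrow> x = y"
  by (auto simp: cell_class_eq_iff same_point_def)

lemma cell_class_face:
  "\<sigma> \<in> X \<Longrightarrow> \<tau> \<in> X \<Longrightarrow> cell_le T \<tau> \<sigma> \<Longrightarrow> x \<in> M \<tau> \<Longrightarrow> cell_class \<sigma> (\<iota> \<sigma> \<tau> x) = cell_class \<tau> x"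
  unfolding cell_class_eq_lim_rel lim_rel_eq
  by (rule r_into_rtrancl) (auto simp: glue_step_def)

lemma lim_set_eq: "lim_set T X \<iota> M = {cell_class \<sigma> x | \<sigma> x. \<sigma> \<in> X \<and> x \<in> M \<sigma>}"
  by (auto simp: lim_set_def lim_class_def quotient_def)

text \<open>If a sum lies in M \<sigma>, it lies in a face common to \<sigma> and to the cell in which it was formed,
  and by \<open>face_summands\<close> the summands lie in that face as well.\<close>

lemma lim_sum_summands:
  assumes \<sigma>: "\<sigma> \<in> X" "x \<in> M \<sigma>" and s: "lim_sum T X \<iota> M a b (cell_class \<sigma> x)"
  shows "\<exists>u\<in>M \<sigma>. \<exists>v\<in>M \<sigma>. a = cell_class \<sigma> u \<and> b = cell_class \<sigma> v \<and> u + v = x"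
proof -
  obtain \<rho> u v where \<rho>: "\<rho> \<in> X" and u: "u \<in> M \<rho>" and v: "v \<in> M \<rho>"
    and a: "a = cell_class \<rho> u" and b: "b = cell_class \<rho> v"
    and e: "cell_class \<sigma> x = cell_class \<rho> (u + v)"
    using s by (auto simp: lim_sum_def)
  obtain \<upsilon> z where \<upsilon>: "\<upsilon> \<in> X" "cell_le T \<upsilon> \<sigma>" "cell_le T \<upsilon> \<rho>" "z \<in> M \<upsilon>"
      "\<iota> \<sigma> \<upsilon> z = x" "\<iota> \<rho> \<upsilon> z = u + v"
    using e cell_class_eq_iff[OF \<sigma> \<rho> monoid_add[OF \<rho> u v]] unfolding same_point_def by auto
  obtain u' v' where *: "u' \<in> C \<upsilon>" "v' \<in> C \<upsilon>" "u = \<iota> \<rho> \<upsilon> u'" "v = \<iota> \<rho> \<upsilon> v'" "u' + v' = z"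
    using face_summands[OF \<rho> \<upsilon>(1,3), of u v z] monoid_in_cone \<rho> u v \<upsilon> by metis
  have m: "u' \<in> M \<upsilon>" "v' \<in> M \<upsilon>"
    using inj_monoid_iff[OF \<rho> \<upsilon>(1,3)] * u v by auto
  have "a = cell_class \<sigma> (\<iota> \<sigma> \<upsilon> u')" "b = cell_class \<sigma> (\<iota> \<sigma> \<upsilon> v')"
    using cell_class_face[OF \<rho> \<upsilon>(1,3)] cell_class_face[OF \<sigma>(1) \<upsilon>(1,2)] m * a b by auto
  moreover have "\<iota> \<sigma> \<upsilon> u' + \<iota> \<sigma> \<upsilon> v' = x"
    using inj_add[OF \<sigma>(1) \<upsilon>(1,2) *(1,2)] *(5) \<upsilon>(5) by simp
  moreover have "\<iota> \<sigma> \<upsilon> u' \<in> M \<sigma>" "\<iota> \<sigma> \<upsilon> v' \<in> M \<sigma>" using inj_monoid[OF \<sigma>(1) \<upsilon>(1,2)] m by auto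
  ultimately show ?thesis by blast
qed

lemma lim_sum_cell:
  "\<sigma> \<in> X \<Longrightarrow> x \<in> M \<sigma> \<Longrightarrow> y \<in> M \<sigma> \<Longrightarrow> lim_sum T X \<iota> M (cell_class \<sigma> x) (cell_class \<sigma> y) (cell_class \<sigma> (x + y))"
  by (auto simp: lim_sum_def)

text \<open>If the sum is formed in another cell \<rho>, each summand lies in some common face of \<sigma> and \<rho>.
  The intersection property provides one common face \<kappa> that contains both summands, and their sum
  can be formed there.\<close>

lemma lim_sum_unique:
  assumes \<sigma>: "\<sigma> \<in> X" "x \<in> M \<sigma>" "y \<in> M \<sigma>"
    and s: "lim_sum T X \<iota> M (cell_class \<sigma> x) (cell_class \<sigma> y) c"
  shows "c = cell_class \<sigma> (x + y)"
proof -
  obtain \<rho> u v where \<rho>: "\<rho> \<in> X" and u: "u \<in> M \<rho>" and v: "v \<in> M \<rho>"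
    and a: "cell_class \<sigma> x = cell_class \<rho> u" and b: "cell_class \<sigma> y = cell_class \<rho> v"
    and c: "c = cell_class \<rho> (u + v)"
    using s by (auto simp: lim_sum_def)
  obtain \<kappa> where \<kappa>: "\<kappa> \<in> X" "cell_le T \<kappa> \<sigma>" "cell_le T \<kappa> \<rho>"
    and meet: "\<And>\<tau>. cell_le T \<tau> \<sigma> \<Longrightarrow> cell_le T \<tau> \<rho> \<Longrightarrow> cell_le T \<tau> \<kappa>"
    using cell_meet[OF \<sigma>(1) \<rho>] by metis
  have lift: "\<exists>z\<in>M \<kappa>. \<iota> \<sigma> \<kappa> z = p \<and> \<iota> \<rho> \<kappa> z = q"
    if pq: "p \<in> M \<sigma>" "q \<in> M \<rho>" "cell_class \<sigma> p = cell_class \<rho> q" for p q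
  proof -
    obtain \<upsilon> z
      where \<upsilon>: "\<upsilon> \<in> X" "cell_le T \<upsilon> \<sigma>" "cell_le T \<upsilon> \<rho>" "z \<in> M \<upsilon>" "\<iota> \<sigma> \<upsilon> z = p" "\<iota> \<rho> \<upsilon> z = q"
      using pq(3) cell_class_eq_iff[OF \<sigma>(1) pq(1) \<rho> pq(2)] unfolding same_point_def by auto
    have l: "cell_le T \<upsilon> \<kappa>" by (rule meet[OF \<upsilon>(2,3)])
    have "\<iota> \<sigma> \<kappa> (\<iota> \<kappa> \<upsilon> z) = p" "\<iota> \<rho> \<kappa> (\<iota> \<kappa> \<upsilon> z) = q"
      using inj_comp[OF \<sigma>(1) \<kappa>(1) \<upsilon>(1) \<kappa>(2) l] inj_comp[OF \<rho> \<kappa>(1) \<upsilon>(1) \<kappa>(3) l]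
        monoid_in_cone[OF \<upsilon>(1,4)] \<upsilon>(5,6) by auto
    then show ?thesis using inj_monoid[OF \<kappa>(1) \<upsilon>(1) l \<upsilon>(4)] by blast
  qed
  obtain p q where p: "p \<in> M \<kappa>" "\<iota> \<sigma> \<kappa> p = x" "\<iota> \<rho> \<kappa> p = u"
    and q: "q \<in> M \<kappa>" "\<iota> \<sigma> \<kappa> q = y" "\<iota> \<rho> \<kappa> q = v"
    using lift[OF \<sigma>(2) u a] lift[OF \<sigma>(3) v b] by blast
  have pq: "p + q \<in> M \<kappa>" by (rule monoid_add[OF \<kappa>(1) p(1) q(1)])
  have "c = cell_class \<kappa> (p + q)"
    using c cell_class_face[OF \<rho> \<kappa>(1,3) pq] inj_add[OF \<rho> \<kappa>(1,3)] monoid_in_cone[OF \<kappa>(1)] p q by simp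
  also have "\<dots> = cell_class \<sigma> (x + y)"
    using cell_class_face[OF \<sigma>(1) \<kappa>(1,2) pq] inj_add[OF \<sigma>(1) \<kappa>(1,2)] monoid_in_cone[OF \<kappa>(1)] p q
    by simp
  finally show ?thesis .
qed

end

section \<open>The toric face ring is reduced and noetherian\<close>

context monoidal_complex
begin

abbreviation face_ring :: "('x exponent \<Rightarrow> 'k::field) ring" where
  "face_ring \<equiv> toric_face_ring T X \<iota> M"

lemma face_ring_simps:
  "carrier face_ring = {f. finite {a. f a \<noteq> 0} \<and> {a. f a \<noteq> 0} \<subseteq> lim_set T X \<iota> M}"
  "f \<otimes>\<^bsub>face_ring\<^esub> g = (\<lambda>c.
       \<Sum>(a, b) \<in> {(a, b). f a \<noteq> 0 \<and> g b \<noteq> 0 \<and> lim_sum T X \<iota> M a b c}. f a * g b)"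
  "\<one>\<^bsub>face_ring\<^esub> = (\<lambda>c. if c = cell_class {} 0 then 1 else 0)"
  "\<zero>\<^bsub>face_ring\<^esub> = (\<lambda>c. 0)"
  "f \<oplus>\<^bsub>face_ring\<^esub> g = (\<lambda>c. f c + g c)"
  by (simp_all add: toric_face_ring_def)

text \<open>The image of r under the projection from the toric face ring to k[M \<sigma>].\<close>

definition cell_poly :: "'x set \<Rightarrow> ('x exponent \<Rightarrow> 'k::field) \<Rightarrow> 'k poly_fun" where
  "cell_poly \<sigma> r = Abs_poly_mapping (cell_projection T X \<iota> M \<sigma> r)"

lemma lookup_cell_poly:
  assumes r: "r \<in> carrier face_ring" and \<sigma>: "\<sigma> \<in> X"
  shows "lookup (cell_poly \<sigma> r) = cell_projection T X \<iota> M \<sigma> r"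
proof -
  have "inj_on (cell_class \<sigma>) {x. cell_projection T X \<iota> M \<sigma> r x \<noteq> 0}"
    by (rule inj_onI) (auto simp: cell_projection_def split: if_splits intro: cell_class_inj[OF \<sigma>])
  moreover have "cell_class \<sigma> ` {x. cell_projection T X \<iota> M \<sigma> r x \<noteq> 0} \<subseteq> {a. r a \<noteq> 0}"
    by (auto simp: cell_projection_def split: if_splits)
  then have "finite (cell_class \<sigma> ` {x. cell_projection T X \<iota> M \<sigma> r x \<noteq> 0})"
    by (rule finite_subset) (use r in \<open>simp add: face_ring_simps\<close>)
  ultimately have "finite {x. cell_projection T X \<iota> M \<sigma> r x \<noteq> 0}" by (rule finite_imageD[rotated])
  then show ?thesis by (simp add: cell_poly_def)
qed

lemma cell_poly_keys:
  assumes "r \<in> carrier face_ring" "\<sigma> \<in> X"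
  shows "cell_poly \<sigma> r \<in> keys_in (M \<sigma>)"
  by (auto simp: keys_in_def in_keys_iff lookup_cell_poly[OF assms] cell_projection_def split: if_splits)

text \<open>Every decomposition of an exponent in M \<sigma> takes place inside M \<sigma>.\<close>

lemma cell_poly_mult:
  fixes f g :: "'x exponent \<Rightarrow> 'k::field"
  assumes R: "cring (face_ring :: ('x exponent \<Rightarrow> 'k) ring)" and \<sigma>: "\<sigma> \<in> X"
    and f: "f \<in> carrier face_ring" and g: "g \<in> carrier face_ring"
  shows "cell_poly \<sigma> (f \<otimes>\<^bsub>face_ring\<^esub> g) = cell_poly \<sigma> f * cell_poly \<sigma> g"
proof (rule poly_mapping_eqI)
  fix x
  interpret R: cring "face_ring :: ('x exponent \<Rightarrow> 'k) ring" by (rule R)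
  note l = lookup_cell_poly[OF _ \<sigma>]
  show "lookup (cell_poly \<sigma> (f \<otimes>\<^bsub>face_ring\<^esub> g)) x = lookup (cell_poly \<sigma> f * cell_poly \<sigma> g) x"
  proof (cases "x \<in> M \<sigma>")
    case False
    have "cell_poly \<sigma> f * cell_poly \<sigma> g \<in> keys_in (M \<sigma>)"
      by (intro keys_in_mult monoid_submonoid[OF \<sigma>] cell_poly_keys f g \<sigma>)
    then have "lookup (cell_poly \<sigma> f * cell_poly \<sigma> g) x = 0"
      using False by (auto simp: keys_in_def in_keys_iff)
    then show ?thesis using False f g by (simp add: l cell_projection_def)
  next
    case x: True
    let ?A = "{(u, v). lookup (cell_poly \<sigma> f) u \<noteq> 0 \<and> lookup (cell_poly \<sigma> g) v \<noteq> 0 \<and> u + v = x}"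
    let ?B = "{(a, b). f a \<noteq> 0 \<and> g b \<noteq> 0 \<and> lim_sum T X \<iota> M a b (cell_class \<sigma> x)}"
    have A: "?A = {(u, v). u \<in> M \<sigma> \<and> v \<in> M \<sigma> \<and> f (cell_class \<sigma> u) \<noteq> 0 \<and> g (cell_class \<sigma> v) \<noteq> 0 \<and> u + v = x}"
      using f g by (auto simp: l cell_projection_def split: if_splits)
    have "(\<Sum>(u, v)\<in>?A. lookup (cell_poly \<sigma> f) u * lookup (cell_poly \<sigma> g) v) =
      (\<Sum>(a, b)\<in>?B. f a * g b)"
    proof (rule sum.reindex_bij_witness_not_neutral[where S' = "{}" and T' = "{}"
          and j = "\<lambda>(u, v). (cell_class \<sigma> u, cell_class \<sigma> v)"
          and i = "\<lambda>(a, b). (inv_into (M \<sigma>) (cell_class \<sigma>) a, inv_into (M \<sigma>) (cell_class \<sigma>) b)"])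
      have inj: "inj_on (cell_class \<sigma>) (M \<sigma>)" by (rule inj_onI) (rule cell_class_inj[OF \<sigma>])
      show "(case (case p of (u, v) \<Rightarrow> (cell_class \<sigma> u, cell_class \<sigma> v)) of
          (a, b) \<Rightarrow> (inv_into (M \<sigma>) (cell_class \<sigma>) a, inv_into (M \<sigma>) (cell_class \<sigma>) b)) = p"
        if "p \<in> ?A - {}" for p
        using that unfolding A by (auto simp: inv_into_f_f[OF inj])
      show "(case p of (u, v) \<Rightarrow> (cell_class \<sigma> u, cell_class \<sigma> v)) \<in> ?B - {}" if "p \<in> ?A - {}" for p
        using that unfolding A by (auto simp: lim_sum_cell[OF \<sigma>])
      show "(case p of (a, b) \<Rightarrow> (inv_into (M \<sigma>) (cell_class \<sigma>) a, inv_into (M \<sigma>) (cell_class \<sigma>) b)) \<in> ?A - {}"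
        and "(case (case p of (a, b) \<Rightarrow> (inv_into (M \<sigma>) (cell_class \<sigma>) a, inv_into (M \<sigma>) (cell_class \<sigma>) b)) of
          (u, v) \<Rightarrow> (cell_class \<sigma> u, cell_class \<sigma> v)) = p"
        if p: "p \<in> ?B - {}" for p
      proof -
        obtain a b where ab: "p = (a, b)" "f a \<noteq> 0" "g b \<noteq> 0" "lim_sum T X \<iota> M a b (cell_class \<sigma> x)"
          using p by auto
        obtain u v
          where uv: "u \<in> M \<sigma>" "v \<in> M \<sigma>" "a = cell_class \<sigma> u" "b = cell_class \<sigma> v" "u + v = x"
          using lim_sum_summands[OF \<sigma> x ab(4)] by blast
        show "(case p of (a, b) \<Rightarrow> (inv_into (M \<sigma>) (cell_class \<sigma>) a, inv_into (M \<sigma>) (cell_class \<sigma>) b)) \<in> ?A - {}"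
          unfolding A using ab uv by (simp add: inv_into_f_f[OF inj])
        show "(case (case p of (a, b) \<Rightarrow> (inv_into (M \<sigma>) (cell_class \<sigma>) a, inv_into (M \<sigma>) (cell_class \<sigma>) b)) of
          (u, v) \<Rightarrow> (cell_class \<sigma> u, cell_class \<sigma> v)) = p"
          using ab uv by (simp add: inv_into_f_f[OF inj])
      qed
      show "(case (case p of (u, v) \<Rightarrow> (cell_class \<sigma> u, cell_class \<sigma> v)) of (a, b) \<Rightarrow> f a * g b) =
        (case p of (u, v) \<Rightarrow> lookup (cell_poly \<sigma> f) u * lookup (cell_poly \<sigma> g) v)" if "p \<in> ?A" for p
        using that f g unfolding A by (auto simp: l cell_projection_def)
    qed auto
    then have "lookup (cell_poly \<sigma> f * cell_poly \<sigma> g) x = (f \<otimes>\<^bsub>face_ring\<^esub> g) (cell_class \<sigma> x)"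
      unfolding lookup_times_sum face_ring_simps(2) .
    also have "\<dots> = lookup (cell_poly \<sigma> (f \<otimes>\<^bsub>face_ring\<^esub> g)) x"
      using x by (simp add: l[OF R.m_closed[OF f g]] cell_projection_def)
    finally show ?thesis ..
  qed
qed

lemma cell_poly_eq_zero:
  assumes f: "f \<in> carrier face_ring" and z: "\<And>\<sigma>. \<sigma> \<in> X \<Longrightarrow> cell_poly \<sigma> f = 0"
  shows "f = \<zero>\<^bsub>face_ring\<^esub>"
proof -
  have "f a = 0" for a
  proof (cases "a \<in> lim_set T X \<iota> M")
    case True
    then obtain \<sigma> x where s: "\<sigma> \<in> X" "x \<in> M \<sigma>" "a = cell_class \<sigma> x" by (auto simp: lim_set_eq)
    have "lookup (cell_poly \<sigma> f) x = f a"
      using s by (simp add: lookup_cell_poly[OF f s(1)] cell_projection_def)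
    then show ?thesis using z[OF s(1)] by simp
  qed (use f in \<open>auto simp: face_ring_simps\<close>)
  then show ?thesis by (auto simp: face_ring_simps)
qed

lemma monoid_real_space: "\<sigma> \<in> X \<Longrightarrow> M \<sigma> \<subseteq> cell_space T \<sigma>"
  using monoid_subset[of \<sigma>] cone_space[of \<sigma>] by auto

text \<open>The projections to the domains k[M \<sigma>] are jointly injective.\<close>

theorem face_ring_reduced:
  assumes R: "cring (face_ring :: ('x exponent \<Rightarrow> 'k::field) ring)"
  shows "reduced_ring (face_ring :: ('x exponent \<Rightarrow> 'k) ring)"
  unfolding reduced_ring_def
proof (intro ballI allI impI)
  interpret R: cring "face_ring :: ('x exponent \<Rightarrow> 'k) ring" by (rule R)
  fix a :: "'x exponent \<Rightarrow> 'k" and n :: nat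
  assume a: "a \<in> carrier face_ring" and z: "a [^]\<^bsub>face_ring\<^esub> n = \<zero>\<^bsub>face_ring\<^esub>"
  show "a = \<zero>\<^bsub>face_ring\<^esub>"
  proof (rule cell_poly_eq_zero[OF a])
    fix \<sigma> assume \<sigma>: "\<sigma> \<in> X"
    have k: "cell_poly \<sigma> a \<in> keys_in (cell_space T \<sigma>)"
      by (rule subsetD[OF keys_in_mono[OF monoid_real_space[OF \<sigma>]] cell_poly_keys[OF a \<sigma>]])
    have z': "a [^]\<^bsub>face_ring\<^esub> Suc n = \<zero>\<^bsub>face_ring\<^esub>" using z a by simp
    have pow: "cell_poly \<sigma> (a [^]\<^bsub>face_ring\<^esub> Suc m) = cell_poly \<sigma> a ^ Suc m" for m
    proof (induction m)
      case (Suc m)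
      have "cell_poly \<sigma> (a [^]\<^bsub>face_ring\<^esub> Suc (Suc m)) = cell_poly \<sigma> (a [^]\<^bsub>face_ring\<^esub> Suc m) * cell_poly \<sigma> a"
        using cell_poly_mult[OF R \<sigma> _ a, of "a [^]\<^bsub>face_ring\<^esub> Suc m"] a by simp
      then show ?case unfolding Suc by (simp only: power_Suc mult_ac)
    qed (use a in simp)
    have "cell_poly \<sigma> (\<zero>\<^bsub>face_ring\<^esub> :: 'x exponent \<Rightarrow> 'k) = 0"
      by (simp add: cell_poly_def cell_projection_def face_ring_simps)
    then have "cell_poly \<sigma> a ^ Suc n = 0" unfolding pow[symmetric] z' .
    then show "cell_poly \<sigma> a = 0" by (rule power_eq_0_real_space[OF k])
  qed
qed

definition face_monom :: "'x exponent \<Rightarrow> 'k::field \<Rightarrow> 'x exponent \<Rightarrow> 'k" where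
  "face_monom c t = (\<lambda>d. if d = c then t else 0)"

lemma empty_le: "cell_le T {} \<sigma>" by (simp add: cell_le_def)

lemma origin_class: "\<sigma> \<in> X \<Longrightarrow> cell_class {} 0 = cell_class \<sigma> 0"
  using cell_class_face[OF _ empty_cell empty_le monoid_zero[OF empty_cell], of \<sigma>]
    inj_zero[OF _ empty_cell empty_le, of \<sigma>] by simp

lemma face_monom_carrier: "\<sigma> \<in> X \<Longrightarrow> x \<in> M \<sigma> \<Longrightarrow> face_monom (cell_class \<sigma> x) t \<in> carrier face_ring"
  by (auto simp: face_ring_simps face_monom_def lim_set_eq)

lemma face_monom_mult:
  assumes \<sigma>: "\<sigma> \<in> X" "x \<in> M \<sigma>" "y \<in> M \<sigma>"
  shows "face_monom (cell_class \<sigma> x) s \<otimes>\<^bsub>face_ring\<^esub> face_monom (cell_class \<sigma> y) t = face_monom (cell_class \<sigma> (x + y)) (s * t)"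
proof
  fix c
  let ?S = "{(a, b). face_monom (cell_class \<sigma> x) s a \<noteq> 0 \<and> face_monom (cell_class \<sigma> y) t b \<noteq> 0 \<and> lim_sum T X \<iota> M a b c}"
  have "lim_sum T X \<iota> M (cell_class \<sigma> x) (cell_class \<sigma> y) c \<longleftrightarrow> c = cell_class \<sigma> (x + y)"
    by (rule iffI, rule lim_sum_unique[OF \<sigma>], assumption, simp only: lim_sum_cell[OF \<sigma>])
  then have "?S = (if c = cell_class \<sigma> (x + y) \<and> s \<noteq> 0 \<and> t \<noteq> 0 then {(cell_class \<sigma> x, cell_class \<sigma> y)} else {})"
    by (auto simp: face_monom_def split: if_splits)
  then have "(\<Sum>(a, b)\<in>?S. face_monom (cell_class \<sigma> x) s a * face_monom (cell_class \<sigma> y) t b) =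
    face_monom (cell_class \<sigma> (x + y)) (s * t) c"
    by (simp add: face_monom_def)
  then show "(face_monom (cell_class \<sigma> x) s \<otimes>\<^bsub>face_ring\<^esub> face_monom (cell_class \<sigma> y) t) c = face_monom (cell_class \<sigma> (x + y)) (s * t) c"
    by (simp only: face_ring_simps(2))
qed

text \<open>The ring is generated over the constants by the monomials of generators of the monoids M \<sigma>.\<close>

theorem face_ring_noetherian:
  assumes R: "cring (face_ring :: ('x exponent \<Rightarrow> 'k::field) ring)"
  shows "noetherian_ring (face_ring :: ('x exponent \<Rightarrow> 'k) ring)"
proof -
  interpret R: cring "face_ring :: ('x exponent \<Rightarrow> 'k) ring" by (rule R)
  define e where "e = cell_class {} 0"
  define K where "K = range (face_monom e :: 'k \<Rightarrow> _)"
  have e\<sigma>: "e = cell_class \<sigma> 0" if "\<sigma> \<in> X" for \<sigma> using origin_class[OF that] by (simp add: e_def)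
  have Kc: "face_monom e t \<in> carrier face_ring" for t :: 'k
    unfolding e_def by (rule face_monom_carrier[OF empty_cell monoid_zero[OF empty_cell]])
  have Km: "face_monom e s \<otimes>\<^bsub>face_ring\<^esub> face_monom e t = face_monom e (s * t)" for s t :: 'k
    using face_monom_mult[OF empty_cell monoid_zero[OF empty_cell] monoid_zero[OF empty_cell]]
    by (simp add: e_def)
  have Ka: "face_monom e s \<oplus>\<^bsub>face_ring\<^esub> face_monom e t = face_monom e (s + t)" for s t :: 'k
    by (auto simp: face_monom_def face_ring_simps)
  have K0: "face_monom e (0 :: 'k) = \<zero>\<^bsub>face_ring\<^esub>" by (auto simp: face_monom_def face_ring_simps)
  have Kn: "\<ominus>\<^bsub>face_ring\<^esub> face_monom e t = face_monom e (- t)" for t :: 'k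
    by (rule R.minus_equality) (use Kc Ka K0 in auto)
  have subK: "subring K face_ring"
  proof (rule R.subringI)
    have "face_monom e 1 = \<one>\<^bsub>face_ring\<^esub>" by (auto simp: face_monom_def face_ring_simps e_def)
    then show "\<one>\<^bsub>face_ring\<^esub> \<in> K" unfolding K_def by (rule range_eqI[OF sym])
  qed (use Kc Km Ka Kn in \<open>auto simp: K_def\<close>)
  have noethK: "R.noetherian_in K"
    unfolding R.noetherian_in_def
  proof (intro allI impI)
    fix J assume J: "R.ideal_in K J"
    show "\<exists>F\<subseteq>J. finite F \<and> (\<forall>L. R.ideal_in K L \<and> F \<subseteq> L \<longrightarrow> J \<subseteq> L)"
    proof (cases "J \<subseteq> {\<zero>\<^bsub>face_ring\<^esub>}")
      case True
      then show ?thesis by (intro exI[of _ "{}"]) (auto simp: R.ideal_in_def)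
    next
      case False
      then obtain y where y: "y \<in> J" "y \<noteq> \<zero>\<^bsub>face_ring\<^esub>" by blast
      then have "y \<in> range (face_monom e)" using J unfolding R.ideal_in_def K_def by blast
      then obtain t where yt: "y = face_monom e t" by blast
      have t: "face_monom e t \<in> J" "t \<noteq> 0" using y K0 by (auto simp: yt)
      have "J \<subseteq> L" if L: "R.ideal_in K L" "{face_monom e t} \<subseteq> L" for L
      proof
        fix z assume "z \<in> J"
        then obtain s where s: "z = face_monom e s" using J by (auto simp: R.ideal_in_def K_def)
        have "face_monom e (s / t) \<otimes>\<^bsub>face_ring\<^esub> face_monom e t \<in> L"
          using L unfolding R.ideal_in_def K_def by blast
        then show "z \<in> L" using t(2) by (simp add: s Km)
      qed
      then show ?thesis using t(1) by (intro exI[of _ "{face_monom e t}"]) auto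
    qed
  qed
  have "\<forall>\<sigma>. \<exists>G. \<sigma> \<in> X \<longrightarrow> finite G \<and> M \<sigma> = is_submonoid hull G"
    using monoid_fin_gen by (auto simp: fin_gen_submonoid_def)
  from choice[OF this] obtain G where
    "\<forall>\<sigma>. \<sigma> \<in> X \<longrightarrow> finite (G \<sigma>) \<and> M \<sigma> = is_submonoid hull G \<sigma>" ..
  then have G: "\<And>\<sigma>. \<sigma> \<in> X \<Longrightarrow> finite (G \<sigma>)" "\<And>\<sigma>. \<sigma> \<in> X \<Longrightarrow> M \<sigma> = is_submonoid hull G \<sigma>" by auto
  have GM: "G \<sigma> \<subseteq> M \<sigma>" if "\<sigma> \<in> X" for \<sigma> unfolding G(2)[OF that] by (rule hull_subset)
  define H where "H = (\<Union>\<sigma>\<in>X. (\<lambda>x. face_monom (cell_class \<sigma> x) (1 :: 'k)) ` G \<sigma>)"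
  show ?thesis
  proof (rule R.noetherian_ring_if_finitely_generated[OF _ _ subK noethK])
    show "finite H" using G(1) finite_cells by (auto simp: H_def)
    show "H \<subseteq> carrier face_ring" using GM face_monom_carrier by (fastforce simp: H_def)
    fix B assume B: "subring B face_ring" and KB: "K \<subseteq> B" and HB: "H \<subseteq> B"
    note Bc = subringE[OF B]
    have mon: "face_monom (cell_class \<sigma> x) 1 \<in> B" if \<sigma>: "\<sigma> \<in> X" and x: "x \<in> M \<sigma>" for \<sigma> x
    proof -
      have "is_submonoid {x \<in> M \<sigma>. face_monom (cell_class \<sigma> x) 1 \<in> B}"
        unfolding is_submonoid_def
      proof (intro conjI ballI)
        have "face_monom e 1 \<in> B" using KB by (auto simp: K_def)
        then show "0 \<in> {x \<in> M \<sigma>. face_monom (cell_class \<sigma> x) 1 \<in> B}"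
          using monoid_zero[OF \<sigma>] e\<sigma>[OF \<sigma>] by simp
        fix u v assume uv: "u \<in> {x \<in> M \<sigma>. face_monom (cell_class \<sigma> x) 1 \<in> B}" "v \<in> {x \<in> M \<sigma>. face_monom (cell_class \<sigma> x) 1 \<in> B}"
        then have "face_monom (cell_class \<sigma> u) 1 \<otimes>\<^bsub>face_ring\<^esub> face_monom (cell_class \<sigma> v) 1 \<in> B"
          using Bc(6) by simp
        then show "u + v \<in> {x \<in> M \<sigma>. face_monom (cell_class \<sigma> x) 1 \<in> B}"
          using uv face_monom_mult[OF \<sigma>, of u v "1 :: 'k" 1] monoid_add[OF \<sigma>] by simp
      qed
      moreover have "G \<sigma> \<subseteq> {x \<in> M \<sigma>. face_monom (cell_class \<sigma> x) 1 \<in> B}"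
        using GM[OF \<sigma>] HB \<sigma> by (auto simp: H_def)
      ultimately have "is_submonoid hull G \<sigma> \<subseteq> {x \<in> M \<sigma>. face_monom (cell_class \<sigma> x) 1 \<in> B}"
        by (intro hull_minimal)
      then show ?thesis using x G(2)[OF \<sigma>] by auto
    qed
    have terms: "face_monom a t \<in> B" if "a \<in> lim_set T X \<iota> M" for a and t :: 'k
    proof -
      obtain \<sigma> x
        where s: "\<sigma> \<in> X" "x \<in> M \<sigma>" "a = cell_class \<sigma> x" using \<open>a \<in> _\<close> by (auto simp: lim_set_eq)
      have "face_monom e t \<otimes>\<^bsub>face_ring\<^esub> face_monom a 1 \<in> B" 
        by (rule Bc(6)) (use KB mon[OF s(1,2)] s(3) in \<open>auto simp: K_def\<close>)
      moreover have "face_monom e t \<otimes>\<^bsub>face_ring\<^esub> face_monom a 1 = face_monom a t"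
        using face_monom_mult[OF s(1) monoid_zero[OF s(1)] s(2), of t 1] s(3) e\<sigma>[OF s(1)] by simp
      ultimately show ?thesis by simp
    qed
    have "f \<in> B"
      if "finite S" "S \<subseteq> lim_set T X \<iota> M" "{a. f a \<noteq> 0} \<subseteq> S" for S and f :: "'x exponent \<Rightarrow> 'k"
      using that
    proof (induction S arbitrary: f rule: finite_induct)
      case empty
      then have "f = \<zero>\<^bsub>face_ring\<^esub>" by (auto simp: face_ring_simps)
      then show ?case using Bc(2) by simp
    next
      case (insert a S)
      have "f(a := 0) \<in> B" by (rule insert.IH) (use insert in auto)
      moreover have "face_monom a (f a) \<in> B" using terms insert by simp
      moreover have "f = f(a := 0) \<oplus>\<^bsub>face_ring\<^esub> face_monom a (f a)"
        by (auto simp: face_ring_simps face_monom_def)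
      ultimately show ?case using Bc(7)[of "f(a := 0)" "face_monom a (f a)"] by simp
    qed
    then show "carrier face_ring \<subseteq> B" by (auto simp: face_ring_simps)
  qed
qed

end

section \<open>Seminormality in terms of squares and cubes\<close>

context cring
begin

lemma nonzerodivisors_closed: "s \<in> nonzerodivisors R \<Longrightarrow> s \<in> carrier R"
  by (simp add: nonzerodivisors_def)

lemma nonzerodivisors_cancel:
  assumes "s \<in> nonzerodivisors R" "x \<in> carrier R" "y \<in> carrier R" "x \<otimes> s = y \<otimes> s"
  shows "x = y"
proof -
  have s: "s \<in> carrier R" by (rule nonzerodivisors_closed[OF assms(1)])
  have "(x \<ominus> y) \<otimes> s = x \<otimes> s \<ominus> y \<otimes> s" using assms s by (simp add: minus_eq l_distr l_minus)
  also have "\<dots> = \<zero>" using assms s by (simp add: minus_eq r_neg)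
  finally have "x \<ominus> y = \<zero>" using assms unfolding nonzerodivisors_def by simp
  then show ?thesis using assms by simp
qed

lemma nonzerodivisors_mult:
  assumes "s \<in> nonzerodivisors R" "t \<in> nonzerodivisors R"
  shows "s \<otimes> t \<in> nonzerodivisors R"
proof -
  have c: "s \<in> carrier R" "t \<in> carrier R" using assms nonzerodivisors_closed by auto
  have "a = \<zero>" if "a \<in> carrier R" "a \<otimes> (s \<otimes> t) = \<zero>" for a
  proof -
    have "(a \<otimes> s) \<otimes> t = \<zero>" using that c by (simp add: m_assoc)
    then have "a \<otimes> s = \<zero>" using assms(2) that(1) c unfolding nonzerodivisors_def by simp
    then show ?thesis using assms(1) that(1) unfolding nonzerodivisors_def by simp
  qed
  then show ?thesis using c by (simp add: nonzerodivisors_def)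
qed

lemma one_nonzerodivisor: "\<one> \<in> nonzerodivisors R"
  by (simp add: nonzerodivisors_def)

lemma frac_subset:
  assumes "x \<in> carrier R" "a \<in> carrier R" "u \<in> nonzerodivisors R" "s \<in> nonzerodivisors R"
    and eq: "x \<otimes> s = a \<otimes> u"
  shows "frac R x u \<subseteq> frac R a s"
proof
  fix p assume "p \<in> frac R x u"
  then obtain b t where p: "p = (b, t)" "b \<in> carrier R" "t \<in> nonzerodivisors R" "b \<otimes> u = x \<otimes> t"
    by (auto simp: frac_def)
  have c: "u \<in> carrier R" "s \<in> carrier R" "t \<in> carrier R"
    using assms(3,4) p(3) by (simp_all add: nonzerodivisors_closed)
  have "(b \<otimes> s) \<otimes> u = (b \<otimes> u) \<otimes> s" using c p(2) by (simp add: m_ac)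
  also have "\<dots> = (x \<otimes> s) \<otimes> t" unfolding p(4) using c assms(1) by (simp add: m_ac)
  also have "\<dots> = (a \<otimes> t) \<otimes> u" unfolding eq using c assms(2) by (simp add: m_ac)
  finally have "b \<otimes> s = a \<otimes> t"
    by (rule nonzerodivisors_cancel[OF assms(3), rotated 2]) (use c p assms in auto)
  then show "p \<in> frac R a s" using p by (simp add: frac_def)
qed

lemma frac_eqI:
  assumes "x \<in> carrier R" "a \<in> carrier R" "u \<in> nonzerodivisors R" "s \<in> nonzerodivisors R"
    and eq: "x \<otimes> s = a \<otimes> u"
  shows "frac R x u = frac R a s"
  by (intro equalityI frac_subset assms sym[OF eq])

lemma frac_self: "a \<in> carrier R \<Longrightarrow> s \<in> nonzerodivisors R \<Longrightarrow> (a, s) \<in> frac R a s"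
  by (simp add: frac_def)

lemma frac_mult:
  assumes "a \<in> carrier R" "b \<in> carrier R" "s \<in> nonzerodivisors R" "t \<in> nonzerodivisors R"
  shows "frac R a s \<otimes>\<^bsub>total_quotient_ring R\<^esub> frac R b t = frac R (a \<otimes> b) (s \<otimes> t)"
proof -
  have c: "s \<in> carrier R" "t \<in> carrier R" using assms(3,4) by (simp_all add: nonzerodivisors_closed)
  have "frac R (x \<otimes> y) (u \<otimes> v) = frac R (a \<otimes> b) (s \<otimes> t)"
    if "(x, u) \<in> frac R a s" "(y, v) \<in> frac R b t" for x u y v
  proof (rule frac_eqI)
    have *: "x \<in> carrier R" "y \<in> carrier R" "u \<in> nonzerodivisors R" "v \<in> nonzerodivisors R"
      "x \<otimes> s = a \<otimes> u" "y \<otimes> t = b \<otimes> v" using that by (auto simp: frac_def)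
    have c': "u \<in> carrier R" "v \<in> carrier R" using *(3,4) by (simp_all add: nonzerodivisors_closed)
    have "(x \<otimes> y) \<otimes> (s \<otimes> t) = (x \<otimes> s) \<otimes> (y \<otimes> t)" using *(1,2) c by (simp add: m_ac)
    also have "\<dots> = (a \<otimes> b) \<otimes> (u \<otimes> v)" unfolding *(5,6) using assms(1,2) c' by (simp add: m_ac)
    finally show "(x \<otimes> y) \<otimes> (s \<otimes> t) = (a \<otimes> b) \<otimes> (u \<otimes> v)" .
    show "u \<otimes> v \<in> nonzerodivisors R" "s \<otimes> t \<in> nonzerodivisors R" "x \<otimes> y \<in> carrier R" "a \<otimes> b \<in> carrier R"
      using *(1-4) assms by (simp_all add: nonzerodivisors_mult)
  qed
  moreover have "frac R a s \<noteq> {}" "frac R b t \<noteq> {}" using frac_self assms by blast+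
  moreover have "frac R a s \<otimes>\<^bsub>total_quotient_ring R\<^esub> frac R b t =
      (\<Union>p\<in>frac R a s. \<Union>q\<in>frac R b t. frac R (fst p \<otimes> fst q) (snd p \<otimes> snd q))"
    by (simp add: total_quotient_ring_def case_prod_beta)
  ultimately show ?thesis by auto
qed

text \<open>A criterion without fractions. For q = a/s, the values b of q^2 and c of q^3 in R satisfy
  b^3 = c^2, because both sides become a^6 after multiplication by s^6.\<close>

lemma seminormalI:
  assumes red: "reduced_ring R" and noeth: "noetherian_ring R"
    and div: "\<And>a s b c. a \<in> carrier R \<Longrightarrow> s \<in> carrier R \<Longrightarrow> b \<in> carrier R \<Longrightarrow> c \<in> carrier R \<Longrightarrow>
      a \<otimes> a = b \<otimes> (s \<otimes> s) \<Longrightarrow> a \<otimes> (a \<otimes> a) = c \<otimes> (s \<otimes> (s \<otimes> s)) \<Longrightarrow>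
      b \<otimes> (b \<otimes> b) = c \<otimes> c \<Longrightarrow> \<exists>r\<in>carrier R. a = s \<otimes> r"
  shows "seminormal R"
proof -
  let ?Q = "total_quotient_ring R"
  have "q \<in> {frac R a \<one> | a. a \<in> carrier R}"
    if q: "q \<in> carrier ?Q" and q2: "q [^]\<^bsub>?Q\<^esub> (2::nat) \<in> {frac R a \<one> | a. a \<in> carrier R}"
      and q3: "q [^]\<^bsub>?Q\<^esub> (3::nat) \<in> {frac R a \<one> | a. a \<in> carrier R}" for q
  proof -
    obtain a s where a: "a \<in> carrier R" and s: "s \<in> nonzerodivisors R" and qa: "q = frac R a s"
      using q by (auto simp: total_quotient_ring_def)
    have sc: "s \<in> carrier R" by (rule nonzerodivisors_closed[OF s])
    note nz = nonzerodivisors_mult one_nonzerodivisor s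
    have p1: "q [^]\<^bsub>?Q\<^esub> (1::nat) = frac R a s"
    proof -
      have "q [^]\<^bsub>?Q\<^esub> (1::nat) = frac R \<one> \<one> \<otimes>\<^bsub>?Q\<^esub> frac R a s"
        by (simp add: nat_pow_def qa) (simp add: total_quotient_ring_def)
      then show ?thesis using frac_mult[OF one_closed a one_nonzerodivisor s] a sc by simp
    qed
    have p2: "q [^]\<^bsub>?Q\<^esub> (2::nat) = frac R (a \<otimes> a) (s \<otimes> s)"
    proof -
      have "q [^]\<^bsub>?Q\<^esub> (2::nat) = q [^]\<^bsub>?Q\<^esub> (1::nat) \<otimes>\<^bsub>?Q\<^esub> q"
        by (simp add: nat_pow_def numeral_2_eq_2)
      then show ?thesis unfolding p1 unfolding qa using frac_mult[OF a a s s] by simp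
    qed
    have p3: "q [^]\<^bsub>?Q\<^esub> (3::nat) = frac R (a \<otimes> a \<otimes> a) (s \<otimes> s \<otimes> s)"
    proof -
      have "q [^]\<^bsub>?Q\<^esub> (3::nat) = q [^]\<^bsub>?Q\<^esub> (2::nat) \<otimes>\<^bsub>?Q\<^esub> q"
        by (simp add: nat_pow_def numeral_2_eq_2 numeral_3_eq_3)
      then show ?thesis unfolding p2 unfolding qa
        using frac_mult[OF m_closed[OF a a] a nonzerodivisors_mult[OF s s] s] by simp
    qed
    obtain b where b: "b \<in> carrier R" "frac R (a \<otimes> a) (s \<otimes> s) = frac R b \<one>"
      using q2 unfolding p2 by blast
    obtain c where c: "c \<in> carrier R" "frac R (a \<otimes> a \<otimes> a) (s \<otimes> s \<otimes> s) = frac R c \<one>"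
      using q3 unfolding p3 by blast
    have "(a \<otimes> a, s \<otimes> s) \<in> frac R b \<one>" unfolding b(2)[symmetric] by (intro frac_self m_closed a nz)
    then have ab: "a \<otimes> a = b \<otimes> (s \<otimes> s)" using a by (simp add: frac_def)
    have "(a \<otimes> a \<otimes> a, s \<otimes> s \<otimes> s) \<in> frac R c \<one>"
      unfolding c(2)[symmetric] by (intro frac_self m_closed a nz)
    then have ac: "a \<otimes> a \<otimes> a = c \<otimes> (s \<otimes> s \<otimes> s)" using a by (simp add: frac_def)
    have "(b \<otimes> b \<otimes> b) \<otimes> ((s \<otimes> s \<otimes> s) \<otimes> (s \<otimes> s \<otimes> s)) =
        (b \<otimes> (s \<otimes> s)) \<otimes> (b \<otimes> (s \<otimes> s)) \<otimes> (b \<otimes> (s \<otimes> s))"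
      using b(1) sc by (simp add: m_ac)
    also have "\<dots> = (a \<otimes> a \<otimes> a) \<otimes> (a \<otimes> a \<otimes> a)"
      unfolding ab[symmetric] using a by (simp add: m_ac)
    also have "\<dots> = (c \<otimes> c) \<otimes> ((s \<otimes> s \<otimes> s) \<otimes> (s \<otimes> s \<otimes> s))"
      unfolding ac using c(1) sc by (simp add: m_ac)
    finally have bc: "b \<otimes> b \<otimes> b = c \<otimes> c"
      by (rule nonzerodivisors_cancel[rotated 3]) (intro nz m_closed b c)+
    obtain r where r: "r \<in> carrier R" "a = s \<otimes> r"
      using div[OF a sc b(1) c(1) ab, folded m_assoc[OF a a a] m_assoc[OF sc sc sc]
          m_assoc[OF b(1) b(1) b(1)], OF ac bc] by blast
    have "frac R a s = frac R r \<one>"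
      by (rule frac_eqI) (use r a s sc one_nonzerodivisor in \<open>auto simp: m_comm\<close>)
    then show ?thesis unfolding qa using r(1) by blast
  qed
  then show ?thesis using red noeth is_cring by (simp add: seminormal_def Let_def)
qed

end


section \<open>Roots in the normalizations\<close>

context monoidal_complex
begin

lemma monoid_group:
  assumes \<sigma>: "\<sigma> \<in> X"
  shows "is_subgroup (is_subgroup hull M \<sigma>)" "is_subgroup hull M \<sigma> \<subseteq> cell_lattice T \<sigma>"
proof -
  show "is_subgroup (is_subgroup hull M \<sigma>)" by (rule hull_in) (auto simp: is_subgroup_def)
  show "is_subgroup hull M \<sigma> \<subseteq> cell_lattice T \<sigma>"
    by (rule hull_minimal)
      (use monoid_subset[OF \<sigma>] in \<open>auto simp: is_subgroup_def int_lattice_def real_space_def\<close>)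
qed

lemma normal_monoid_facts:
  assumes \<sigma>: "\<sigma> \<in> X"
  shows "is_submonoid (normal_monoid C M \<sigma>)" "M \<sigma> \<subseteq> normal_monoid C M \<sigma>"
    "normal_monoid C M \<sigma> \<subseteq> C \<sigma>" "normal_monoid C M \<sigma> \<subseteq> cell_space T \<sigma>"
proof -
  show "is_submonoid (normal_monoid C M \<sigma>)"
    unfolding normal_monoid_def
    by (rule normal_monoid_submonoid(1)[OF monoid_group[OF \<sigma>] cone_polyhedral[OF \<sigma>]])
  show "M \<sigma> \<subseteq> normal_monoid C M \<sigma>"
    using hull_subset[of "M \<sigma>" is_subgroup] monoid_subset[OF \<sigma>] by (auto simp: normal_monoid_def)
  show "normal_monoid C M \<sigma> \<subseteq> C \<sigma>" by (auto simp: normal_monoid_def)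
  then show "normal_monoid C M \<sigma> \<subseteq> cell_space T \<sigma>" using cone_space[OF \<sigma>] by (rule subset_trans)
qed

lemma normal_monoid_diff:
  assumes "\<sigma> \<in> X" "x \<in> normal_monoid C M \<sigma>" "y \<in> normal_monoid C M \<sigma>" "x - y \<in> C \<sigma>"
  shows "x - y \<in> normal_monoid C M \<sigma>"
  using assms monoid_group(1)[OF assms(1)] by (auto simp: normal_monoid_def is_subgroup_def)

text \<open>If b^3 = c^2, this is the element c/b of the normalization of k[M \<sigma>], or 0 if b vanishes on
  the cell.\<close>

definition is_cell_root :: "'x set \<Rightarrow> ('x exponent \<Rightarrow> 'k::field) \<Rightarrow> ('x exponent \<Rightarrow> 'k) \<Rightarrow> 'k poly_fun \<Rightarrow> bool" where
  "is_cell_root \<sigma> b c q \<longleftrightarrow> q \<in> keys_in (normal_monoid C M \<sigma>) \<and> q ^ 2 = cell_poly \<sigma> b \<and> q ^ 3 = cell_poly \<sigma> c"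

text \<open>The fraction c/b has the square b, so it lies in the normal ring.\<close>

lemma cell_root_exists:
  fixes b c :: "'x exponent \<Rightarrow> 'k::field"
  assumes R: "cring (face_ring :: ('x exponent \<Rightarrow> 'k) ring)" and \<sigma>: "\<sigma> \<in> X"
    and b: "b \<in> carrier face_ring" and c: "c \<in> carrier face_ring"
    and bc: "b \<otimes>\<^bsub>face_ring\<^esub> (b \<otimes>\<^bsub>face_ring\<^esub> b) = c \<otimes>\<^bsub>face_ring\<^esub> c"
  shows "\<exists>q. is_cell_root \<sigma> b c q"
proof -
  interpret R: cring "face_ring :: ('x exponent \<Rightarrow> 'k) ring" by (rule R)
  let ?b = "cell_poly \<sigma> b" and ?c = "cell_poly \<sigma> c" and ?N = "normal_monoid C M \<sigma>"
  note N = normal_monoid_facts[OF \<sigma>]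
  have eq: "?b * (?b * ?b) = ?c * ?c"
    using arg_cong[OF bc, of "cell_poly \<sigma>"] b c by (simp add: cell_poly_mult[OF R \<sigma>])
  have bN: "?b \<in> keys_in ?N" and cN: "?c \<in> keys_in ?N"
    using cell_poly_keys[OF b \<sigma>] cell_poly_keys[OF c \<sigma>] keys_in_mono[OF N(2)] by auto
  note sp = subsetD[OF keys_in_mono[OF N(4)]]
  show ?thesis
  proof (cases "?b = 0")
    case True
    then have "?c ^ 2 = 0" using eq by (simp add: power2_eq_square)
    then have "?c = 0" by (rule power_eq_0_real_space[OF sp[OF cN]])
    then show ?thesis using True by (intro exI[of _ 0]) (simp add: is_cell_root_def keys_in_zero)
  next
    case False
    have "?c ^ 2 = ?b * ?b ^ 2" using eq by (simp add: power2_eq_square)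
    from normal_monoid_ring_root_closed[OF monoid_group[OF \<sigma>] cone_polyhedral[OF \<sigma>],
        folded normal_monoid_def, OF cN bN bN False this]
    obtain q where q: "q \<in> keys_in ?N" "?c = q * ?b" by blast
    have "(q * q - ?b) * (?b * ?b) = 0"
      using eq unfolding q(2) by (simp add: algebra_simps)
    then have "q * q - ?b = 0 \<or> ?b * ?b = 0"
      by (rule mult_eq_0_real_space[OF sp[OF keys_in_diff[OF keys_in_mult[OF N(1) q(1) q(1)] bN]]
            sp[OF keys_in_mult[OF N(1) bN bN]]])
    moreover have "?b * ?b \<noteq> 0"
      using mult_eq_0_real_space[OF sp[OF bN] sp[OF bN]] False by blast
    ultimately have "q * q = ?b" by (simp only: right_minus_eq simp_thms)
    then have "q ^ 2 = ?b" "q ^ 3 = ?c"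
      using q(2) by (simp_all add: power2_eq_square power3_eq_cube mult.assoc)
    then show ?thesis using q(1) by (auto simp: is_cell_root_def)
  qed
qed

text \<open>Both sides have the same square and the same cube. This covers cells on which s vanishes,
  where q is not a quotient of the images of a and s.\<close>

lemma cell_root_mult:
  fixes a b c s :: "'x exponent \<Rightarrow> 'k::field"
  assumes R: "cring (face_ring :: ('x exponent \<Rightarrow> 'k) ring)" and \<sigma>: "\<sigma> \<in> X"
    and car: "a \<in> carrier face_ring" "s \<in> carrier face_ring" "b \<in> carrier face_ring" "c \<in> carrier face_ring"
    and 2: "a \<otimes>\<^bsub>face_ring\<^esub> a = b \<otimes>\<^bsub>face_ring\<^esub> (s \<otimes>\<^bsub>face_ring\<^esub> s)"
    and 3: "a \<otimes>\<^bsub>face_ring\<^esub> (a \<otimes>\<^bsub>face_ring\<^esub> a) = c \<otimes>\<^bsub>face_ring\<^esub> (s \<otimes>\<^bsub>face_ring\<^esub> (s \<otimes>\<^bsub>face_ring\<^esub> s))"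
    and q: "is_cell_root \<sigma> b c q"
  shows "cell_poly \<sigma> s * q = cell_poly \<sigma> a"
proof (rule square_cube_unique)
  interpret R: cring "face_ring :: ('x exponent \<Rightarrow> 'k) ring" by (rule R)
  let ?\<phi> = "cell_poly \<sigma>"
  note N = normal_monoid_facts[OF \<sigma>]
  have q': "q \<in> keys_in (normal_monoid C M \<sigma>)" "q ^ 2 = ?\<phi> b" "q ^ 3 = ?\<phi> c"
    using q by (auto simp: is_cell_root_def)
  have N': "?\<phi> r \<in> keys_in (normal_monoid C M \<sigma>)"
    if "r \<in> carrier face_ring" for r :: "'x exponent \<Rightarrow> 'k"
    by (rule subsetD[OF keys_in_mono[OF N(2)] cell_poly_keys[OF that \<sigma>]])
  note sp = subsetD[OF keys_in_mono[OF N(4)]]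
  show "?\<phi> s * q \<in> keys_in (cell_space T \<sigma>)"
    by (rule sp[OF keys_in_mult[OF N(1) N'[OF car(2)] q'(1)]])
  show "?\<phi> a \<in> keys_in (cell_space T \<sigma>)" by (rule sp[OF N'[OF car(1)]])
  have "?\<phi> a * ?\<phi> a = ?\<phi> b * (?\<phi> s * ?\<phi> s)"
    using arg_cong[OF 2, of ?\<phi>] car by (simp add: cell_poly_mult[OF R \<sigma>])
  then show "(?\<phi> s * q) ^ 2 = ?\<phi> a ^ 2"
    unfolding power_mult_distrib q'(2) by (simp add: power2_eq_square mult_ac)
  have "?\<phi> a * (?\<phi> a * ?\<phi> a) = ?\<phi> c * (?\<phi> s * (?\<phi> s * ?\<phi> s))"
    using arg_cong[OF 3, of ?\<phi>] car by (simp add: cell_poly_mult[OF R \<sigma>])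
  then show "(?\<phi> s * q) ^ 3 = ?\<phi> a ^ 3"
    unfolding power_mult_distrib q'(3) by (simp add: power3_eq_cube mult_ac)
qed

text \<open>Restriction of f to the exponents in the face of \<tau>, transported to the cone of \<tau>.\<close>

definition pull :: "'x set \<Rightarrow> 'x set \<Rightarrow> 'k::field poly_fun \<Rightarrow> 'k poly_fun" where
  "pull \<sigma> \<tau> f = Abs_poly_mapping (\<lambda>c. if c \<in> C \<tau> then lookup f (\<iota> \<sigma> \<tau> c) else 0)"

context
  fixes \<sigma> \<tau>
  assumes \<sigma>: "\<sigma> \<in> X" and \<tau>: "\<tau> \<in> X" and le: "cell_le T \<tau> \<sigma>"
begin

lemma lookup_pull: "lookup (pull \<sigma> \<tau> f) c = (if c \<in> C \<tau> then lookup f (\<iota> \<sigma> \<tau> c) else 0)"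
proof -
  have "finite (\<iota> \<sigma> \<tau> ` {c. (if c \<in> C \<tau> then lookup f (\<iota> \<sigma> \<tau> c) else 0) \<noteq> 0})"
    by (rule finite_subset[OF _ finite_keys[of f]]) (auto simp: in_keys_iff split: if_splits)
  moreover have "inj_on (\<iota> \<sigma> \<tau>) {c. (if c \<in> C \<tau> then lookup f (\<iota> \<sigma> \<tau> c) else 0) \<noteq> 0}"
    by (rule inj_on_subset[OF inj_injective[OF \<sigma> \<tau> le]]) (auto split: if_splits)
  ultimately have "finite {c. (if c \<in> C \<tau> then lookup f (\<iota> \<sigma> \<tau> c) else 0) \<noteq> 0}"
    by (rule finite_imageD)
  then show ?thesis by (simp add: pull_def)
qed

lemma pull_keys: "pull \<sigma> \<tau> f \<in> keys_in (C \<tau>)"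
  by (auto simp: keys_in_def in_keys_iff lookup_pull split: if_splits)

text \<open>Exponents in a face decompose only inside the face.\<close>

lemma pull_mult:
  fixes f g :: "'a::field poly_fun"
  assumes f: "f \<in> keys_in (C \<sigma>)" and g: "g \<in> keys_in (C \<sigma>)"
  shows "pull \<sigma> \<tau> (f * g) = pull \<sigma> \<tau> f * pull \<sigma> \<tau> g"
proof (rule poly_mapping_eqI)
  fix c
  have fC: "u \<in> C \<sigma>" if "lookup f u \<noteq> 0" for u using f that by (auto simp: keys_in_def in_keys_iff)
  have gC: "u \<in> C \<sigma>" if "lookup g u \<noteq> 0" for u using g that by (auto simp: keys_in_def in_keys_iff)
  show "lookup (pull \<sigma> \<tau> (f * g)) c = lookup (pull \<sigma> \<tau> f * pull \<sigma> \<tau> g) c"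
  proof (cases "c \<in> C \<tau>")
    case False
    have "is_submonoid (C \<tau>)" using cone_zero[OF \<tau>] cone_add[OF \<tau>] by (auto simp: is_submonoid_def)
    then have "pull \<sigma> \<tau> f * pull \<sigma> \<tau> g \<in> keys_in (C \<tau>)" by (intro keys_in_mult pull_keys)
    then have "lookup (pull \<sigma> \<tau> f * pull \<sigma> \<tau> g) c = 0"
      using False unfolding keys_in_def by (simp add: subset_iff in_keys_iff) blast
    then show ?thesis using False by (simp add: lookup_pull)
  next
    case c: True
    have nz: "lookup (pull \<sigma> \<tau> h) u \<noteq> 0 \<longleftrightarrow> u \<in> C \<tau> \<and> lookup h (\<iota> \<sigma> \<tau> u) \<noteq> 0" for h :: "'a poly_fun" and u
      by (simp add: lookup_pull)
    let ?A = "{(u, v). lookup (pull \<sigma> \<tau> f) u \<noteq> 0 \<and> lookup (pull \<sigma> \<tau> g) v \<noteq> 0 \<and> u + v = c}"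
    let ?B = "{(u, v). lookup f u \<noteq> 0 \<and> lookup g v \<noteq> 0 \<and> u + v = \<iota> \<sigma> \<tau> c}"
    let ?j = "\<lambda>(u, v). (\<iota> \<sigma> \<tau> u, \<iota> \<sigma> \<tau> v)"
    have "bij_betw ?j ?A ?B"
    proof (rule bij_betwI')
      show "?j p = ?j p' \<longleftrightarrow> p = p'" if "p \<in> ?A" "p' \<in> ?A" for p p'
        using that by (cases p; cases p') (simp add: nz inj_eq[OF \<sigma> \<tau> le])
      show "?j p \<in> ?B" if "p \<in> ?A" for p
        using that inj_add[OF \<sigma> \<tau> le, of "fst p" "snd p"] by (cases p) (simp add: nz)
      show "\<exists>p\<in>?A. p' = ?j p" if p': "p' \<in> ?B" for p'
      proof -
        obtain u v where uv: "p' = (u, v)" "lookup f u \<noteq> 0" "lookup g v \<noteq> 0" "u + v = \<iota> \<sigma> \<tau> c"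
          using p' by auto
        obtain u' v' where "u' \<in> C \<tau>" "v' \<in> C \<tau>" "u = \<iota> \<sigma> \<tau> u'" "v = \<iota> \<sigma> \<tau> v'" "u' + v' = c"
          by (rule face_summands[OF \<sigma> \<tau> le fC[OF uv(2)] gC[OF uv(3)] c uv(4)])
        then show ?thesis using uv(1-3) by (intro bexI[of _ "(u', v')"]) (simp_all add: nz)
      qed
    qed
    then have "(\<Sum>(u, v)\<in>?B. lookup f u * lookup g v) =
      (\<Sum>p\<in>?A. case ?j p of (u, v) \<Rightarrow> lookup f u * lookup g v)"
      by (rule sum.reindex_bij_betw[symmetric])
    also have "\<dots> = (\<Sum>(u, v)\<in>?A. lookup (pull \<sigma> \<tau> f) u * lookup (pull \<sigma> \<tau> g) v)"
    proof (rule sum.cong[OF refl])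
      fix p assume "p \<in> ?A"
      then show "(case ?j p of (u, v) \<Rightarrow> lookup f u * lookup g v) =
          (case p of (u, v) \<Rightarrow> lookup (pull \<sigma> \<tau> f) u * lookup (pull \<sigma> \<tau> g) v)"
        by (cases p) (simp add: nz, simp add: lookup_pull)
    qed
    finally show ?thesis
      using c by (simp add: lookup_pull lookup_times_sum[of f g] lookup_times_sum[of "pull \<sigma> \<tau> f"])
  qed
qed

lemma pull_cell_poly:
  assumes r: "r \<in> carrier face_ring"
  shows "pull \<sigma> \<tau> (cell_poly \<sigma> r) = cell_poly \<tau> r"
proof (rule poly_mapping_eqI)
  fix c
  have MC: "c \<in> C \<tau>" if "c \<in> M \<tau>" using monoid_in_cone[OF \<tau> that] .
  show "lookup (pull \<sigma> \<tau> (cell_poly \<sigma> r)) c = lookup (cell_poly \<tau> r) c"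
    using inj_monoid_iff[OF \<sigma> \<tau> le] cell_class_face[OF \<sigma> \<tau> le] MC
    by (auto simp: lookup_pull lookup_cell_poly[OF r \<sigma>] lookup_cell_poly[OF r \<tau>] cell_projection_def)
qed

text \<open>By uniqueness of roots: the restriction of q has the square and the cube of q'. In
  particular its exponents lie in the group generated by M \<tau>.\<close>

lemma pull_cell_root:
  assumes bc: "b \<in> carrier face_ring" "c \<in> carrier face_ring"
    and q: "is_cell_root \<sigma> b c q" and q': "is_cell_root \<tau> b c q'"
  shows "pull \<sigma> \<tau> q = q'"
proof (rule square_cube_unique)
  show "pull \<sigma> \<tau> q \<in> keys_in (cell_space T \<tau>)"
    by (rule subsetD[OF keys_in_mono[OF cone_space[OF \<tau>]] pull_keys])
  show "q' \<in> keys_in (cell_space T \<tau>)"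
    using q' subsetD[OF keys_in_mono[OF normal_monoid_facts(4)[OF \<tau>]]]
    by (auto simp: is_cell_root_def)
  have qC: "q \<in> keys_in (C \<sigma>)"
    using q subsetD[OF keys_in_mono[OF normal_monoid_facts(3)[OF \<sigma>]]]
    by (auto simp: is_cell_root_def)
  have "is_submonoid (C \<sigma>)" using cone_zero[OF \<sigma>] cone_add[OF \<sigma>] by (auto simp: is_submonoid_def)
  then have qqC: "q * q \<in> keys_in (C \<sigma>)" using qC by (intro keys_in_mult)
  have "pull \<sigma> \<tau> (q ^ 2) = pull \<sigma> \<tau> q ^ 2" unfolding power2_eq_square by (rule pull_mult[OF qC qC])
  then show "pull \<sigma> \<tau> q ^ 2 = q' ^ 2" using q q' bc by (simp add: is_cell_root_def pull_cell_poly)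
  have "pull \<sigma> \<tau> (q ^ 3) = pull \<sigma> \<tau> q ^ 3"
    unfolding power3_eq_cube pull_mult[OF qqC qC] pull_mult[OF qC qC] ..
  then show "pull \<sigma> \<tau> q ^ 3 = q' ^ 3" using q q' bc by (simp add: is_cell_root_def pull_cell_poly)
qed

text \<open>In general the projection to the face of \<tau> is not multiplicative, because it drops the
  exponents outside the group generated by M \<tau>, and such exponents may add up to one inside. But
  all exponents of q in the face belong to this group, so multiplying by q does not mix exponents
  inside and outside of it.\<close>

lemma face_projection_root_mult:
  assumes bc: "b \<in> carrier face_ring" "c \<in> carrier face_ring"
    and q: "is_cell_root \<sigma> b c q" and q': "is_cell_root \<tau> b c q'"
    and y: "y \<in> keys_in (normal_monoid C M \<sigma>)"
    and z: "lookup z = face_projection C \<iota> M \<tau> \<sigma> (lookup y)"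
  shows "face_projection C \<iota> M \<tau> \<sigma> (lookup (q * y)) = lookup (q' * z)"
proof
  fix x
  let ?N = "normal_monoid C M \<tau>"
  note N = normal_monoid_facts[OF \<tau>]
  have q'N: "q' \<in> keys_in ?N" using q' by (simp add: is_cell_root_def)
  have zN: "z \<in> keys_in ?N"
    by (auto simp: keys_in_def in_keys_iff z face_projection_def split: if_splits)
  have C\<sigma>: "q \<in> keys_in (C \<sigma>)" "y \<in> keys_in (C \<sigma>)"
    using q y subsetD[OF keys_in_mono[OF normal_monoid_facts(3)[OF \<sigma>]]]
    by (auto simp: is_cell_root_def)
  show "face_projection C \<iota> M \<tau> \<sigma> (lookup (q * y)) x = lookup (q' * z) x"
  proof (cases "x \<in> ?N")
    case False
    then have "lookup (q' * z) x = 0"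
      using keys_in_mult[OF N(1) q'N zN] by (auto simp: keys_in_def in_keys_iff)
    then show ?thesis using False by (simp add: face_projection_def)
  next
    case x: True
    then have xC: "x \<in> C \<tau>" using N(3) by auto
    have "face_projection C \<iota> M \<tau> \<sigma> (lookup (q * y)) x = lookup (pull \<sigma> \<tau> (q * y)) x"
      using x xC by (simp add: face_projection_def lookup_pull)
    also have "\<dots> = lookup (q' * pull \<sigma> \<tau> y) x"
      unfolding pull_mult[OF C\<sigma>] pull_cell_root[OF bc q q'] ..
    also have "\<dots> = lookup (q' * z) x"
    proof -
      have eq: "lookup (pull \<sigma> \<tau> y) v = lookup z v" if "lookup q' u \<noteq> 0" "u + v = x" for u v
      proof (cases "v \<in> C \<tau>")
        case True
        have "u \<in> ?N" using q'N that by (auto simp: keys_in_def in_keys_iff)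
        moreover have v: "v = x - u" using that by auto
        ultimately have "v \<in> ?N" using normal_monoid_diff[OF \<tau> x, of u] True by simp
        then show ?thesis using True by (simp add: lookup_pull z face_projection_def)
      next
        case False
        then have "v \<notin> ?N" using N(3) by auto
        then show ?thesis using False by (simp add: lookup_pull z face_projection_def)
      qed
      show ?thesis
        unfolding lookup_times_sum by (rule sum.cong) (auto simp: eq)
    qed
    finally show ?thesis .
  qed
qed

end

end

section \<open>The action of a root on the complex of normalizations\<close>

lemma semigroup_ring_simps:
  "carrier (semigroup_ring S) = {f. finite {a. f a \<noteq> 0} \<and> {a. f a \<noteq> 0} \<subseteq> S}"
  "f \<otimes>\<^bsub>semigroup_ring S\<^esub> g = (\<lambda>c. \<Sum>(a, b) \<in> {(a, b). f a \<noteq> 0 \<and> g b \<noteq> 0 \<and> a + b = c}. f a * g b)"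
  "\<zero>\<^bsub>semigroup_ring S\<^esub> = (\<lambda>c. 0)"
  "f \<oplus>\<^bsub>semigroup_ring S\<^esub> g = (\<lambda>c. f c + g c)"
  by (simp_all add: semigroup_ring_def)

lemma lookup_scalar_mult:
  fixes f :: "'k::field poly_fun"
  shows "lookup (single 0 t * f) c = t * lookup f c"
proof -
  have "{(u, v). lookup (single 0 t) u \<noteq> 0 \<and> lookup f v \<noteq> 0 \<and> u + v = c} =
    (if t \<noteq> 0 \<and> lookup f c \<noteq> 0 then {(0, c)} else {})"
    by (auto simp: lookup_single when_def split: if_splits)
  then show ?thesis unfolding lookup_times_sum by simp
qed

context monoidal_complex
begin

abbreviation norm_module :: "'x set \<Rightarrow> ('x exponent \<Rightarrow> 'k::field, (nat \<Rightarrow> real) \<Rightarrow> 'k) module" where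
  "norm_module \<equiv> normalization_module T X C \<iota> M"

lemma norm_module_simps:
  "carrier (norm_module \<sigma>) = {f. finite {a. f a \<noteq> 0} \<and> {a. f a \<noteq> 0} \<subseteq> normal_monoid C M \<sigma>}"
  "f \<oplus>\<^bsub>norm_module \<sigma>\<^esub> g = (\<lambda>c. f c + g c)"
  "\<zero>\<^bsub>norm_module \<sigma>\<^esub> = (\<lambda>c. 0)"
  "r \<odot>\<^bsub>norm_module \<sigma>\<^esub> f = (\<lambda>c. \<Sum>(a, b) \<in> {(a, b). cell_projection T X \<iota> M \<sigma> r a \<noteq> 0 \<and> f b \<noteq> 0 \<and> a + b = c}.
    cell_projection T X \<iota> M \<sigma> r a * f b)"
  by (simp_all add: normalization_module_def Let_def semigroup_ring_simps)

lemma norm_module_lookup: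
  fixes p :: "'k::field poly_fun"
  shows "p \<in> keys_in (normal_monoid C M \<sigma>) \<Longrightarrow> lookup p \<in> carrier (norm_module \<sigma>)"
  by (simp add: norm_module_simps(1) keys_in_def subset_iff in_keys_iff)

lemma norm_module_Abs:
  fixes f :: "(nat \<Rightarrow> real) \<Rightarrow> 'k::field"
  assumes "f \<in> carrier (norm_module \<sigma>)"
  shows "lookup (Abs_poly_mapping f) = f" "Abs_poly_mapping f \<in> keys_in (normal_monoid C M \<sigma>)"
proof -
  show l: "lookup (Abs_poly_mapping f) = f" using assms by (simp add: norm_module_simps(1))
  show "Abs_poly_mapping f \<in> keys_in (normal_monoid C M \<sigma>)"
    using assms by (simp add: norm_module_simps(1) keys_in_def subset_iff in_keys_iff l)
qed

lemma norm_module_smult: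
  assumes "r \<in> carrier face_ring" "\<sigma> \<in> X"
  shows "r \<odot>\<^bsub>norm_module \<sigma>\<^esub> lookup p = lookup (cell_poly \<sigma> r * p)"
  by (rule ext) (simp only: norm_module_simps(4) lookup_times_sum lookup_cell_poly[OF assms])

definition cells_in_degree :: "int \<Rightarrow> 'x set set" where
  "cells_in_degree j = {\<sigma> \<in> X. cell_dim T \<sigma> = - j - 1}"

lemma cells_in_degreeD: "\<sigma> \<in> cells_in_degree j \<Longrightarrow> \<sigma> \<in> X"
  by (simp add: cells_in_degree_def)

abbreviation plus_complex ::
    "('x set \<Rightarrow> 'x set \<Rightarrow> int) \<Rightarrow> ('x exponent \<Rightarrow> 'k::field, 'x set \<Rightarrow> (nat \<Rightarrow> real) \<Rightarrow> 'k) cochain" where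
  "plus_complex \<equiv> plus_I T X C \<iota> M"

lemma plus_complex_simps:
  fixes \<epsilon> :: "'x set \<Rightarrow> 'x set \<Rightarrow> int"
  defines "Y \<equiv> (plus_complex \<epsilon> :: ('x exponent \<Rightarrow> 'k::field, 'x set \<Rightarrow> (nat \<Rightarrow> real) \<Rightarrow> 'k) cochain)"
  shows "carrier (obj Y j) = (\<Pi>\<^sub>E \<sigma>\<in>cells_in_degree j. carrier (norm_module \<sigma>))"
    and "y \<oplus>\<^bsub>obj Y j\<^esub> z = (\<lambda>\<sigma>\<in>cells_in_degree j. y \<sigma> \<oplus>\<^bsub>norm_module \<sigma>\<^esub> z \<sigma>)"
    and "r \<odot>\<^bsub>obj Y j\<^esub> y = (\<lambda>\<sigma>\<in>cells_in_degree j. r \<odot>\<^bsub>norm_module \<sigma>\<^esub> y \<sigma>)"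
    and "diff Y j y = (\<lambda>\<tau>\<in>cells_in_degree (j + 1). \<lambda>c.
       \<Sum>\<sigma> \<in> {\<sigma> \<in> cells_in_degree j. cell_le T \<tau> \<sigma>}. of_int (\<epsilon> \<sigma> \<tau>) * face_projection C \<iota> M \<tau> \<sigma> (y \<sigma>) c)"
proof -
  have "finite (cells_in_degree j)" using finite_cells by (simp add: cells_in_degree_def)
  then have "finite {i \<in> cells_in_degree j. P i}" for P by simp
  then show "carrier (obj Y j) = (\<Pi>\<^sub>E \<sigma>\<in>cells_in_degree j. carrier (norm_module \<sigma>))"
    by (simp add: Y_def plus_I_def direct_sum_def flip: cells_in_degree_def)
  show "y \<oplus>\<^bsub>obj Y j\<^esub> z = (\<lambda>\<sigma>\<in>cells_in_degree j. y \<sigma> \<oplus>\<^bsub>norm_module \<sigma>\<^esub> z \<sigma>)"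
    "r \<odot>\<^bsub>obj Y j\<^esub> y = (\<lambda>\<sigma>\<in>cells_in_degree j. r \<odot>\<^bsub>norm_module \<sigma>\<^esub> y \<sigma>)"
    by (simp_all add: Y_def plus_I_def direct_sum_def flip: cells_in_degree_def)
  have "{\<tau> \<in> X. cell_dim T \<tau> = - j - 2} = cells_in_degree (j + 1)"
    "{\<sigma> \<in> X. cell_dim T \<sigma> = - j - 1 \<and> cell_le T \<tau> \<sigma>} = {\<sigma> \<in> cells_in_degree j. cell_le T \<tau> \<sigma>}" for \<tau>
    by (auto simp: cells_in_degree_def)
  then show "diff Y j y = (\<lambda>\<tau>\<in>cells_in_degree (j + 1). \<lambda>c.
       \<Sum>\<sigma> \<in> {\<sigma> \<in> cells_in_degree j. cell_le T \<tau> \<sigma>}. of_int (\<epsilon> \<sigma> \<tau>) * face_projection C \<iota> M \<tau> \<sigma> (y \<sigma>) c)"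
    by (simp add: Y_def plus_I_def)
qed

text \<open>The components of y are coefficient functions of finite support, and \<open>Abs_poly_mapping\<close>
  turns them into polynomials, which can be multiplied.\<close>

definition root_action :: "('x set \<Rightarrow> 'k::field poly_fun) \<Rightarrow> int \<Rightarrow>
    ('x set \<Rightarrow> (nat \<Rightarrow> real) \<Rightarrow> 'k) \<Rightarrow> 'x set \<Rightarrow> (nat \<Rightarrow> real) \<Rightarrow> 'k" where
  "root_action q j y = (\<lambda>\<sigma>\<in>cells_in_degree j. lookup (q \<sigma> * Abs_poly_mapping (y \<sigma>)))"

context
  fixes \<epsilon> :: "'x set \<Rightarrow> 'x set \<Rightarrow> int" and b c :: "'x exponent \<Rightarrow> 'k::field" and q :: "'x set \<Rightarrow> 'k poly_fun"
    and Y :: "('x exponent \<Rightarrow> 'k, 'x set \<Rightarrow> (nat \<Rightarrow> real) \<Rightarrow> 'k) cochain"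
  assumes Y: "Y = plus_complex \<epsilon>" and Yc: "cochain_complex face_ring Y"
    and bc: "b \<in> carrier face_ring" "c \<in> carrier face_ring"
    and q: "\<And>\<sigma>. \<sigma> \<in> X \<Longrightarrow> is_cell_root \<sigma> b c (q \<sigma>)"
begin

lemmas Y_simps = plus_complex_simps[of \<epsilon>, where ?'k = 'k, folded Y]

lemma component:
  assumes "y \<in> carrier (obj Y j)" "\<sigma> \<in> cells_in_degree j"
  shows "lookup (Abs_poly_mapping (y \<sigma>)) = y \<sigma>" "Abs_poly_mapping (y \<sigma>) \<in> keys_in (normal_monoid C M \<sigma>)"
  using norm_module_Abs[of "y \<sigma>" \<sigma>] assms unfolding Y_simps by auto

lemma q_keys: "\<sigma> \<in> X \<Longrightarrow> q \<sigma> \<in> keys_in (normal_monoid C M \<sigma>)"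
  using q by (simp add: is_cell_root_def)

lemma root_action_closed:
  assumes "y \<in> carrier (obj Y j)"
  shows "root_action q j y \<in> carrier (obj Y j)"
  unfolding Y_simps
proof (rule PiE_I)
  fix \<sigma> assume \<sigma>: "\<sigma> \<in> cells_in_degree j"
  note X = cells_in_degreeD[OF \<sigma>]
  have "q \<sigma> * Abs_poly_mapping (y \<sigma>) \<in> keys_in (normal_monoid C M \<sigma>)"
    by (rule keys_in_mult[OF normal_monoid_facts(1)[OF X] q_keys[OF X] component(2)[OF assms \<sigma>]])
  then show "root_action q j y \<sigma> \<in> carrier (norm_module \<sigma>)"
    using \<sigma> by (simp add: root_action_def norm_module_lookup)
qed (simp add: root_action_def)

lemma smult_component:
  fixes r :: "'x exponent \<Rightarrow> 'k"
  assumes "r \<in> carrier face_ring" "y \<in> carrier (obj Y j)" "\<sigma> \<in> cells_in_degree j"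
  shows "(r \<odot>\<^bsub>obj Y j\<^esub> y) \<sigma> = lookup (cell_poly \<sigma> r * Abs_poly_mapping (y \<sigma>))"
  using norm_module_smult[OF assms(1) cells_in_degreeD[OF assms(3)], of "Abs_poly_mapping (y \<sigma>)"]
    component(1)[OF assms(2,3)] assms(3) by (simp add: Y_simps)

lemma root_action_hom: "root_action q j \<in> mod_hom face_ring (obj Y j) (obj Y j)"
proof (rule mod_homI)
  show "root_action q j y \<in> carrier (obj Y j)" if "y \<in> carrier (obj Y j)" for y
    by (rule root_action_closed[OF that])
next
  fix y z assume yz: "y \<in> carrier (obj Y j)" "z \<in> carrier (obj Y j)"
  show "root_action q j (y \<oplus>\<^bsub>obj Y j\<^esub> z) = root_action q j y \<oplus>\<^bsub>obj Y j\<^esub> root_action q j z"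
  proof
    fix \<sigma>
    show "root_action q j (y \<oplus>\<^bsub>obj Y j\<^esub> z) \<sigma> = (root_action q j y \<oplus>\<^bsub>obj Y j\<^esub> root_action q j z) \<sigma>"
    proof (cases "\<sigma> \<in> cells_in_degree j")
      case \<sigma>: True
      let ?y = "Abs_poly_mapping (y \<sigma>)" and ?z = "Abs_poly_mapping (z \<sigma>)"
      have "(y \<oplus>\<^bsub>obj Y j\<^esub> z) \<sigma> = lookup (?y + ?z)"
        using \<sigma> component(1)[OF yz(1) \<sigma>] component(1)[OF yz(2) \<sigma>]
        by (simp add: Y_simps norm_module_simps(2) fun_eq_iff lookup_add)
      then have "root_action q j (y \<oplus>\<^bsub>obj Y j\<^esub> z) \<sigma> = lookup (q \<sigma> * ?y + q \<sigma> * ?z)"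
        using \<sigma>
        by (simp only: root_action_def restrict_apply' poly_mapping.lookup_inverse distrib_left)
      then show ?thesis
        using \<sigma> by (simp add: Y_simps norm_module_simps(2) fun_eq_iff lookup_add root_action_def)
    qed (simp add: root_action_def Y_simps)
  qed
next
  fix r :: "'x exponent \<Rightarrow> 'k" and y assume ry: "r \<in> carrier face_ring" "y \<in> carrier (obj Y j)"
  show "root_action q j (r \<odot>\<^bsub>obj Y j\<^esub> y) = r \<odot>\<^bsub>obj Y j\<^esub> root_action q j y"
  proof
    fix \<sigma>
    show "root_action q j (r \<odot>\<^bsub>obj Y j\<^esub> y) \<sigma> = (r \<odot>\<^bsub>obj Y j\<^esub> root_action q j y) \<sigma>"
    proof (cases "\<sigma> \<in> cells_in_degree j")
      case \<sigma>: True
      let ?y = "Abs_poly_mapping (y \<sigma>)"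
      have "root_action q j (r \<odot>\<^bsub>obj Y j\<^esub> y) \<sigma> = lookup (q \<sigma> * (cell_poly \<sigma> r * ?y))"
        using \<sigma> smult_component[OF ry \<sigma>]
        by (simp only: root_action_def restrict_apply' poly_mapping.lookup_inverse)
      also have "\<dots> = lookup (cell_poly \<sigma> r * (q \<sigma> * ?y))" by (simp only: mult.left_commute)
      also have "\<dots> = (r \<odot>\<^bsub>obj Y j\<^esub> root_action q j y) \<sigma>"
        using \<sigma> smult_component[OF ry(1) root_action_closed[OF ry(2)] \<sigma>]
        by (simp only: root_action_def restrict_apply' poly_mapping.lookup_inverse)
      finally show ?thesis .
    qed (simp add: root_action_def Y_simps)
  qed
qed

text \<open>On each summand of the differential this is \<open>face_projection_root_mult\<close>.\<close>

lemma root_action_diff: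
  assumes y: "y \<in> carrier (obj Y j)"
  shows "root_action q (j + 1) (diff Y j y) = diff Y j (root_action q j y)"
proof
  fix \<tau>
  show "root_action q (j + 1) (diff Y j y) \<tau> = diff Y j (root_action q j y) \<tau>"
  proof (cases "\<tau> \<in> cells_in_degree (j + 1)")
    case \<tau>: True
    have \<tau>X: "\<tau> \<in> X" by (rule cells_in_degreeD[OF \<tau>])
    let ?I = "{\<sigma> \<in> cells_in_degree j. cell_le T \<tau> \<sigma>}"
    let ?e = "\<lambda>\<sigma>. single 0 (of_int (\<epsilon> \<sigma> \<tau>) :: 'k)"
    define F where "F \<sigma> = Abs_poly_mapping (face_projection C \<iota> M \<tau> \<sigma> (y \<sigma>))" for \<sigma>
    have F: "lookup (F \<sigma>) = face_projection C \<iota> M \<tau> \<sigma> (y \<sigma>)" if \<sigma>: "\<sigma> \<in> ?I" for \<sigma>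
    proof -
      have X: "\<sigma> \<in> X" and le: "cell_le T \<tau> \<sigma>" and deg: "\<sigma> \<in> cells_in_degree j"
        using \<sigma> cells_in_degreeD by auto
      have "{c. face_projection C \<iota> M \<tau> \<sigma> (y \<sigma>) c \<noteq> 0} \<subseteq> keys (pull \<sigma> \<tau> (Abs_poly_mapping (y \<sigma>)))"
        using normal_monoid_facts(3)[OF \<tau>X]
        by (auto simp: face_projection_def in_keys_iff lookup_pull[OF X \<tau>X le] component(1)[OF y deg]
            split: if_splits)
      then have "finite {c. face_projection C \<iota> M \<tau> \<sigma> (y \<sigma>) c \<noteq> 0}" by (rule finite_subset) simp
      then show ?thesis by (simp add: F_def)
    qed
    have dy: "diff Y j y \<tau> = lookup (\<Sum>\<sigma>\<in>?I. ?e \<sigma> * F \<sigma>)"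
    proof
      fix x
      have "diff Y j y \<tau> x = (\<Sum>\<sigma>\<in>?I. of_int (\<epsilon> \<sigma> \<tau>) * face_projection C \<iota> M \<tau> \<sigma> (y \<sigma>) x)"
        using \<tau> by (simp add: Y_simps)
      also have "\<dots> = (\<Sum>\<sigma>\<in>?I. lookup (?e \<sigma> * F \<sigma>) x)"
        by (rule sum.cong[OF refl]) (simp only: lookup_scalar_mult F)
      finally show "diff Y j y \<tau> x = lookup (\<Sum>\<sigma>\<in>?I. ?e \<sigma> * F \<sigma>) x" by (simp only: lookup_sum)
    qed
    show ?thesis
    proof
      fix x
      have "root_action q (j + 1) (diff Y j y) \<tau> x = lookup (q \<tau> * (\<Sum>\<sigma>\<in>?I. ?e \<sigma> * F \<sigma>)) x"
        using \<tau> dy by (simp only: root_action_def restrict_apply' poly_mapping.lookup_inverse)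
      also have "\<dots> = (\<Sum>\<sigma>\<in>?I. lookup (?e \<sigma> * (q \<tau> * F \<sigma>)) x)"
        by (simp only: sum_distrib_left lookup_sum mult.left_commute[of "q \<tau>"])
      also have "\<dots> = (\<Sum>\<sigma>\<in>?I. of_int (\<epsilon> \<sigma> \<tau>) * face_projection C \<iota> M \<tau> \<sigma> (root_action q j y \<sigma>) x)"
      proof (rule sum.cong[OF refl])
        fix \<sigma> assume \<sigma>: "\<sigma> \<in> ?I"
        then have X: "\<sigma> \<in> X" and le: "cell_le T \<tau> \<sigma>" and deg: "\<sigma> \<in> cells_in_degree j"
          using cells_in_degreeD by auto
        have "lookup (F \<sigma>) = face_projection C \<iota> M \<tau> \<sigma> (lookup (Abs_poly_mapping (y \<sigma>)))"
          unfolding component(1)[OF y deg] by (rule F[OF \<sigma>])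
        from face_projection_root_mult[OF X \<tau>X le bc q[OF X] q[OF \<tau>X] component(2)[OF y deg] this]
        have "face_projection C \<iota> M \<tau> \<sigma> (root_action q j y \<sigma>) = lookup (q \<tau> * F \<sigma>)"
          using deg by (simp only: root_action_def restrict_apply')
        then show "lookup (?e \<sigma> * (q \<tau> * F \<sigma>)) x =
            of_int (\<epsilon> \<sigma> \<tau>) * face_projection C \<iota> M \<tau> \<sigma> (root_action q j y \<sigma>) x"
          by (simp only: lookup_scalar_mult)
      qed
      also have "\<dots> = diff Y j (root_action q j y) \<tau> x" using \<tau> by (simp add: Y_simps)
      finally show "root_action q (j + 1) (diff Y j y) \<tau> x = diff Y j (root_action q j y) \<tau> x" .
    qed
  qed (simp add: root_action_def Y_simps)
qed

lemma root_action_chain_map: "chain_map face_ring Y Y (root_action q)"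
proof (rule chain_mapI[OF Yc Yc])
  show "root_action q j \<in> mod_hom face_ring (obj Y j) (obj Y j)" for j by (rule root_action_hom)
  show "root_action q (j + 1) (diff Y j y) = diff Y j (root_action q j y)"
    if "y \<in> carrier (obj Y j)" for j y
    by (rule root_action_diff[OF that])
qed

lemma smult_root_action:
  assumes R: "cring (face_ring :: ('x exponent \<Rightarrow> 'k) ring)"
    and as: "a \<in> carrier face_ring" "s \<in> carrier face_ring"
    and eqs: "a \<otimes>\<^bsub>face_ring\<^esub> a = b \<otimes>\<^bsub>face_ring\<^esub> (s \<otimes>\<^bsub>face_ring\<^esub> s)"
      "a \<otimes>\<^bsub>face_ring\<^esub> (a \<otimes>\<^bsub>face_ring\<^esub> a) = c \<otimes>\<^bsub>face_ring\<^esub> (s \<otimes>\<^bsub>face_ring\<^esub> (s \<otimes>\<^bsub>face_ring\<^esub> s))"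
    and y: "y \<in> carrier (obj Y j)"
  shows "s \<odot>\<^bsub>obj Y j\<^esub> root_action q j y = a \<odot>\<^bsub>obj Y j\<^esub> y"
proof
  fix \<sigma>
  show "(s \<odot>\<^bsub>obj Y j\<^esub> root_action q j y) \<sigma> = (a \<odot>\<^bsub>obj Y j\<^esub> y) \<sigma>"
  proof (cases "\<sigma> \<in> cells_in_degree j")
    case \<sigma>: True
    note X = cells_in_degreeD[OF \<sigma>]
    let ?y = "Abs_poly_mapping (y \<sigma>)"
    have "(s \<odot>\<^bsub>obj Y j\<^esub> root_action q j y) \<sigma> = lookup (cell_poly \<sigma> s * (q \<sigma> * ?y))"
      using \<sigma> smult_component[OF as(2) root_action_closed[OF y] \<sigma>]
      by (simp only: root_action_def restrict_apply' poly_mapping.lookup_inverse)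
    also have "\<dots> = lookup (cell_poly \<sigma> a * ?y)"
      unfolding cell_root_mult[OF R X as bc eqs q[OF X], symmetric] mult.assoc ..
    also have "\<dots> = (a \<odot>\<^bsub>obj Y j\<^esub> y) \<sigma>" by (rule smult_component[OF as(1) y \<sigma>, symmetric])
    finally show ?thesis .
  qed (simp add: Y_simps)
qed

end

theorem face_ring_seminormal:
  fixes D :: "('x exponent \<Rightarrow> 'k::field, 'd) cochain"
  assumes D: "dualizing_complex face_ring D"
    and der: "derived_isomorphic TYPE('z) face_ring (plus_complex \<epsilon>) D"
  shows "seminormal (face_ring :: ('x exponent \<Rightarrow> 'k) ring)"
proof -
  \<comment> \<open>Modules are taken over commutative rings only, so D provides the ring axioms.\<close>
  have "module face_ring (obj D 0)"
    using D cochain_complexD(1) unfolding dualizing_complex_def by blast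
  then have R: "cring (face_ring :: ('x exponent \<Rightarrow> 'k) ring)" by (rule module.axioms)
  have Yc: "cochain_complex face_ring (plus_complex \<epsilon> :: ('x exponent \<Rightarrow> 'k, _) cochain)"
    using der by (auto simp: derived_isomorphic_def quasi_iso_def chain_map_def)
  show ?thesis
  proof (rule cring.seminormalI[OF R face_ring_reduced[OF R] face_ring_noetherian[OF R]])
    fix a s b c :: "'x exponent \<Rightarrow> 'k"
    assume car: "a \<in> carrier face_ring" "s \<in> carrier face_ring" "b \<in> carrier face_ring" "c \<in> carrier face_ring"
      and eqs: "a \<otimes>\<^bsub>face_ring\<^esub> a = b \<otimes>\<^bsub>face_ring\<^esub> (s \<otimes>\<^bsub>face_ring\<^esub> s)"
        "a \<otimes>\<^bsub>face_ring\<^esub> (a \<otimes>\<^bsub>face_ring\<^esub> a) = c \<otimes>\<^bsub>face_ring\<^esub> (s \<otimes>\<^bsub>face_ring\<^esub> (s \<otimes>\<^bsub>face_ring\<^esub> s))"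
        "b \<otimes>\<^bsub>face_ring\<^esub> (b \<otimes>\<^bsub>face_ring\<^esub> b) = c \<otimes>\<^bsub>face_ring\<^esub> c"
    have "\<forall>\<sigma>. \<exists>q. \<sigma> \<in> X \<longrightarrow> is_cell_root \<sigma> b c q"
      using cell_root_exists[OF R _ car(3,4) eqs(3)] by auto
    from choice[OF this] obtain q where "\<forall>\<sigma>. \<sigma> \<in> X \<longrightarrow> is_cell_root \<sigma> b c (q \<sigma>)" ..
    then have q: "\<And>\<sigma>. \<sigma> \<in> X \<Longrightarrow> is_cell_root \<sigma> b c (q \<sigma>)" by simp
    show "\<exists>r\<in>carrier face_ring. a = s \<otimes>\<^bsub>face_ring\<^esub> r"
      by (rule dualizing_complex_divides[OF D der root_action_chain_map[OF refl Yc car(3,4) q] car(2,1)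
            smult_root_action[OF refl Yc car(3,4) q R car(1,2) eqs(1,2)]])
  qed
qed

end


section \<open>Seminormality from duality\<close>

theorem proposition5p12:
  fixes T :: "'x topology" and X :: "'x set set"
    and C :: "'x set \<Rightarrow> (nat \<Rightarrow> real) set"
    and \<iota> :: "'x set \<Rightarrow> 'x set \<Rightarrow> (nat \<Rightarrow> real) \<Rightarrow> (nat \<Rightarrow> real)"
    and M :: "'x set \<Rightarrow> (nat \<Rightarrow> real) set"
    and \<epsilon> :: "'x set \<Rightarrow> 'x set \<Rightarrow> int"
    and R :: "('x exponent \<Rightarrow> 'k::field) ring"
    and D :: "('x exponent \<Rightarrow> 'k, 'd) cochain"
  assumes "monoidal_complex T X C \<iota> M"
    and "incidence_function T X \<epsilon>"
    and "R = toric_face_ring T X \<iota> M"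
    and "normalized_dualizing_complex R D"
    and "derived_isomorphic TYPE('z) R (plus_I T X C \<iota> M \<epsilon>) D"
  shows "seminormal R"
proof -
  have "dualizing_complex (toric_face_ring T X \<iota> M) D"
    using assms(3,4) by (simp add: normalized_dualizing_complex_def)
  then show ?thesis
    unfolding assms(3)
    by (rule monoidal_complex.face_ring_seminormal[OF assms(1) _ assms(5)[unfolded assms(3)]])
qed

end
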